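(* Assume the balanced setting: $G$ is balanced, all weights $a_{N,n}$ are radial, and all polynomials belong to $H(a_{N,n})_0(G)$ for all $N,n$. Consider the following statements. (i) $\operatorname{Proj}^1\mathcal{A}_0H=0$. (ii) $(AH)_0(G)$ is ultrabornological. (iii) $(AH)_0(G)$ is barrelled. (iv) $\mathcal{A}$ satisfies condition $(\mathrm{wQ})^{\sim}_{\mathrm{in}}$. Then (i)$\Rightarrow$(ii)$\Rightarrow$(iii)$\Rightarrow$(iv).
   Context: $\mathbb{N}=\{1,2,\dots\}$. $G$ is a non-empty open subset of $\mathbb{C}^d$, $d\geq 1$; $H(G)$ is the space of holomorphic functions on $G$, and co denotes the topology of uniform convergence on compact subsets of $G$. A weight on $G$ is a strictly positive continuous function on $G$. For a weight $a$: $Ha(G)=\{f\in H(G): \|f\|_a:=\sup_{z\in G}a(z)|f(z)|<\infty\}$, a Banach space with norm $\|\cdot\|_a$, and $Ha_0(G)=\{f\in H(G): a|f| \text{ vanishes at } \infty\text{ on } G\}$, a closed subspace. ($g\colon G\to\mathbb{R}$ vanishes at $\infty$ on $G$ if for each $\varepsilon>0$ there is a compact $K\subseteq G$ with $|g(z)|<\varepsilon$ for $z\in G\setminus K$.) $\mathcal{A}=((a_{N,n})_{n\in\mathbb{N}})_{N\in\mathbb{N}}$ is a double sequence of weights on $G$ with $a_{N,n+1}\leq a_{N,n}\leq a_{N+1,n}$ for all $N,n$. Put $(\mathcal{A}_N)_0H(G):=\operatorname{ind}_n H(a_{N,n})_0(G)$ (locally convex inductive limit). $\mathcal{A}_0H=((\mathcal{A}_N)_0H(G))_{N\in\mathbb{N}}$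 is the projective spectrum with inclusions $(\mathcal{A}_{N+1})_0H(G)\subseteq(\mathcal{A}_N)_0H(G)$ as linking maps, and $(AH)_0(G):=\operatorname{proj}_N(\mathcal{A}_N)_0H(G)$ is its locally convex projective limit. For a projective spectrum $\mathcal{X}=(X_N)_{N\in\mathbb{N}}$ with inclusions as linking maps, $\operatorname{Proj}^1\mathcal{X}:=\big(\prod_{N}X_N\big)/\operatorname{im}\sigma$, where $\sigma\colon\prod_N X_N\to\prod_N X_N$, $\sigma((x_N)_N)=(x_{N+1}-x_N)_N$. Balanced setting: $G$ is balanced ($\lambda z\in G$ for $z\in G$, $|\lambda|\leq 1$), each weight $a$ in $\mathcal{A}$ is radial ($a(\lambda z)=a(z)$ for $|\lambda|=1$), the Banach space topologies of the spaces $Ha_{N,n}(G)$ are stronger than co, and the polynomials are contained in all the spaces $H(a_{N,n})_0(G)$. For a strictly positive continuous function $w$ on $G$, $\tilde w(z)=(w)^{\sim}(z):=\sup\{|g(z)|: g\in H(G),\ |g|\leq w \text{ on } G\}$. Condition $(\mathrm{wQ})^{\sim}_{\mathrm{in}}$: for every $N$ there exist $M\geq N$ and $n$ such that for all $K\geq M$ and $m$ there exist $k$ and $S>0$ with $$\Big(\frac{1}{a_{M,m}}\Big)^{\sim}\leq S\max\Big(\Big(\frac{1}{a_{N,n}}\Big)^{\sim},\Big(\frac{1}{a_{K,k}}\Big)^{\sim}\Big)\quad\text{on } G.$$ *)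

theory Defs
  imports "HOL-Analysis.Analysis" "HOL-Library.Function_Algebras"
begin

section \<open>Locally convex spaces over the complex numbers\<close>

text \<open>
  The spaces below are linear subspaces of an ambient complex vector space \<open>'v\<close>; a topological
  vector space is represented by its topology \<open>T\<close>, with underlying linear space \<open>topspace T\<close>.
  No Hausdorff condition is built in.
\<close>

locale complex_space = vector_space scale
  for scale :: "complex \<Rightarrow> 'v::ab_group_add \<Rightarrow> 'v"  (infixr \<open>*C\<close> 75)
begin

definition absolutely_convex :: "'v set \<Rightarrow> bool" where
  "absolutely_convex A \<longleftrightarrow>
     (\<forall>x\<in>A. \<forall>y\<in>A. \<forall>\<alpha> \<beta>. cmod \<alpha> + cmod \<beta> \<le> 1 \<longrightarrow> \<alpha> *C x + \<beta> *C y \<in> A)"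

definition absorbs :: "'v set \<Rightarrow> 'v set \<Rightarrow> bool" where
  "absorbs A B \<longleftrightarrow> (\<exists>r>0. \<forall>c. r \<le> cmod c \<longrightarrow> B \<subseteq> (*C) c ` A)"

definition zero_nbhd :: "'v topology \<Rightarrow> 'v set \<Rightarrow> bool" where
  "zero_nbhd T V \<longleftrightarrow> V \<subseteq> topspace T \<and> (\<exists>U. openin T U \<and> 0 \<in> U \<and> U \<subseteq> V)"

definition vector_topology :: "'v topology \<Rightarrow> bool" where
  "vector_topology T \<longleftrightarrow>
     subspace (topspace T) \<and>
     continuous_map (prod_topology T T) T (\<lambda>(x, y). x + y) \<and>
     continuous_map (prod_topology euclidean T) T (\<lambda>(c, x). c *C x)"

definition locally_convex :: "'v topology \<Rightarrow> bool" where
  "locally_convex T \<longleftrightarrow>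
     vector_topology T \<and>
     (\<forall>V. zero_nbhd T V \<longrightarrow> (\<exists>W\<subseteq>V. zero_nbhd T W \<and> absolutely_convex W))"

definition bounded_set :: "'v topology \<Rightarrow> 'v set \<Rightarrow> bool" where
  "bounded_set T B \<longleftrightarrow> B \<subseteq> topspace T \<and> (\<forall>V. zero_nbhd T V \<longrightarrow> absorbs V B)"

definition norm_on :: "'v set \<Rightarrow> ('v \<Rightarrow> real) \<Rightarrow> bool" where
  "norm_on X p \<longleftrightarrow>
     subspace X \<and>
     (\<forall>x\<in>X. 0 \<le> p x \<and> (p x = 0 \<longrightarrow> x = 0)) \<and>
     (\<forall>x\<in>X. \<forall>c. p (c *C x) = cmod c * p x) \<and>
     (\<forall>x\<in>X. \<forall>y\<in>X. p (x + y) \<le> p x + p y)"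

definition banach_on :: "'v set \<Rightarrow> ('v \<Rightarrow> real) \<Rightarrow> bool" where
  "banach_on X p \<longleftrightarrow>
     norm_on X p \<and>
     (\<forall>u::nat \<Rightarrow> 'v. range u \<subseteq> X \<and> (\<forall>e>0. \<exists>n0. \<forall>m\<ge>n0. \<forall>n\<ge>n0. p (u m - u n) < e) \<longrightarrow>
        (\<exists>l\<in>X. (\<lambda>n. p (u n - l)) \<longlonglongrightarrow> 0))"

definition gauge_of :: "'v set \<Rightarrow> 'v \<Rightarrow> real" where
  "gauge_of B x = Inf {t. 0 < t \<and> x \<in> (*C) (complex_of_real t) ` B}"

definition banach_disc :: "'v topology \<Rightarrow> 'v set \<Rightarrow> bool" where
  "banach_disc T B \<longleftrightarrow>
     absolutely_convex B \<and> bounded_set T B \<and> banach_on (span B) (gauge_of B)"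

definition ultrabornological :: "'v topology \<Rightarrow> bool" where
  "ultrabornological T \<longleftrightarrow>
     locally_convex T \<and>
     (\<forall>A. A \<subseteq> topspace T \<and> absolutely_convex A \<and> (\<forall>B. banach_disc T B \<longrightarrow> absorbs A B)
        \<longrightarrow> zero_nbhd T A)"

definition barrel :: "'v topology \<Rightarrow> 'v set \<Rightarrow> bool" where
  "barrel T A \<longleftrightarrow>
     closedin T A \<and> absolutely_convex A \<and> (\<forall>x\<in>topspace T. absorbs A {x})"

definition barrelled :: "'v topology \<Rightarrow> bool" where
  "barrelled T \<longleftrightarrow> locally_convex T \<and> (\<forall>A. barrel T A \<longrightarrow> zero_nbhd T A)"

text \<open>
  The locally convex inductive limit of an increasing sequence of spaces (with inclusions as linking
  maps): the supremum of all locally convex topologies on the union for which every inclusion is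
  continuous, that is, the finest such topology.
\<close>

definition inductive_limit :: "(nat \<Rightarrow> 'v topology) \<Rightarrow> 'v topology" where
  "inductive_limit T = topology_generated_by
     {U. \<exists>S. locally_convex S \<and> topspace S = (\<Union>n. topspace (T n)) \<and>
             (\<forall>n. continuous_map (T n) S id) \<and> openin S U}"

text \<open>
  The projective limit of a sequence of spaces with inclusions as linking maps: the intersection,
  with the coarsest topology for which every inclusion is continuous.
\<close>

definition projective_limit :: "(nat \<Rightarrow> 'v topology) \<Rightarrow> 'v topology" where
  "projective_limit T = topology_generated_by
     {U \<inter> (\<Inter>N. topspace (T N)) | U N. openin (T N) U}"

end

definition norm_topology :: "'v::ab_group_add set \<Rightarrow> ('v \<Rightarrow> real) \<Rightarrow> 'v topology" where
  "norm_topology X p =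
     topology (\<lambda>U. U \<subseteq> X \<and> (\<forall>x\<in>U. \<exists>r>0. \<forall>y\<in>X. p (y - x) < r \<longrightarrow> y \<in> U))"

lemma openin_norm_topology:
  "openin (norm_topology X p) U \<longleftrightarrow>
     U \<subseteq> X \<and> (\<forall>x\<in>U. \<exists>r>0. \<forall>y\<in>X. p (y - x) < r \<longrightarrow> y \<in> U)"
proof -
  have "istopology (\<lambda>U. U \<subseteq> X \<and> (\<forall>x\<in>U. \<exists>r>0. \<forall>y\<in>X. p (y - x) < r \<longrightarrow> y \<in> U))"
    unfolding istopology_def
  proof (intro conjI allI impI)
    fix S T
    assume S: "S \<subseteq> X \<and> (\<forall>x\<in>S. \<exists>r>0. \<forall>y\<in>X. p (y - x) < r \<longrightarrow> y \<in> S)"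
      and T: "T \<subseteq> X \<and> (\<forall>x\<in>T. \<exists>r>0. \<forall>y\<in>X. p (y - x) < r \<longrightarrow> y \<in> T)"
    show "S \<inter> T \<subseteq> X" using S by blast
    show "\<forall>x\<in>S \<inter> T. \<exists>r>0. \<forall>y\<in>X. p (y - x) < r \<longrightarrow> y \<in> S \<inter> T"
    proof
      fix x assume x: "x \<in> S \<inter> T"
      obtain r where "r > 0" "\<forall>y\<in>X. p (y - x) < r \<longrightarrow> y \<in> S" using S x by blast
      moreover obtain q where "q > 0" "\<forall>y\<in>X. p (y - x) < q \<longrightarrow> y \<in> T" using T x by blast
      ultimately show "\<exists>r>0. \<forall>y\<in>X. p (y - x) < r \<longrightarrow> y \<in> S \<inter> T"
        by (intro exI[of _ "min r q"]) auto
    qed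
  next
    fix \<K>
    assume K: "\<forall>S\<in>\<K>. S \<subseteq> X \<and> (\<forall>x\<in>S. \<exists>r>0. \<forall>y\<in>X. p (y - x) < r \<longrightarrow> y \<in> S)"
    show "\<Union>\<K> \<subseteq> X" using K by blast
    show "\<forall>x\<in>\<Union>\<K>. \<exists>r>0. \<forall>y\<in>X. p (y - x) < r \<longrightarrow> y \<in> \<Union>\<K>"
    proof
      fix x assume "x \<in> \<Union>\<K>"
      then obtain S where S: "S \<in> \<K>" "x \<in> S" by blast
      with K obtain r where "r > 0" "\<forall>y\<in>X. p (y - x) < r \<longrightarrow> y \<in> S" by blast
      with S(1) show "\<exists>r>0. \<forall>y\<in>X. p (y - x) < r \<longrightarrow> y \<in> \<Union>\<K>"
        by (intro exI[of _ r]) auto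
    qed
  qed
  then show ?thesis
    by (simp add: norm_topology_def)
qed

section \<open>The first derived projective limit\<close>

definition spectrum_diff :: "(nat \<Rightarrow> 'v::ab_group_add) \<Rightarrow> nat \<Rightarrow> 'v" where
  "spectrum_diff x = (\<lambda>N. x (Suc N) - x N)"

definition Proj1 :: "(nat \<Rightarrow> 'v::ab_group_add set) \<Rightarrow> (nat \<Rightarrow> 'v) set set" where
  "Proj1 X = Pi UNIV X //
     {(x, y). x \<in> Pi UNIV X \<and> y \<in> Pi UNIV X \<and> x - y \<in> spectrum_diff ` Pi UNIV X}"

text \<open>The zero element of the quotient space is the coset \<open>im \<sigma>\<close>.\<close>

definition Proj1_is_zero :: "(nat \<Rightarrow> 'v::ab_group_add set) \<Rightarrow> bool" where
  "Proj1_is_zero X \<longleftrightarrow> Proj1 X = {spectrum_diff ` Pi UNIV X}"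

section \<open>Weighted spaces of holomorphic functions\<close>

global_interpretation cfun: complex_space "\<lambda>(c::complex) (f::'x \<Rightarrow> complex) z. c * f z"
  by unfold_locales (auto simp: fun_eq_iff algebra_simps)

text \<open>A function on \<open>G\<close> is represented by its extension by \<open>0\<close> to all of \<open>\<complex>\<^sup>d\<close>.\<close>

definition zero_ext :: "'x set \<Rightarrow> ('x \<Rightarrow> complex) \<Rightarrow> 'x \<Rightarrow> complex" where
  "zero_ext G f = (\<lambda>z. if z \<in> G then f z else 0)"

definition Hol :: "(complex ^ 'd) set \<Rightarrow> (complex ^ 'd \<Rightarrow> complex) set" where
  "Hol G = {f. (\<forall>z\<in>G. \<exists>f'. (f has_derivative f') (at z) \<and> (\<forall>c h. f' (c *s h) = c * f' h)) \<and>
               (\<forall>z. z \<notin> G \<longrightarrow> f z = 0)}"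

definition co_topology :: "(complex ^ 'd) set \<Rightarrow> (complex ^ 'd \<Rightarrow> complex) topology" where
  "co_topology G = topology (\<lambda>U. U \<subseteq> Hol G \<and>
     (\<forall>f\<in>U. \<exists>K e. compact K \<and> K \<subseteq> G \<and> 0 < e \<and>
        (\<forall>g\<in>Hol G. (\<forall>z\<in>K. cmod (g z - f z) < e) \<longrightarrow> g \<in> U)))"

lemma openin_co_topology:
  "openin (co_topology G) U \<longleftrightarrow> U \<subseteq> Hol G \<and>
     (\<forall>f\<in>U. \<exists>K e. compact K \<and> K \<subseteq> G \<and> 0 < e \<and>
        (\<forall>g\<in>Hol G. (\<forall>z\<in>K. cmod (g z - f z) < e) \<longrightarrow> g \<in> U))"
proof -
  let ?P = "\<lambda>U f. \<exists>K e. compact K \<and> K \<subseteq> G \<and> 0 < e \<and>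
        (\<forall>g\<in>Hol G. (\<forall>z\<in>K. cmod (g z - f z) < e) \<longrightarrow> g \<in> U)"
  have "istopology (\<lambda>U. U \<subseteq> Hol G \<and> (\<forall>f\<in>U. ?P U f))"
    unfolding istopology_def
  proof (intro conjI allI impI)
    fix S T
    assume S: "S \<subseteq> Hol G \<and> (\<forall>f\<in>S. ?P S f)" and T: "T \<subseteq> Hol G \<and> (\<forall>f\<in>T. ?P T f)"
    show "S \<inter> T \<subseteq> Hol G" using S by blast
    show "\<forall>f\<in>S \<inter> T. ?P (S \<inter> T) f"
    proof
      fix f assume f: "f \<in> S \<inter> T"
      obtain K e where "compact K" "K \<subseteq> G" "0 < e"
        "\<forall>g\<in>Hol G. (\<forall>z\<in>K. cmod (g z - f z) < e) \<longrightarrow> g \<in> S" using S f by blast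
      moreover obtain L d where "compact L" "L \<subseteq> G" "0 < d"
        "\<forall>g\<in>Hol G. (\<forall>z\<in>L. cmod (g z - f z) < d) \<longrightarrow> g \<in> T" using T f by blast
      ultimately show "?P (S \<inter> T) f"
        by (intro exI[of _ "K \<union> L"] exI[of _ "min e d"]) (auto intro: compact_Un)
    qed
  next
    fix \<K>
    assume K: "\<forall>S\<in>\<K>. S \<subseteq> Hol G \<and> (\<forall>f\<in>S. ?P S f)"
    show "\<Union>\<K> \<subseteq> Hol G" using K by blast
    show "\<forall>f\<in>\<Union>\<K>. ?P (\<Union>\<K>) f"
    proof
      fix f assume "f \<in> \<Union>\<K>"
      then obtain S where S: "S \<in> \<K>" "f \<in> S" by blast
      with K have "?P S f" by blast
      then obtain K' e where "compact K'" "K' \<subseteq> G" "0 < e"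
        "\<forall>g\<in>Hol G. (\<forall>z\<in>K'. cmod (g z - f z) < e) \<longrightarrow> g \<in> S" by blast
      with S(1) show "?P (\<Union>\<K>) f"
        by (intro exI[of _ K'] exI[of _ e]) auto
    qed
  qed
  then show ?thesis
    by (simp add: co_topology_def)
qed

definition weight_on :: "(complex ^ 'd) set \<Rightarrow> (complex ^ 'd \<Rightarrow> real) \<Rightarrow> bool" where
  "weight_on G a \<longleftrightarrow> continuous_on G a \<and> (\<forall>z\<in>G. 0 < a z)"

definition vanishes_at_infinity_on :: "(complex ^ 'd) set \<Rightarrow> (complex ^ 'd \<Rightarrow> real) \<Rightarrow> bool" where
  "vanishes_at_infinity_on G g \<longleftrightarrow>
     (\<forall>e>0. \<exists>K. compact K \<and> K \<subseteq> G \<and> (\<forall>z\<in>G - K. \<bar>g z\<bar> < e))"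

definition wnorm :: "(complex ^ 'd) set \<Rightarrow> (complex ^ 'd \<Rightarrow> real) \<Rightarrow> (complex ^ 'd \<Rightarrow> complex) \<Rightarrow> real" where
  "wnorm G a f = (SUP z\<in>G. a z * cmod (f z))"

definition Ha :: "(complex ^ 'd) set \<Rightarrow> (complex ^ 'd \<Rightarrow> real) \<Rightarrow> (complex ^ 'd \<Rightarrow> complex) set" where
  "Ha G a = {f \<in> Hol G. bdd_above ((\<lambda>z. a z * cmod (f z)) ` G)}"

definition Ha0 :: "(complex ^ 'd) set \<Rightarrow> (complex ^ 'd \<Rightarrow> real) \<Rightarrow> (complex ^ 'd \<Rightarrow> complex) set" where
  "Ha0 G a = {f \<in> Hol G. vanishes_at_infinity_on G (\<lambda>z. a z * cmod (f z))}"

text \<open>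
  Double sequences are indexed from \<open>0\<close> instead of from \<open>1\<close>. The first index of \<open>a N n\<close> is the
  projective one, the second the inductive one.
\<close>

definition A0H :: "(complex ^ 'd) set \<Rightarrow> (nat \<Rightarrow> nat \<Rightarrow> complex ^ 'd \<Rightarrow> real) \<Rightarrow>
    nat \<Rightarrow> (complex ^ 'd \<Rightarrow> complex) topology" where
  "A0H G a N = cfun.inductive_limit (\<lambda>n. norm_topology (Ha0 G (a N n)) (wnorm G (a N n)))"

definition AH0 :: "(complex ^ 'd) set \<Rightarrow> (nat \<Rightarrow> nat \<Rightarrow> complex ^ 'd \<Rightarrow> real) \<Rightarrow>
    (complex ^ 'd \<Rightarrow> complex) topology" where
  "AH0 G a = cfun.projective_limit (A0H G a)"

definition weight_double_sequence ::
    "(complex ^ 'd) set \<Rightarrow> (nat \<Rightarrow> nat \<Rightarrow> complex ^ 'd \<Rightarrow> real) \<Rightarrow> bool" where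
  "weight_double_sequence G a \<longleftrightarrow>
     (\<forall>N n. weight_on G (a N n)) \<and>
     (\<forall>N n. \<forall>z\<in>G. a N (Suc n) z \<le> a N n z \<and> a N n z \<le> a (Suc N) n z)"

definition balanced_set :: "(complex ^ 'd) set \<Rightarrow> bool" where
  "balanced_set G \<longleftrightarrow> (\<forall>z\<in>G. \<forall>c. cmod c \<le> 1 \<longrightarrow> c *s z \<in> G)"

definition radial_on :: "(complex ^ 'd) set \<Rightarrow> (complex ^ 'd \<Rightarrow> real) \<Rightarrow> bool" where
  "radial_on G a \<longleftrightarrow> (\<forall>z\<in>G. \<forall>c. cmod c = 1 \<longrightarrow> a (c *s z) = a z)"

definition polynomials :: "(complex ^ 'd \<Rightarrow> complex) set" where
  "polynomials = {p. \<exists>(I :: ('d \<Rightarrow> nat) set) c. finite I \<and>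
     p = (\<lambda>z. \<Sum>\<alpha>\<in>I. c \<alpha> * (\<Prod>i\<in>UNIV. (z $ i) ^ \<alpha> i))}"

definition balanced_setting ::
    "(complex ^ 'd) set \<Rightarrow> (nat \<Rightarrow> nat \<Rightarrow> complex ^ 'd \<Rightarrow> real) \<Rightarrow> bool" where
  "balanced_setting G a \<longleftrightarrow>
     balanced_set G \<and>
     (\<forall>N n. radial_on G (a N n)) \<and>
     (\<forall>N n. continuous_map (norm_topology (Ha G (a N n)) (wnorm G (a N n))) (co_topology G) id) \<and>
     (\<forall>N n. zero_ext G ` polynomials \<subseteq> Ha0 G (a N n))"

definition wtilde :: "(complex ^ 'd) set \<Rightarrow> (complex ^ 'd \<Rightarrow> real) \<Rightarrow> complex ^ 'd \<Rightarrow> real" where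
  "wtilde G w z = Sup {cmod (g z) | g. g \<in> Hol G \<and> (\<forall>\<zeta>\<in>G. cmod (g \<zeta>) \<le> w \<zeta>)}"

definition wQ_in_tilde ::
    "(complex ^ 'd) set \<Rightarrow> (nat \<Rightarrow> nat \<Rightarrow> complex ^ 'd \<Rightarrow> real) \<Rightarrow> bool" where
  "wQ_in_tilde G a \<longleftrightarrow>
     (\<forall>N. \<exists>M\<ge>N. \<exists>n. \<forall>K\<ge>M. \<forall>m. \<exists>k. \<exists>S>0. \<forall>z\<in>G.
        wtilde G (\<lambda>\<zeta>. 1 / a M m \<zeta>) z \<le>
          S * max (wtilde G (\<lambda>\<zeta>. 1 / a N n \<zeta>) z) (wtilde G (\<lambda>\<zeta>. 1 / a K k \<zeta>) z))"

end

theory Submission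
  imports Defs "HOL-Complex_Analysis.Complex_Analysis"
begin

text \<open>
  (i) \<open>\<Longrightarrow>\<close> (ii) holds for every decreasing spectrum of LB-spaces \<open>E\<^sub>N = (\<Union>n. X\<^sub>N\<^sub>n)\<close> with limit \<open>Y\<close>.
  Applying the Baire category theorem to \<open>\<Prod>\<^sub>N E\<^sub>N\<close>, all factors discrete, the surjectivity of \<open>\<sigma>\<close>
  yields balls \<open>B\<^sub>j\<close> of the steps such that for each \<open>i\<close> some \<open>E\<^sub>M\<close> lies in
  \<open>Y + D\<close>, \<open>D = (\<Inter>j<i. B\<^sub>j)\<close>. If \<open>A\<close> absorbs all Banach discs of \<open>Y\<close>, then it
  absorbs \<open>Y \<inter> D\<close> for some \<open>i\<close>, and a second Baire argument in each Banach space
  \<open>X\<^sub>M\<^sub>m\<close> shows that the part of \<open>A + D\<close> in \<open>E\<^sub>M\<close> is a zero neighbourhood there, up to a factor;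
  its trace on \<open>Y\<close> is absorbed by \<open>A\<close>.

  (iii) \<open>\<Longrightarrow>\<close> (iv): if the condition fails for \<open>N\<close>, choose for every \<open>M \<ge> N\<close> the data \<open>K\<close>, \<open>m\<close>
  violating it with \<open>n = M\<close>, and for every \<open>k\<close> a point \<open>z\<^sub>M\<^sub>k\<close> violating it with \<open>S = k + 1\<close>.
  The functions \<open>g\<close> with \<open>\<bar>g\<bar>\<close> bounded by the maximum on the right-hand side at all these
  points form a barrel. That it is a zero neighbourhood contradicts the choice of the points, since
  in the balanced setting the value of the majorant \<open>(1/a)\<^sup>\<sim>\<close> at a point is already attained as a supremum
  over polynomials, which belong to all spaces.
\<close>

section \<open>Locally convex topologies\<close>

text \<open>Baire's theorem yields only density: a ball around 0 lies in a closure. Equality is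
  reached by successive approximation along one branch of a web: the residual is doubled at each
  step, and the l-th correction, taken l levels deeper, enters with weight 2^-l. In each coordinate
  all but finitely many corrections then lie in one ball of a Banach step, so their series converges
  there, at the price of a factor 2. Limits found in different steps are compared in the steps of
  \<open>E 0\<close>. With discrete factors, being close to 0 in the product means that finitely
  many coordinates vanish. A sequence whose only nonzero entry z stands far out is therefore small
  whatever z is, which is why a whole space \<open>E M\<close> gets decomposed. In (iii) ==> (iv)
  the two indices of the points serve absorption: for fixed M, membership of g in
  \<open>E (K M)\<close> controls g at all but finitely many k, and membership in \<open>E N\<close>
  controls g for all but finitely many M. The exceptions cost only finite sums.\<close>

lemma topspace_norm_topology [simp]: "topspace (norm_topology X p) = X"
proof -
  have "openin (norm_topology X p) X"
    unfolding openin_norm_topology by (auto intro: exI[of _ 1])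
  then have "X \<subseteq> topspace (norm_topology X p)"
    by (rule openin_subset)
  moreover have "topspace (norm_topology X p) \<subseteq> X"
    using openin_topspace[of "norm_topology X p"] unfolding openin_norm_topology by blast
  ultimately show ?thesis by blast
qed

context complex_space
begin

text \<open>Definiteness is dropped because gauges, point evaluations and even the zero function
  must define admissible topologies below.\<close>

definition seminorm_on :: "'v set \<Rightarrow> ('v \<Rightarrow> real) \<Rightarrow> bool" where
  "seminorm_on X p \<longleftrightarrow>
     subspace X \<and> (\<forall>x\<in>X. 0 \<le> p x) \<and> (\<forall>x\<in>X. \<forall>c. p (c *C x) = cmod c * p x) \<and>
     (\<forall>x\<in>X. \<forall>y\<in>X. p (x + y) \<le> p x + p y)"

lemma norm_on_imp_seminorm_on: "norm_on X p \<Longrightarrow> seminorm_on X p"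
  by (simp add: norm_on_def seminorm_on_def)

lemma seminorm_onD:
  assumes "seminorm_on X p"
  shows "subspace X" "x \<in> X \<Longrightarrow> 0 \<le> p x" "x \<in> X \<Longrightarrow> p (c *C x) = cmod c * p x"
    "x \<in> X \<Longrightarrow> y \<in> X \<Longrightarrow> p (x + y) \<le> p x + p y"
  using assms by (auto simp: seminorm_on_def)

lemma seminorm_on_0: "seminorm_on X p \<Longrightarrow> p 0 = 0"
  using subspace_0[of X] unfolding seminorm_on_def
  by (metis mult_eq_0_iff norm_zero scale_zero_left)

lemma seminorm_on_minus: "seminorm_on X p \<Longrightarrow> x \<in> X \<Longrightarrow> p (- x) = p x"
  unfolding seminorm_on_def by (metis mult_1 norm_minus_cancel norm_one scale_minus_left scale_one)

lemma seminorm_on_commute: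
  assumes "seminorm_on X p" "x \<in> X" "y \<in> X"
  shows "p (x - y) = p (y - x)"
  using seminorm_on_minus[OF assms(1), of "y - x"] assms
  by (auto simp: seminorm_on_def subspace_diff)

lemma seminorm_on_triangle_diff:
  assumes "seminorm_on X p" "x \<in> X" "y \<in> X" "z \<in> X"
  shows "p (x - z) \<le> p (x - y) + p (y - z)"
proof -
  have "x - y \<in> X" "y - z \<in> X" using assms by (auto simp: seminorm_on_def subspace_diff)
  then have "p ((x - y) + (y - z)) \<le> p (x - y) + p (y - z)"
    using assms(1) unfolding seminorm_on_def by blast
  then show ?thesis by simp
qed

lemma openin_seminorm_ball:
  assumes "seminorm_on X p" "x \<in> X"
  shows "openin (norm_topology X p) {y\<in>X. p (y - x) < r}"
  unfolding openin_norm_topology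
proof (intro conjI ballI)
  fix y assume y: "y \<in> {y\<in>X. p (y - x) < r}"
  show "\<exists>e>0. \<forall>z\<in>X. p (z - y) < e \<longrightarrow> z \<in> {y\<in>X. p (y - x) < r}"
  proof (intro exI[of _ "r - p (y - x)"] conjI ballI impI)
    fix z assume "z \<in> X" "p (z - y) < r - p (y - x)"
    then show "z \<in> {y\<in>X. p (y - x) < r}"
      using seminorm_on_triangle_diff[OF assms(1), of z y x] y assms(2) by auto
  qed (use y in auto)
qed auto

lemma absolutely_convex_seminorm_ball:
  assumes p: "seminorm_on X p"
  shows "absolutely_convex {x\<in>X. p x \<le> r}" "absolutely_convex {x\<in>X. p x < r}"
proof -
  have X: "subspace X" using p by (simp add: seminorm_on_def)
  have le: "p (\<alpha> *C x + \<beta> *C y) \<le> cmod \<alpha> * p x + cmod \<beta> * p y" if "x \<in> X" "y \<in> X" for \<alpha> \<beta> x y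
    using p that X unfolding seminorm_on_def by (metis subspace_scale)
  have max: "cmod \<alpha> * p x + cmod \<beta> * p y \<le> max (p x) (p y)"
    if "x \<in> X" "y \<in> X" "cmod \<alpha> + cmod \<beta> \<le> 1" for \<alpha> \<beta> x y
  proof -
    have "cmod \<alpha> * p x + cmod \<beta> * p y \<le> cmod \<alpha> * max (p x) (p y) + cmod \<beta> * max (p x) (p y)"
      by (intro add_mono mult_left_mono) auto
    also have "\<dots> = (cmod \<alpha> + cmod \<beta>) * max (p x) (p y)" by (simp add: algebra_simps)
    also have "\<dots> \<le> max (p x) (p y)"
      using that p unfolding seminorm_on_def
      by (metis max.coboundedI1 mult_left_le_one_le norm_ge_zero add_nonneg_nonneg)
    finally show ?thesis .
  qed
  have conv: "p (\<alpha> *C x + \<beta> *C y) \<le> max (p x) (p y)" "\<alpha> *C x + \<beta> *C y \<in> X"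
    if "x \<in> X" "y \<in> X" "cmod \<alpha> + cmod \<beta> \<le> 1" for \<alpha> \<beta> x y
    using order_trans[OF le[OF that(1,2)] max[OF that]] that X by (auto simp: subspace_add subspace_scale)
  show "absolutely_convex {x\<in>X. p x \<le> r}"
    unfolding absolutely_convex_def
  proof (intro ballI allI impI)
    fix x y and \<alpha> \<beta> :: complex
    assume "x \<in> {x\<in>X. p x \<le> r}" "y \<in> {x\<in>X. p x \<le> r}" "cmod \<alpha> + cmod \<beta> \<le> 1"
    with conv[of x y \<alpha> \<beta>] show "\<alpha> *C x + \<beta> *C y \<in> {x\<in>X. p x \<le> r}" by (auto intro: order_trans)
  qed
  show "absolutely_convex {x\<in>X. p x < r}"
    unfolding absolutely_convex_def
  proof (intro ballI allI impI)
    fix x y and \<alpha> \<beta> :: complex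
    assume "x \<in> {x\<in>X. p x < r}" "y \<in> {x\<in>X. p x < r}" "cmod \<alpha> + cmod \<beta> \<le> 1"
    with conv[of x y \<alpha> \<beta>] show "\<alpha> *C x + \<beta> *C y \<in> {x\<in>X. p x < r}" by (auto intro: order_le_less_trans)
  qed
qed

lemma zero_nbhd_openin: "openin T U \<Longrightarrow> 0 \<in> U \<Longrightarrow> U \<subseteq> V \<Longrightarrow> V \<subseteq> topspace T \<Longrightarrow> zero_nbhd T V"
  by (auto simp: zero_nbhd_def)

lemma vector_topology_seminorm:
  assumes p: "seminorm_on X p"
  shows "vector_topology (norm_topology X p)"
  unfolding vector_topology_def
proof (intro conjI)
  let ?T = "norm_topology X p"
  have X: "subspace X" using p by (simp add: seminorm_on_def)
  have p0: "0 \<le> p x" if "x \<in> X" for x using that p by (simp add: seminorm_on_def)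
  show "subspace (topspace ?T)" using X by simp
  show "continuous_map (prod_topology ?T ?T) ?T (\<lambda>(x, y). x + y)"
    unfolding continuous_map_def
  proof (intro conjI allI impI)
    show "(\<lambda>(x, y). x + y) \<in> topspace (prod_topology ?T ?T) \<rightarrow> topspace ?T"
      using X by (auto simp: subspace_add)
    fix U assume U: "openin ?T U"
    show "openin (prod_topology ?T ?T)
        {x \<in> topspace (prod_topology ?T ?T). (case x of (x, y) \<Rightarrow> x + y) \<in> U}"
      unfolding openin_prod_topology_alt
    proof (intro allI impI)
      fix x y assume xy: "(x, y) \<in> {x \<in> topspace (prod_topology ?T ?T). (case x of (x, y) \<Rightarrow> x + y) \<in> U}"
      then have "x + y \<in> U" by simp
      then obtain r where r: "r > 0" "\<forall>z\<in>X. p (z - (x + y)) < r \<longrightarrow> z \<in> U"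
        using U[unfolded openin_norm_topology] by blast
      show "\<exists>V W. openin ?T V \<and> openin ?T W \<and> x \<in> V \<and> y \<in> W \<and>
          V \<times> W \<subseteq> {x \<in> topspace (prod_topology ?T ?T). (case x of (x, y) \<Rightarrow> x + y) \<in> U}"
      proof (intro exI conjI)
        show "openin ?T {z\<in>X. p (z - x) < r/2}" "openin ?T {z\<in>X. p (z - y) < r/2}"
          by (rule openin_seminorm_ball[OF p]; use xy in simp)+
        show "{z\<in>X. p (z - x) < r/2} \<times> {z\<in>X. p (z - y) < r/2}
          \<subseteq> {x \<in> topspace (prod_topology ?T ?T). (case x of (x, y) \<Rightarrow> x + y) \<in> U}"
        proof clarsimp
          fix u v assume uv: "u \<in> X" "v \<in> X" "p (u - x) * 2 < r" "p (v - y) * 2 < r"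
          have "u - x \<in> X" "v - y \<in> X" using uv xy X by (auto simp: subspace_diff)
          then have "p ((u - x) + (v - y)) \<le> p (u - x) + p (v - y)"
            using p by (auto simp: seminorm_on_def)
          moreover have "(u - x) + (v - y) = (u + v) - (x + y)" by simp
          ultimately show "u + v \<in> U" using uv r X by (auto simp: subspace_add)
        qed
      qed (use xy r seminorm_on_0[OF p] in auto)
    qed
  qed
  show "continuous_map (prod_topology euclidean ?T) ?T (\<lambda>(c, x). c *C x)"
    unfolding continuous_map_def
  proof (intro conjI allI impI)
    show "(\<lambda>(c, x). c *C x) \<in> topspace (prod_topology euclidean ?T) \<rightarrow> topspace ?T"
      using X by (auto simp: subspace_scale)
    fix U assume U: "openin ?T U"
    show "openin (prod_topology euclidean ?T)
        {x \<in> topspace (prod_topology euclidean ?T). (case x of (c, x) \<Rightarrow> c *C x) \<in> U}"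
      unfolding openin_prod_topology_alt
    proof (intro allI impI)
      fix c x assume xy: "(c, x) \<in> {x \<in> topspace (prod_topology euclidean ?T). (case x of (c, x) \<Rightarrow> c *C x) \<in> U}"
      then have "c *C x \<in> U" by simp
      then obtain r where r: "r > 0" "\<forall>z\<in>X. p (z - c *C x) < r \<longrightarrow> z \<in> U"
        using U[unfolded openin_norm_topology] by blast
      have x: "x \<in> X" using xy by auto
      \<comment> \<open>The increment b u - c x splits into b (u - x) + (b - c) x. The bound d <= 1
        gives |b| <= |c| + 1, and the summands 1 keep the denominators positive when p x or c
        vanishes.\<close>
      define d where "d = min 1 (r / (2 * (p x + 1)))"
      define e where "e = r / (2 * (cmod c + 1))"
      have d: "d > 0" using r p0[OF x] by (simp add: d_def)
      have e: "e > 0" using r by (simp add: e_def add_nonneg_pos)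
      show "\<exists>V W. openin euclidean V \<and> openin ?T W \<and> c \<in> V \<and> x \<in> W \<and>
          V \<times> W \<subseteq> {x \<in> topspace (prod_topology euclidean ?T). (case x of (c, x) \<Rightarrow> c *C x) \<in> U}"
      proof (intro exI conjI)
        show "openin euclidean (ball c d)" by simp
        show "openin ?T {z\<in>X. p (z - x) < e}"
          by (rule openin_seminorm_ball[OF p x])
        show "ball c d \<times> {z\<in>X. p (z - x) < e}
          \<subseteq> {x \<in> topspace (prod_topology euclidean ?T). (case x of (c, x) \<Rightarrow> c *C x) \<in> U}"
        proof clarsimp
          fix b u assume uv: "u \<in> X" "p (u - x) < e" "dist c b < d"
          have ux: "u - x \<in> X" using uv x X by (auto simp: subspace_diff)
          have b: "cmod b \<le> cmod c + 1"
            using uv(3) norm_triangle_ineq2[of b c] by (simp add: dist_norm norm_minus_commute d_def)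
          have "p (b *C (u - x) + (b - c) *C x) \<le> p (b *C (u - x)) + p ((b - c) *C x)"
            by (intro seminorm_onD(4)[OF p] subspace_scale X ux x)
          also have "\<dots> = cmod b * p (u - x) + cmod (b - c) * p x"
            by (simp add: seminorm_onD(3)[OF p] ux x)
          also have "\<dots> \<le> (cmod c + 1) * p (u - x) + d * p x"
            using b uv p0[OF ux] p0[OF x]
            by (intro add_mono mult_right_mono) (auto simp: dist_norm norm_minus_commute)
          also have "\<dots> < (cmod c + 1) * e + d * p x"
            using uv by (simp add: add_nonneg_pos)
          also have "\<dots> \<le> r/2 + r/2"
          proof (rule add_mono)
            show "(cmod c + 1) * e \<le> r/2"
            proof -
              have "k * (r / (2 * k)) = r / 2" if "k \<noteq> 0" for k using that by simp
              from this[of "cmod c + 1"] show ?thesis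
                using norm_ge_zero[of c] unfolding e_def by linarith
            qed
            have "d * p x \<le> (r / (2 * (p x + 1))) * p x"
              using p0[OF x] by (intro mult_right_mono) (auto simp: d_def)
            also have "\<dots> = (r / 2) * (p x / (p x + 1))" by simp
            also have "\<dots> \<le> (r / 2) * 1"
              using p0[OF x] r by (intro mult_left_mono) auto
            finally show "d * p x \<le> r/2" by simp
          qed
          finally have "p (b *C (u - x) + (b - c) *C x) < r" by simp
          moreover have "b *C (u - x) + (b - c) *C x = b *C u - c *C x"
            by (simp add: scale_right_diff_distrib scale_left_diff_distrib)
          ultimately show "b *C u \<in> U" using uv r X by (auto simp: subspace_scale)
        qed
      qed (use d e x seminorm_on_0[OF p] in auto)
    qed
  qed
qed

lemma locally_convex_seminorm:
  assumes p: "seminorm_on X p"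
  shows "locally_convex (norm_topology X p)"
  unfolding locally_convex_def
proof (intro conjI allI impI)
  show "vector_topology (norm_topology X p)" using p by (rule vector_topology_seminorm)
  have X: "0 \<in> X" using p by (simp add: seminorm_on_def subspace_0)
  fix V assume "zero_nbhd (norm_topology X p) V"
  then obtain U r where U: "U \<subseteq> V" "r > 0" "\<forall>y\<in>X. p (y - 0) < r \<longrightarrow> y \<in> U"
    unfolding zero_nbhd_def openin_norm_topology by blast
  show "\<exists>W\<subseteq>V. zero_nbhd (norm_topology X p) W \<and> absolutely_convex W"
  proof (intro exI conjI)
    show "{y\<in>X. p y < r} \<subseteq> V" using U by auto
    show "zero_nbhd (norm_topology X p) {y\<in>X. p y < r}"
      using openin_seminorm_ball[OF p X, of r] X U seminorm_on_0[OF p]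
      by (intro zero_nbhd_openin[of _ "{y\<in>X. p y < r}"]) auto
    show "absolutely_convex {y\<in>X. p y < r}" using p by (rule absolutely_convex_seminorm_ball)
  qed
qed

lemma continuous_map_into_seminorm:
  assumes q: "seminorm_on Y q" and p: "seminorm_on X p" and sub: "Y \<subseteq> X"
    and le: "\<And>y. y \<in> Y \<Longrightarrow> p y \<le> C * q y"
  shows "continuous_map (norm_topology Y q) (norm_topology X p) id"
  unfolding continuous_map_def
proof (intro conjI allI impI)
  show "id \<in> topspace (norm_topology Y q) \<rightarrow> topspace (norm_topology X p)" using sub by auto
  fix U assume U: "openin (norm_topology X p) U"
  show "openin (norm_topology Y q) {x \<in> topspace (norm_topology Y q). id x \<in> U}"
    unfolding openin_norm_topology
  proof (intro conjI ballI)
    fix x assume "x \<in> {x \<in> topspace (norm_topology Y q). id x \<in> U}"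
    then have x: "x \<in> Y" "x \<in> U" by auto
    then obtain r where r: "r > 0" "\<forall>y\<in>X. p (y - x) < r \<longrightarrow> y \<in> U"
      using U unfolding openin_norm_topology by blast
    show "\<exists>r>0. \<forall>y\<in>Y. q (y - x) < r \<longrightarrow> y \<in> {x \<in> topspace (norm_topology Y q). id x \<in> U}"
    \<comment> \<open>C is an arbitrary real, possibly zero or negative; |C| + 1 is a positive
      constant that also works.\<close>
    proof (intro exI[of _ "r / (\<bar>C\<bar> + 1)"] conjI ballI impI)
      fix y assume y: "y \<in> Y" "q (y - x) < r / (\<bar>C\<bar> + 1)"
      have yx: "y - x \<in> Y" using q x y by (auto simp: seminorm_on_def subspace_diff)
      have q0: "0 \<le> q (y - x)" using q yx by (auto simp: seminorm_on_def)
      have "p (y - x) \<le> C * q (y - x)" using le yx by blast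
      also have "\<dots> \<le> (\<bar>C\<bar> + 1) * q (y - x)" using q0 by (intro mult_right_mono) auto
      also have "\<dots> < r" using y(2) by (simp add: field_simps add_nonneg_pos)
      finally show "y \<in> {x \<in> topspace (norm_topology Y q). id x \<in> U}"
        using r sub y by auto
    qed (use r in \<open>auto simp: add_nonneg_pos\<close>)
  qed auto
qed

lemma locally_convex_subtopology:
  assumes T: "locally_convex T" and Y: "subspace Y" "Y \<subseteq> topspace T"
  shows "locally_convex (subtopology T Y)"
proof -
  have top: "topspace (subtopology T Y) = Y" using Y by auto
  have VT: "vector_topology T" using T by (simp add: locally_convex_def)
  have "continuous_map (prod_topology (subtopology T Y) (subtopology T Y)) T (\<lambda>(x, y). x + y)"
    using VT unfolding vector_topology_def prod_topology_subtopology
    by (auto intro: continuous_map_from_subtopology)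
  moreover have "continuous_map (prod_topology euclidean (subtopology T Y)) T (\<lambda>(c, x). c *C x)"
    using VT unfolding vector_topology_def prod_topology_subtopology(2)
    by (auto intro: continuous_map_from_subtopology)
  ultimately have "vector_topology (subtopology T Y)"
    unfolding vector_topology_def continuous_map_in_subtopology top
    using Y by (auto simp: top subspace_add subspace_scale)
  moreover have "\<exists>W\<subseteq>V. zero_nbhd (subtopology T Y) W \<and> absolutely_convex W"
    if V: "zero_nbhd (subtopology T Y) V" for V
  proof -
    obtain U where U: "openin T U" "0 \<in> U" "U \<inter> Y \<subseteq> V"
      using V unfolding zero_nbhd_def openin_subtopology by auto
    then have "zero_nbhd T U" by (intro zero_nbhd_openin[of T U]) (auto simp: openin_subset)
    then obtain W where W: "W \<subseteq> U" "zero_nbhd T W" "absolutely_convex W"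
      using T unfolding locally_convex_def by blast
    show ?thesis
    proof (intro exI[of _ "W \<inter> Y"] conjI)
      show "W \<inter> Y \<subseteq> V" using W U by blast
      obtain O' where "openin T O'" "0 \<in> O'" "O' \<subseteq> W" using W(2) by (auto simp: zero_nbhd_def)
      then show "zero_nbhd (subtopology T Y) (W \<inter> Y)"
        using subspace_0[OF Y(1)] Y
        by (intro zero_nbhd_openin[of _ "O' \<inter> Y"]) (auto simp: openin_subtopology top)
      show "absolutely_convex (W \<inter> Y)"
        using W(3) Y(1) unfolding absolutely_convex_def by (auto simp: subspace_add subspace_scale)
    qed
  qed
  ultimately show ?thesis by (auto simp: locally_convex_def)
qed

text \<open>Continuity into the supremum of topologies can be tested in each member, so the vector
  operations stay continuous. The family must be nonempty, since otherwise the generated topology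
  lives on the empty set instead of X.\<close>

lemma locally_convex_generated:
  assumes F: "\<F> \<noteq> {}" "\<And>S. S \<in> \<F> \<Longrightarrow> locally_convex S \<and> topspace S = X"
  shows "locally_convex (topology_generated_by {U. \<exists>S\<in>\<F>. openin S U})" (is "locally_convex ?T")
    and "topspace (topology_generated_by {U. \<exists>S\<in>\<F>. openin S U}) = X"
proof -
  have top: "\<Union>{U. \<exists>S\<in>\<F>. openin S U} = X"
  proof
    show "\<Union>{U. \<exists>S\<in>\<F>. openin S U} \<subseteq> X" using F openin_subset by fastforce
    show "X \<subseteq> \<Union>{U. \<exists>S\<in>\<F>. openin S U}" using F by blast
  qed
  then show topT: "topspace ?T = X" by simp
  have VT: "vector_topology S" "topspace S = X" if "S \<in> \<F>" for S
    using F(2)[OF that] by (auto simp: locally_convex_def)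
  have X: "subspace X" using VT F(1) unfolding vector_topology_def by fastforce
  have id: "continuous_map ?T S id" if "S \<in> \<F>" for S
    unfolding continuous_map_def
  proof (intro conjI allI impI)
    show "id \<in> topspace ?T \<rightarrow> topspace S" unfolding topT VT(2)[OF that] by simp
    fix U assume U: "openin S U"
    then have "{x \<in> topspace ?T. id x \<in> U} = U" unfolding topT using openin_subset[OF U] VT(2)[OF that] by auto
    then show "openin ?T {x \<in> topspace ?T. id x \<in> U}"
      using U that by (auto intro!: topology_generated_by_Basis)
  qed
  have into: "continuous_map Z ?T f"
    if cont: "\<And>S. S \<in> \<F> \<Longrightarrow> continuous_map Z S f" for Z :: "'z topology" and f
  proof -
    have "f ` topspace Z \<subseteq> X"
      using cont F continuous_map_image_subset_topspace by (metis ex_in_conv)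
    moreover have "openin Z (f -` U \<inter> topspace Z)" if "S \<in> \<F>" "openin S U" for S U
    proof -
      have "f -` U \<inter> topspace Z = {x \<in> topspace Z. f x \<in> U}" by auto
      then show ?thesis
        using openin_continuous_map_preimage[OF cont[OF that(1)] that(2)] by simp
    qed
    ultimately show ?thesis
      unfolding continuous_on_generated_topo_iff top by blast
  qed
  have "continuous_map (prod_topology ?T ?T) ?T (\<lambda>(x, y). x + y)"
  proof (rule into)
    fix S assume S: "S \<in> \<F>"
    have "continuous_map (prod_topology ?T ?T) (prod_topology S S) (\<lambda>x. (id (fst x), id (snd x)))"
      unfolding continuous_map_pairwise comp_def fst_conv snd_conv
      using continuous_map_compose[OF continuous_map_fst id[OF S], of ?T]
        continuous_map_compose[OF continuous_map_snd id[OF S], of ?T]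
      by (simp add: comp_def)
    from continuous_map_compose[OF this] VT[OF S]
    show "continuous_map (prod_topology ?T ?T) S (\<lambda>(x, y). x + y)"
      unfolding vector_topology_def comp_def case_prod_beta by fastforce
  qed
  moreover have "continuous_map (prod_topology euclidean ?T) ?T (\<lambda>(c, x). c *C x)"
  proof (rule into)
    fix S assume S: "S \<in> \<F>"
    have "continuous_map (prod_topology euclidean ?T) (prod_topology euclidean S) (\<lambda>x. (fst x, id (snd x)))"
      unfolding continuous_map_pairwise comp_def fst_conv snd_conv
      using continuous_map_fst[of euclidean ?T]
        continuous_map_compose[OF continuous_map_snd id[OF S], of euclidean]
      by (simp add: comp_def)
    from continuous_map_compose[OF this] VT[OF S]
    show "continuous_map (prod_topology euclidean ?T) S (\<lambda>(c, x). c *C x)"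
      unfolding vector_topology_def comp_def case_prod_beta by fastforce
  qed
  ultimately have VTT: "vector_topology ?T" using X topT by (simp add: vector_topology_def)
  \<comment> \<open>Induction over the generation of U: an intersection of two absolutely convex
    neighbourhoods is again one, and for a union one member containing 0 suffices.\<close>
  have sub: "\<exists>W. W \<subseteq> U \<and> zero_nbhd ?T W \<and> absolutely_convex W"
    if "generate_topology_on {U. \<exists>S\<in>\<F>. openin S U} U" "0 \<in> U" for U
    using that
  proof induction
    case (Int a b)
    then obtain W W' where W: "W \<subseteq> a" "zero_nbhd ?T W" "absolutely_convex W"
      "W' \<subseteq> b" "zero_nbhd ?T W'" "absolutely_convex W'" by blast
    obtain O1 O2 where O: "openin ?T O1" "0 \<in> O1" "O1 \<subseteq> W" "openin ?T O2" "0 \<in> O2" "O2 \<subseteq> W'"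
      using W unfolding zero_nbhd_def by blast
    have "zero_nbhd ?T (W \<inter> W')"
      by (rule zero_nbhd_openin[of _ "O1 \<inter> O2"]) (use O W in \<open>auto simp: zero_nbhd_def\<close>)
    moreover have "absolutely_convex (W \<inter> W')" using W by (auto simp: absolutely_convex_def)
    ultimately show ?case using W by (intro exI[of _ "W \<inter> W'"]) blast
  next
    case (UN K)
    then obtain k where "k \<in> K" "0 \<in> k" by blast
    with UN obtain W where "W \<subseteq> k" "zero_nbhd ?T W \<and> absolutely_convex W" by blast
    then show ?case using \<open>k \<in> K\<close> by blast
  next
    case (Basis s)
    then obtain S where S: "S \<in> \<F>" "openin S s" by blast
    then have "zero_nbhd S s" using Basis by (intro zero_nbhd_openin[of S s]) (auto simp: openin_subset)
    then obtain W where W: "W \<subseteq> s" "zero_nbhd S W" "absolutely_convex W"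
      using F(2)[OF S(1)] unfolding locally_convex_def by blast
    then obtain O1 where O: "openin S O1" "0 \<in> O1" "O1 \<subseteq> W" by (auto simp: zero_nbhd_def)
    have "openin ?T O1" using O S by (auto intro!: topology_generated_by_Basis)
    then have "zero_nbhd ?T W" using O W VT(2)[OF S(1)] topT
      by (intro zero_nbhd_openin[of _ O1]) (auto simp: zero_nbhd_def)
    then show ?case using W by blast
  qed auto
  show "locally_convex ?T"
    unfolding locally_convex_def
  proof (intro conjI allI impI VTT)
    fix V assume "zero_nbhd ?T V"
    then obtain U where U: "openin ?T U" "0 \<in> U" "U \<subseteq> V" by (auto simp: zero_nbhd_def)
    then have "generate_topology_on {U. \<exists>S\<in>\<F>. openin S U} U"
      by (simp add: openin_topology_generated_by_iff)
    from sub[OF this U(2)] U show "\<exists>W\<subseteq>V. zero_nbhd ?T W \<and> absolutely_convex W" by blast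
  qed
qed

end

section \<open>Gauges, inductive and projective limits\<close>

context complex_space
begin

section \<open>Absolutely convex sets and their gauges\<close>

lemma absolutely_convexD:
  "absolutely_convex A \<Longrightarrow> x \<in> A \<Longrightarrow> y \<in> A \<Longrightarrow> cmod \<alpha> + cmod \<beta> \<le> 1 \<Longrightarrow> \<alpha> *C x + \<beta> *C y \<in> A"
  by (auto simp: absolutely_convex_def)

lemma absolutely_convex_scale: "absolutely_convex A \<Longrightarrow> x \<in> A \<Longrightarrow> cmod c \<le> 1 \<Longrightarrow> c *C x \<in> A"
  using absolutely_convexD[of A x x c 0] by simp

lemma absolutely_convex_0: "absolutely_convex A \<Longrightarrow> x \<in> A \<Longrightarrow> 0 \<in> A"
  using absolutely_convex_scale[of A x 0] by simp

lemma mem_scale_image: "c \<noteq> 0 \<Longrightarrow> x \<in> (*C) c ` A \<longleftrightarrow> inverse c *C x \<in> A"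
proof
  assume c: "c \<noteq> 0" and "inverse c *C x \<in> A"
  then have "c *C (inverse c *C x) \<in> (*C) c ` A" by blast
  then show "x \<in> (*C) c ` A" using c by simp
qed auto

lemma absolutely_convex_shrink:
  assumes A: "absolutely_convex A" and x: "complex_of_real c *C x \<in> A" and "cmod d \<le> c"
  shows "d *C x \<in> A"
proof (cases "c = 0")
  case True
  then show ?thesis using x assms by simp
next
  case False
  with assms have "c > 0" using norm_ge_zero[of d] by linarith
  then have "cmod (d / c) \<le> 1" using assms by (simp add: norm_divide)
  from absolutely_convex_scale[OF A x this] show ?thesis using \<open>c > 0\<close> by simp
qed

text \<open>An absolutely convex set is stable under factors of modulus at most 1, so a single
  positive real scalar takes care of all complex scalars of larger modulus in the definition of
  absorption.\<close>

lemma absorbs_iff: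
  assumes A: "absolutely_convex A"
  shows "absorbs A B \<longleftrightarrow> (\<exists>c>0. \<forall>x\<in>B. complex_of_real c *C x \<in> A)"
proof
  assume "absorbs A B"
  then obtain r where r: "r > 0" "\<forall>c. r \<le> cmod c \<longrightarrow> B \<subseteq> (*C) c ` A"
    by (auto simp: absorbs_def)
  then have "B \<subseteq> (*C) (complex_of_real r) ` A" by simp
  then have "\<forall>x\<in>B. complex_of_real (inverse r) *C x \<in> A"
    using r(1) mem_scale_image[of "complex_of_real r"] by auto
  then show "\<exists>c>0. \<forall>x\<in>B. complex_of_real c *C x \<in> A"
    using r(1) by (intro exI[of _ "inverse r"]) simp
next
  assume "\<exists>c>0. \<forall>x\<in>B. complex_of_real c *C x \<in> A"
  then obtain c where c: "c > 0" "\<forall>x\<in>B. complex_of_real c *C x \<in> A" by blast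
  show "absorbs A B"
    unfolding absorbs_def
  proof (intro exI[of _ "inverse c"] conjI allI impI subsetI)
    fix b x assume b: "inverse c \<le> cmod b" and x: "x \<in> B"
    have "b \<noteq> 0" using b c(1) by auto
    have "cmod (inverse b) \<le> c"
      using b c(1) \<open>b \<noteq> 0\<close> by (simp add: norm_inverse norm_divide field_simps)
    from absolutely_convex_shrink[OF A _ this] c(2) x
    show "x \<in> (*C) b ` A" using mem_scale_image[OF \<open>b \<noteq> 0\<close>] by blast
  qed (use c in simp)
qed

lemma span_absolutely_convex:
  assumes B: "absolutely_convex B" "B \<noteq> {}"
  shows "span B = {x. \<exists>c>0. complex_of_real c *C x \<in> B}" (is "_ = ?S")
proof
  obtain b where b: "b \<in> B" using B by blast
  have "subspace ?S"
    unfolding subspace_def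
  proof (intro conjI allI ballI)
    show "0 \<in> ?S" using absolutely_convex_0[OF B(1) b] by (auto intro: exI[of _ 1])
    fix x y assume "x \<in> ?S" "y \<in> ?S"
    then obtain c d where cd: "c > 0" "complex_of_real c *C x \<in> B" "d > 0" "complex_of_real d *C y \<in> B"
      by blast
    define e where "e = min c d"
    have "complex_of_real e *C x \<in> B" "complex_of_real e *C y \<in> B" "e > 0"
      using absolutely_convex_shrink[OF B(1) cd(2)] absolutely_convex_shrink[OF B(1) cd(4)] cd
      by (auto simp: e_def)
    then have "(1/2) *C (complex_of_real e *C x) + (1/2) *C (complex_of_real e *C y) \<in> B"
      by (intro absolutely_convexD[OF B(1)]) auto
    then have "complex_of_real (e/2) *C (x + y) \<in> B" by (simp add: scale_right_distrib)
    then show "x + y \<in> ?S" using \<open>e > 0\<close> by (auto intro!: exI[of _ "e/2"])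
  next
    fix b x assume "x \<in> ?S"
    then obtain c where c: "c > 0" "complex_of_real c *C x \<in> B" by blast
    have "cmod (complex_of_real (c / (cmod b + 1)) * b) \<le> c"
    proof -
      have b: "cmod b + 1 > 0" by (simp add: add_nonneg_pos)
      have "cmod (complex_of_real (c / (cmod b + 1)) * b) = c * (cmod b / (cmod b + 1))"
        using c(1) b by (simp only: norm_mult norm_of_real) simp
      also have "\<dots> \<le> c * 1" using c(1) b by (intro mult_left_mono) simp_all
      finally show ?thesis by simp
    qed
    then have "(complex_of_real (c / (cmod b + 1)) * b) *C x \<in> B"
      by (rule absolutely_convex_shrink[OF B(1) c(2)])
    then show "b *C x \<in> ?S"
      using c(1) by (auto intro!: exI[of _ "c / (cmod b + 1)"] divide_pos_pos add_nonneg_pos)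
  qed
  moreover have "B \<subseteq> ?S" by (auto intro: exI[of _ 1])
  ultimately show "span B \<subseteq> ?S" by (simp add: span_minimal)
  show "?S \<subseteq> span B"
  proof
    fix x assume "x \<in> ?S"
    then obtain c where c: "c > 0" "complex_of_real c *C x \<in> B" by blast
    then have "inverse (complex_of_real c) *C (complex_of_real c *C x) \<in> span B"
      by (intro span_scale span_base)
    then show "x \<in> span B" using c by simp
  qed
qed

lemma gauge_of_alt: "gauge_of B x = Inf {t. 0 < t \<and> complex_of_real (inverse t) *C x \<in> B}"
  unfolding gauge_of_def
  by (rule arg_cong[where f = Inf]) (auto simp: mem_scale_image of_real_inverse simp del: image_iff)

lemma gauge_of_le: "t > 0 \<Longrightarrow> complex_of_real (inverse t) *C x \<in> B \<Longrightarrow> gauge_of B x \<le> t"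
  unfolding gauge_of_alt by (intro cInf_lower bdd_belowI[of _ 0]) auto

lemma gauge_of_nonempty:
  assumes B: "absolutely_convex B" "B \<noteq> {}" and x: "x \<in> span B"
  shows "{t. 0 < t \<and> complex_of_real (inverse t) *C x \<in> B} \<noteq> {}"
proof -
  obtain c where "c > 0" "complex_of_real c *C x \<in> B"
    using x span_absolutely_convex[OF B] by blast
  then have "inverse c \<in> {t. 0 < t \<and> complex_of_real (inverse t) *C x \<in> B}" by simp
  then show ?thesis by blast
qed

lemma gauge_of_nonneg:
  assumes "absolutely_convex B" "B \<noteq> {}" "x \<in> span B"
  shows "0 \<le> gauge_of B x"
  unfolding gauge_of_alt using gauge_of_nonempty[OF assms] by (intro cInf_greatest) auto

lemma gauge_of_less:
  assumes B: "absolutely_convex B" "B \<noteq> {}" and x: "x \<in> span B" and less: "gauge_of B x < t"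
  shows "complex_of_real (inverse t) *C x \<in> B" "t > 0"
proof -
  show t: "t > 0" using gauge_of_nonneg[OF B x] less by simp
  obtain s where s: "s < t" "0 < s" "complex_of_real (inverse s) *C x \<in> B"
    using cInf_lessD[OF gauge_of_nonempty[OF B x]] less unfolding gauge_of_alt by blast
  have "cmod (complex_of_real (inverse t)) \<le> inverse s"
    using s t by (simp only: norm_of_real) simp
  then show "complex_of_real (inverse t) *C x \<in> B"
    by (rule absolutely_convex_shrink[OF B(1) s(3)])
qed

lemma seminorm_on_gauge:
  assumes B: "absolutely_convex B" "B \<noteq> {}"
  shows "seminorm_on (span B) (gauge_of B)"
proof -
  note less = gauge_of_less[OF B]
  have le: "gauge_of B (c *C x) \<le> cmod c * gauge_of B x" if x: "x \<in> span B" and c: "c \<noteq> 0" for c x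
  proof -
    have "gauge_of B (c *C x) / cmod c \<le> gauge_of B x"
    proof (rule dense_ge)
      fix t assume t: "gauge_of B x < t"
      have "(c / cmod c) *C (complex_of_real (inverse t) *C x) \<in> B"
        using c by (intro absolutely_convex_scale[OF B(1)] less x t) (simp add: norm_divide)
      then have "complex_of_real (inverse (cmod c * t)) *C (c *C x) \<in> B"
        by (simp add: field_simps)
      then have "gauge_of B (c *C x) \<le> cmod c * t"
        using c less(2)[OF x t] by (intro gauge_of_le) auto
      then show "gauge_of B (c *C x) / cmod c \<le> t" using c by (simp add: field_simps)
    qed
    then show ?thesis using c by (simp add: field_simps)
  qed
  show ?thesis
    unfolding seminorm_on_def
  proof (intro conjI ballI allI)
    fix x assume x: "x \<in> span B"
    show "0 \<le> gauge_of B x" by (rule gauge_of_nonneg[OF B x])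
    fix c
    show "gauge_of B (c *C x) = cmod c * gauge_of B x"
    proof (cases "c = 0")
      case True
      have "gauge_of B 0 \<le> t" if "t > 0" for t
        using that absolutely_convex_0[OF B(1)] B(2) by (intro gauge_of_le) auto
      then have "gauge_of B 0 \<le> 0" by (rule dense_ge)
      then show ?thesis using gauge_of_nonneg[OF B local.span_zero] True by simp
    next
      case False
      \<comment> \<open>The inequality already shown, applied to the inverse scalar, is the reverse
        inequality.\<close>
      have "gauge_of B (inverse c *C (c *C x)) \<le> cmod (inverse c) * gauge_of B (c *C x)"
        using False x by (intro le span_scale) auto
      then have "cmod c * gauge_of B x \<le> gauge_of B (c *C x)"
        using False by (simp add: norm_inverse norm_divide field_simps)
      then show ?thesis using le[OF x False] by simp
    qed
  next
    fix x y assume x: "x \<in> span B" and y: "y \<in> span B"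
    have "gauge_of B (x + y) - gauge_of B y \<le> gauge_of B x"
    proof (rule dense_ge)
      fix s assume s: "gauge_of B x < s"
      have "gauge_of B (x + y) - s \<le> gauge_of B y"
      proof (rule dense_ge)
        fix t assume t: "gauge_of B y < t"
        have st: "s > 0" "t > 0" using less(2)[OF x s] less(2)[OF y t] by auto
        \<comment> \<open>(x + y)/(s + t) is the convex combination of x/s and y/t with weights s/(s
          + t) and t/(s + t).\<close>
        have "complex_of_real (s / (s + t)) *C (complex_of_real (inverse s) *C x) +
            complex_of_real (t / (s + t)) *C (complex_of_real (inverse t) *C y) \<in> B"
        proof (intro absolutely_convexD[OF B(1)] less x y s t)
          have "s / (s + t) + t / (s + t) = 1"
            using st by (simp add: add_divide_distrib[symmetric])
          then show "cmod (complex_of_real (s / (s + t))) + cmod (complex_of_real (t / (s + t))) \<le> 1"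
            using st by (simp only: norm_of_real) simp
        qed
        moreover have "complex_of_real (s / (s + t)) * complex_of_real (inverse s) = complex_of_real (inverse (s + t))"
          "complex_of_real (t / (s + t)) * complex_of_real (inverse t) = complex_of_real (inverse (s + t))"
          using st by (simp_all only: of_real_mult[symmetric]) (simp_all add: field_simps)
        ultimately have "complex_of_real (inverse (s + t)) *C (x + y) \<in> B"
          by (simp add: scale_right_distrib del: of_real_inverse)
        then have "gauge_of B (x + y) \<le> s + t" using st by (intro gauge_of_le) auto
        then show "gauge_of B (x + y) - s \<le> t" by simp
      qed
      then show "gauge_of B (x + y) - gauge_of B y \<le> s" by simp
    qed
    then show "gauge_of B (x + y) \<le> gauge_of B x + gauge_of B y" by simp
  qed simp
qed

section \<open>Inductive limits of seminormed steps\<close>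

lemma subspace_increasing_UN:
  fixes X :: "nat \<Rightarrow> 'v set"
  assumes X: "\<And>n. subspace (X n)" "\<And>n. X n \<subseteq> X (Suc n)"
  shows "subspace (\<Union>n. X n)"
  unfolding subspace_def
proof (intro conjI ballI allI)
  show "0 \<in> (\<Union>n. X n)" using subspace_0[OF X(1)] by blast
  fix x y assume "x \<in> (\<Union>n. X n)" "y \<in> (\<Union>n. X n)"
  then obtain m n where "x \<in> X m" "y \<in> X n" by blast
  then have "x \<in> X (max m n)" "y \<in> X (max m n)"
    using lift_Suc_mono_le[of X, OF X(2)] by (meson max.cobounded1 max.cobounded2 subsetD)+
  then show "x + y \<in> (\<Union>n. X n)" using subspace_add[OF X(1)] by blast
next
  fix c x assume "x \<in> (\<Union>n. X n)"
  then show "c *C x \<in> (\<Union>n. X n)" using subspace_scale[OF X(1)] by blast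
qed

context
  fixes X :: "nat \<Rightarrow> 'v set" and p :: "nat \<Rightarrow> 'v \<Rightarrow> real"
  assumes p: "\<And>n. seminorm_on (X n) (p n)" and X_mono: "\<And>n. X n \<subseteq> X (Suc n)"
begin

private abbreviation "union_X \<equiv> \<Union>n. X n"
private abbreviation "ind_X \<equiv> inductive_limit (\<lambda>n. norm_topology (X n) (p n))"

lemma inductive_limit_props:
  shows locally_convex_inductive_limit: "locally_convex ind_X"
    and topspace_inductive_limit: "topspace ind_X = union_X"
proof -
  let ?F = "{S. locally_convex S \<and> topspace S = union_X \<and> (\<forall>n. continuous_map (norm_topology (X n) (p n)) S id)}"
  have ind_X: "ind_X = topology_generated_by {U. \<exists>S\<in>?F. openin S U}"
    unfolding inductive_limit_def by (rule arg_cong[where f = topology_generated_by]) auto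
  have union_X: "subspace union_X" using p X_mono by (intro subspace_increasing_UN) (auto simp: seminorm_on_def)
  \<comment> \<open>The zero seminorm gives the indiscrete topology, which makes every inclusion
    continuous; the family whose supremum is taken is thus nonempty.\<close>
  have z: "seminorm_on union_X (\<lambda>_. 0)" using union_X by (simp add: seminorm_on_def)
  have "norm_topology union_X (\<lambda>_. 0) \<in> ?F"
    using locally_convex_seminorm[OF z] continuous_map_into_seminorm[OF p z, of _ 0] by auto
  then have ne: "?F \<noteq> {}" by blast
  show "locally_convex ind_X" unfolding ind_X by (rule locally_convex_generated[OF ne, of union_X]) auto
  show "topspace ind_X = union_X" unfolding ind_X by (rule locally_convex_generated[OF ne, of union_X]) auto
qed

lemma openin_inductive_limit_ball:
  assumes "openin ind_X U" "0 \<in> U"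
  shows "\<exists>e>0. \<forall>x\<in>X n. p n x < e \<longrightarrow> x \<in> U"
  using assms unfolding inductive_limit_def openin_topology_generated_by_iff
proof induction
  case (Int a b)
  then obtain d e where "d > 0" "\<forall>x\<in>X n. p n x < d \<longrightarrow> x \<in> a" "e > 0" "\<forall>x\<in>X n. p n x < e \<longrightarrow> x \<in> b"
    by blast
  then show ?case by (intro exI[of _ "min d e"]) auto
next
  case (UN K)
  then show ?case by blast
next
  case (Basis s)
  then obtain S where "continuous_map (norm_topology (X n) (p n)) S id" "openin S s" by blast
  then have "openin (norm_topology (X n) (p n)) {x \<in> X n. x \<in> s}"
    using openin_continuous_map_preimage by fastforce
  moreover have "0 \<in> X n" using p[of n] by (simp add: seminorm_on_def subspace_0)
  ultimately show ?case using \<open>0 \<in> s\<close> unfolding openin_norm_topology by fastforce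
qed auto

lemma openin_inductive_limit_seminorm:
  assumes q: "seminorm_on union_X q" and le: "\<And>n x. x \<in> X n \<Longrightarrow> q x \<le> C n * p n x"
    and U: "openin (norm_topology union_X q) U"
  shows "openin ind_X U"
  unfolding inductive_limit_def
proof (rule topology_generated_by_Basis, rule CollectI, intro exI conjI allI)
  show "locally_convex (norm_topology union_X q)" by (rule locally_convex_seminorm[OF q])
  show "continuous_map (norm_topology (X n) (p n)) (norm_topology union_X q) id" for n
    by (rule continuous_map_into_seminorm[OF p q _ le]) auto
qed (use U in auto)

text \<open>The gauge of U is finite on the union, since U absorbs every point, and on each step it
  is dominated by a multiple of the norm. Its topology therefore competes in the supremum, and its
  open unit ball lies in U.\<close>

lemma zero_nbhd_inductive_limit:
  assumes U: "absolutely_convex U" "U \<subseteq> union_X"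
    and ball: "\<And>n. \<exists>e>0. \<forall>x\<in>X n. p n x < e \<longrightarrow> x \<in> U"
  shows "zero_nbhd ind_X U"
proof -
  have "0 \<in> X 0" using p[of 0] by (simp add: seminorm_on_def subspace_0)
  then have zU: "0 \<in> U" using ball[of 0] seminorm_on_0[OF p] by fastforce
  then have ne: "U \<noteq> {}" by blast
  obtain e where e: "\<And>n. e n > 0" "\<And>n x. x \<in> X n \<Longrightarrow> p n x < e n \<Longrightarrow> x \<in> U"
    using ball by metis
  have small: "complex_of_real (inverse t) *C x \<in> U" if "x \<in> X n" "t > p n x / e n" "t > 0" for n x t
  proof (rule e)
    show "complex_of_real (inverse t) *C x \<in> X n" using that p by (simp add: seminorm_on_def subspace_scale)
    have "p n (complex_of_real (inverse t) *C x) = cmod (complex_of_real (inverse t)) * p n x"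
      by (rule seminorm_onD(3)[OF p that(1)])
    also have "\<dots> = p n x / t"
      using that(3) by (simp only: norm_of_real) (simp add: field_simps)
    also have "\<dots> < e n"
      using that e(1)[of n] by (simp add: field_simps)
    finally show "p n (complex_of_real (inverse t) *C x) < e n" .
  qed
  have span: "span U = union_X"
  proof
    have "subspace union_X" using p X_mono by (intro subspace_increasing_UN) (auto simp: seminorm_on_def)
    then show "span U \<subseteq> union_X" using U(2) by (rule span_minimal[rotated])
    show "union_X \<subseteq> span U"
    proof
      fix x assume "x \<in> union_X"
      then obtain n where "x \<in> X n" by blast
      define t where "t = p n x / e n + 1"
      have "t > 0" "t > p n x / e n"
        using e(1)[of n] seminorm_onD(2)[OF p \<open>x \<in> X n\<close>] by (auto simp: t_def add_nonneg_pos)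
      with small[OF \<open>x \<in> X n\<close>] have "inverse t > 0" "complex_of_real (inverse t) *C x \<in> U" by auto
      then show "x \<in> span U"
        unfolding span_absolutely_convex[OF U(1) ne] by blast
    qed
  qed
  have q: "seminorm_on union_X (gauge_of U)" using seminorm_on_gauge[OF U(1) ne] by (simp add: span)
  have le: "gauge_of U x \<le> inverse (e n) * p n x" if x: "x \<in> X n" for n x
  proof (rule dense_ge)
    fix t assume t: "inverse (e n) * p n x < t"
    have "t > 0" using t e(1)[of n] seminorm_onD(2)[OF p x] by (smt (verit) mult_nonneg_nonneg inverse_nonnegative_iff_nonnegative)
    then show "gauge_of U x \<le> t"
      using small[OF x, of t] t by (intro gauge_of_le) (auto simp: field_simps)
  qed
  have zE: "0 \<in> union_X" using \<open>0 \<in> X 0\<close> by blast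
  have "openin ind_X {x\<in>union_X. gauge_of U (x - 0) < 1}"
    by (rule openin_inductive_limit_seminorm[OF q le openin_seminorm_ball[OF q zE]])
  moreover have "{x\<in>union_X. gauge_of U (x - 0) < 1} \<subseteq> U"
    using gauge_of_less(1)[OF U(1) ne, of _ 1] span by auto
  ultimately show ?thesis
    using U(2) zE seminorm_on_0[OF q] topspace_inductive_limit
    by (intro zero_nbhd_openin[of ind_X "{x\<in>union_X. gauge_of U (x - 0) < 1}"]) auto
qed

end

text \<open>This is continuity of the linking map between two inductive limits. A competing topology
  on the large union induces one on the small union that makes all the small steps embed
  continuously, hence competes there.\<close>

lemma openin_inductive_limit_restrict:
  assumes p: "\<And>n. seminorm_on (X n) (p n)" and X_mono: "\<And>n. X n \<subseteq> X (Suc n)"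
    and q: "\<And>n. seminorm_on (Y n) (q n)" and Y_mono: "\<And>n. Y n \<subseteq> Y (Suc n)"
    and sub: "\<And>n. Y n \<subseteq> X n" and le: "\<And>n y. y \<in> Y n \<Longrightarrow> p n y \<le> q n y"
    and U: "openin (inductive_limit (\<lambda>n. norm_topology (X n) (p n))) U"
  shows "openin (inductive_limit (\<lambda>n. norm_topology (Y n) (q n))) (U \<inter> (\<Union>n. Y n))" (is "openin ?L _")
  using U unfolding inductive_limit_def[of "\<lambda>n. norm_topology (X n) (p n)"] openin_topology_generated_by_iff
proof induction
  case (Int a b)
  have "a \<inter> b \<inter> (\<Union>n. Y n) = (a \<inter> (\<Union>n. Y n)) \<inter> (b \<inter> (\<Union>n. Y n))" by blast
  then show ?case using Int by auto
next
  case (UN K)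
  have "openin ?L (\<Union>k\<in>K. k \<inter> (\<Union>n. Y n))" by (rule openin_Union) (use UN in auto)
  moreover have "\<Union>K \<inter> (\<Union>n. Y n) = (\<Union>k\<in>K. k \<inter> (\<Union>n. Y n))" by blast
  ultimately show ?case by (simp only:)
next
  case (Basis s)
  then obtain S where S: "locally_convex S" "topspace S = (\<Union>n. X n)"
      "\<And>n. continuous_map (norm_topology (X n) (p n)) S id" "openin S s" by auto
  let ?F = "\<Union>n. Y n"
  have sp: "subspace ?F" using q Y_mono by (intro subspace_increasing_UN) (auto simp: seminorm_on_def)
  have subF: "?F \<subseteq> topspace S" using sub S(2) by blast
  show ?case
    unfolding inductive_limit_def
  proof (rule topology_generated_by_Basis, rule CollectI, intro exI conjI allI)
    show "locally_convex (subtopology S ?F)" by (rule locally_convex_subtopology[OF S(1) sp subF])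
    show "topspace (subtopology S ?F) = (\<Union>n. topspace (norm_topology (Y n) (q n)))"
      using subF by auto
    show "openin (subtopology S ?F) (s \<inter> ?F)" using S(4) by (auto simp: openin_subtopology)
    fix n
    have "continuous_map (norm_topology (Y n) (q n)) (norm_topology (X n) (p n)) id"
      by (rule continuous_map_into_seminorm[OF q p sub, of _ 1]) (use le in auto)
    then have "continuous_map (norm_topology (Y n) (q n)) S (id \<circ> id)"
      using S(3) by (rule continuous_map_compose)
    then show "continuous_map (norm_topology (Y n) (q n)) (subtopology S ?F) id"
      unfolding continuous_map_in_subtopology by auto
  qed
qed auto

section \<open>Projective limits of decreasing sequences\<close>

context
  fixes T :: "nat \<Rightarrow> 'v topology"
  assumes T: "\<And>N. locally_convex (T N)" and T_mono: "\<And>N. topspace (T (Suc N)) \<subseteq> topspace (T N)"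
    and T_cont: "\<And>N U. openin (T N) U \<Longrightarrow> openin (T (Suc N)) (U \<inter> topspace (T (Suc N)))"
begin

private abbreviation "inter_T \<equiv> \<Inter>N. topspace (T N)"

lemma projective_limit_props:
  shows locally_convex_projective_limit: "locally_convex (projective_limit T)"
    and topspace_projective_limit: "topspace (projective_limit T) = inter_T"
proof -
  let ?F = "range (\<lambda>N. subtopology (T N) inter_T)"
  have sp: "subspace (topspace (T N))" for N
    using T by (auto simp: locally_convex_def vector_topology_def)
  have inter_T: "subspace inter_T" using sp by (auto simp: subspace_def)
  have "{U \<inter> inter_T | U N. openin (T N) U} = {U. \<exists>S\<in>?F. openin S U}"
    by (auto simp: openin_subtopology)
  then have L: "projective_limit T = topology_generated_by {U. \<exists>S\<in>?F. openin S U}"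
    unfolding projective_limit_def by simp
  have F: "locally_convex S \<and> topspace S = inter_T" if "S \<in> ?F" for S
    using that locally_convex_subtopology[OF T inter_T] by fastforce
  show "locally_convex (projective_limit T)" unfolding L by (rule locally_convex_generated[OF _ F]) auto
  show "topspace (projective_limit T) = inter_T" unfolding L by (rule locally_convex_generated[OF _ F]) auto
qed

lemma openin_projective_limit: "openin (T N) U \<Longrightarrow> openin (projective_limit T) (U \<inter> inter_T)"
  unfolding projective_limit_def by (rule topology_generated_by_Basis) blast

lemma openin_spectrum_mono:
  assumes "N \<le> M" "openin (T N) U"
  shows "openin (T M) (U \<inter> topspace (T M))"
  using assms
proof (induction rule: dec_induct)
  case base
  then show ?case by (simp add: openin_subset inf.absorb1)
next
  case (step n)
  from T_cont[OF step(3)[OF step(4)]]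
  have "openin (T (Suc n)) (U \<inter> topspace (T n) \<inter> topspace (T (Suc n)))" .
  moreover have "U \<inter> topspace (T n) \<inter> topspace (T (Suc n)) = U \<inter> topspace (T (Suc n))"
    using T_mono by blast
  ultimately show ?case by simp
qed

text \<open>The topologies get finer along the spectrum, so a neighbourhood seen at one index is
  seen at all later ones. Claiming this for all M >= N, rather than for one M, lets the induction
  pass to a maximum at intersections, and later leaves M free to be chosen large.\<close>

lemma zero_nbhd_projective_limitD:
  assumes "zero_nbhd (projective_limit T) V"
  shows "\<exists>N. \<forall>M\<ge>N. \<exists>W. openin (T M) W \<and> 0 \<in> W \<and> W \<inter> inter_T \<subseteq> V"
proof -
  obtain U where U: "openin (projective_limit T) U" "0 \<in> U" "U \<subseteq> V"
    using assms by (auto simp: zero_nbhd_def)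
  have zT: "0 \<in> topspace (T M)" for M
    using T[of M] by (simp add: locally_convex_def vector_topology_def subspace_0)
  have "\<exists>N. \<forall>M\<ge>N. \<exists>W. openin (T M) W \<and> 0 \<in> W \<and> W \<inter> inter_T \<subseteq> U"
    using U(1,2) unfolding projective_limit_def openin_topology_generated_by_iff
  proof induction
    case (Int a b)
    then obtain N N' where N: "\<And>M. M \<ge> N \<Longrightarrow> \<exists>W. openin (T M) W \<and> 0 \<in> W \<and> W \<inter> inter_T \<subseteq> a"
      and N': "\<And>M. M \<ge> N' \<Longrightarrow> \<exists>W. openin (T M) W \<and> 0 \<in> W \<and> W \<inter> inter_T \<subseteq> b" by blast
    show ?case
    proof (intro exI[of _ "max N N'"] allI impI)
      fix M assume "max N N' \<le> M"
      then obtain W W' where "openin (T M) W" "0 \<in> W" "W \<inter> inter_T \<subseteq> a"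
        "openin (T M) W'" "0 \<in> W'" "W' \<inter> inter_T \<subseteq> b"
        using N[of M] N'[of M] by auto
      then show "\<exists>W. openin (T M) W \<and> 0 \<in> W \<and> W \<inter> inter_T \<subseteq> a \<inter> b"
        by (intro exI[of _ "W \<inter> W'"]) blast
    qed
  next
    case (UN K)
    then obtain k where "k \<in> K" "0 \<in> k" by blast
    from UN.IH[OF this] \<open>k \<in> K\<close> show ?case by (meson Union_upper order_trans)
  next
    case (Basis s)
    then obtain W N where W: "s = W \<inter> inter_T" "openin (T N) W" by blast
    show ?case
    proof (intro exI[of _ N] allI impI)
      fix M assume "N \<le> M"
      from openin_spectrum_mono[OF this W(2)] Basis(2) zT W(1)
      show "\<exists>W. openin (T M) W \<and> 0 \<in> W \<and> W \<inter> inter_T \<subseteq> s" by blast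
    qed
  qed auto
  with U(3) show ?thesis by (meson order_trans)
qed

lemma zero_nbhd_projective_limitI:
  assumes "zero_nbhd (T N) W" "W \<inter> inter_T \<subseteq> V" "V \<subseteq> inter_T"
  shows "zero_nbhd (projective_limit T) V"
proof -
  obtain U where U: "openin (T N) U" "0 \<in> U" "U \<subseteq> W" using assms(1) by (auto simp: zero_nbhd_def)
  have "0 \<in> topspace (T M)" for M
    using T[of M] by (simp add: locally_convex_def vector_topology_def subspace_0)
  then show ?thesis
    using openin_projective_limit[OF U(1)] U assms topspace_projective_limit
    by (intro zero_nbhd_openin[of _ "U \<inter> inter_T"]) auto
qed

end

end

section \<open>Baire category and barrels\<close>

text \<open>A countable union of meagre sets is meagre, so a non-meagre node of the tree has a
  non-meagre child; following such children gives the branch. A non-meagre set cannot be nowhere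
  dense. A node is a list because it records finitely many choices of natural numbers.\<close>

lemma (in Metric_space) nonmeagre_web:
  fixes P :: "nat list \<Rightarrow> 'a set"
  assumes complete: mcomplete and "M \<noteq> {}" and P0: "P [] = M" and PM: "\<And>s. P s \<subseteq> M"
    and P: "\<And>s. P s \<subseteq> (\<Union>m. P (s @ [m]))"
  shows "\<exists>\<sigma>. \<forall>i. mtopology interior_of (mtopology closure_of P (map \<sigma> [0..<i])) \<noteq> {}"
proof -
  define meagre where "meagre S \<longleftrightarrow> (\<exists>\<G>. countable \<G> \<and>
    (\<forall>T\<in>\<G>. closedin mtopology T \<and> mtopology interior_of T = {}) \<and> S \<subseteq> \<Union>\<G>)" for S
  have not_meagre: "\<not> meagre M"
  proof
    assume "meagre M"
    then obtain \<G> where G: "countable \<G>" "\<And>T. T \<in> \<G> \<Longrightarrow> closedin mtopology T \<and> mtopology interior_of T = {}"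
        "M \<subseteq> \<Union>\<G>" unfolding meagre_def by blast
    have "mtopology interior_of \<Union>\<G> = {}" by (rule metric_Baire_category_alt[OF complete G(1,2)])
    moreover have "M \<subseteq> mtopology interior_of \<Union>\<G>"
      using G(3) by (intro interior_of_maximal) (use openin_topspace[of mtopology] in simp_all)
    ultimately show False using \<open>M \<noteq> {}\<close> by blast
  qed
  have step: "\<exists>m. \<not> meagre (P (s @ [m]))" if "\<not> meagre (P s)" for s
  proof (rule ccontr)
    assume "\<not> (\<exists>m. \<not> meagre (P (s @ [m])))"
    then have "\<forall>m. \<exists>\<G>. countable \<G> \<and>
      (\<forall>T\<in>\<G>. closedin mtopology T \<and> mtopology interior_of T = {}) \<and> P (s @ [m]) \<subseteq> \<Union>\<G>"
      unfolding meagre_def by blast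
    then obtain G where G: "\<And>m. countable (G m)"
        "\<And>m T. T \<in> G m \<Longrightarrow> closedin mtopology T \<and> mtopology interior_of T = {}"
        "\<And>m. P (s @ [m]) \<subseteq> \<Union>(G m)" by metis
    have "meagre (P s)"
      unfolding meagre_def
    proof (intro exI conjI ballI)
      show "countable (\<Union>m. G m)" using G(1) by simp
      show "P s \<subseteq> \<Union>(\<Union>m. G m)" 
      proof
        fix x assume "x \<in> P s"
        then obtain m where "x \<in> P (s @ [m])" using P by blast
        then have "x \<in> \<Union>(G m)" using G(3) by blast
        then show "x \<in> \<Union>(\<Union>m. G m)" by blast
      qed
      fix T assume "T \<in> (\<Union>m. G m)"
      then show "closedin mtopology T" "mtopology interior_of T = {}" using G(2) by auto
    qed
    with that show False by blast
  qed
  have interior: "mtopology interior_of (mtopology closure_of S) \<noteq> {}" if "\<not> meagre S" "S \<subseteq> M" for S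
  proof
    assume "mtopology interior_of (mtopology closure_of S) = {}"
    moreover have "S \<subseteq> mtopology closure_of S" using that(2) by (intro closure_of_subset) simp
    ultimately have "meagre S"
      unfolding meagre_def by (intro exI[of _ "{mtopology closure_of S}"]) simp
    with that(1) show False by blast
  qed
  \<comment> \<open>The starting value is part of the invariant, since dependent choice returns only
    what the invariant says about index 0.\<close>
  have "\<exists>l. \<forall>i. (\<not> meagre (P (l i)) \<and> (i = 0 \<longrightarrow> l i = [])) \<and> (\<exists>m. l (Suc i) = l i @ [m])"
  proof (rule dependent_nat_choice)
    show "\<exists>s. \<not> meagre (P s) \<and> (0 = (0::nat) \<longrightarrow> s = [])" using not_meagre P0 by auto
  qed (use step in auto)
  then obtain l where l: "\<And>i. \<not> meagre (P (l i))" "l 0 = []" "\<And>i. \<exists>m. l (Suc i) = l i @ [m]" by metis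
  define \<sigma> where "\<sigma> i = last (l (Suc i))" for i
  have "map \<sigma> [0..<i] = l i" for i
  proof (induction i)
    case (Suc i)
    with l(3)[of i] show ?case by (auto simp: \<sigma>_def)
  qed (simp add: l(2))
  then show ?thesis using interior[OF l(1) PM] by metis
qed

context complex_space
begin

text \<open>Full homogeneity is weakened to q (x/2) <= q x, so that Banach norms and the product of
  discrete factors are both instances. Halving is the only scaling whose effect on q the web
  arguments need.\<close>

definition complete_fnorm_on :: "'v set \<Rightarrow> ('v \<Rightarrow> real) \<Rightarrow> bool" where
  "complete_fnorm_on X q \<longleftrightarrow>
     subspace X \<and>
     (\<forall>x\<in>X. 0 \<le> q x \<and> (q x = 0 \<longleftrightarrow> x = 0) \<and> q (- x) = q x \<and> q ((1/2) *C x) \<le> q x) \<and>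
     (\<forall>x\<in>X. \<forall>y\<in>X. q (x + y) \<le> q x + q y) \<and>
     (\<forall>u::nat \<Rightarrow> 'v. range u \<subseteq> X \<and> (\<forall>e>0. \<exists>n0. \<forall>m\<ge>n0. \<forall>n\<ge>n0. q (u m - u n) < e) \<longrightarrow>
        (\<exists>l\<in>X. (\<lambda>n. q (u n - l)) \<longlonglongrightarrow> 0))"

lemma complete_fnorm_on_add:
  "complete_fnorm_on X q \<Longrightarrow> x \<in> X \<Longrightarrow> y \<in> X \<Longrightarrow> q (x + y) \<le> q x + q y"
  unfolding complete_fnorm_on_def by blast

lemma complete_fnorm_on_complete:
  assumes "complete_fnorm_on X q" "range u \<subseteq> X"
    "\<forall>e>0. \<exists>n0. \<forall>m\<ge>n0. \<forall>n\<ge>n0. q (u m - u n) < e"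
  shows "\<exists>l\<in>X. (\<lambda>n. q (u n - l)) \<longlonglongrightarrow> 0"
  using assms unfolding complete_fnorm_on_def by simp

lemma banach_on_imp_complete_fnorm_on:
  assumes "banach_on X p"
  shows "complete_fnorm_on X p"
proof -
  have norm: "norm_on X p" using assms by (simp add: banach_on_def)
  note semi = norm_on_imp_seminorm_on[OF norm]
  have "p x = 0 \<longleftrightarrow> x = 0" if "x \<in> X" for x
    using norm that seminorm_on_0[OF semi] by (auto simp: norm_on_def)
  moreover have "p ((1/2) *C x) \<le> p x" if "x \<in> X" for x
    using seminorm_onD(2,3)[OF semi that] by simp
  ultimately show ?thesis
    using assms seminorm_onD(1,2,4)[OF semi] seminorm_on_minus[OF semi]
    unfolding complete_fnorm_on_def banach_on_def by blast
qed

text \<open>The value 0 off X is a default: nonnegativity and symmetry of the distance are demanded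
  for all points, while q is controlled on X only.\<close>

lemma Metric_space_fnorm:
  assumes q: "complete_fnorm_on X q"
  shows "Metric_space X (\<lambda>x y. if x \<in> X \<and> y \<in> X then q (x - y) else 0)" (is "Metric_space X ?d")
    and "Metric_space.mcomplete X (\<lambda>x y. if x \<in> X \<and> y \<in> X then q (x - y) else 0)"
proof -
  have X: "subspace X" using q by (simp add: complete_fnorm_on_def)
  have diff: "x - y \<in> X" if "x \<in> X" "y \<in> X" for x y using X that by (rule subspace_diff)
  have comm: "q (x - y) = q (y - x)" if "x \<in> X" "y \<in> X" for x y
    using q diff[OF that] unfolding complete_fnorm_on_def by (metis minus_diff_eq)
  show M: "Metric_space X ?d"
  proof
    show "0 \<le> ?d x y" for x y using q diff by (auto simp: complete_fnorm_on_def)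
    show "?d x y = ?d y x" for x y using comm by auto
    show "?d x y = 0 \<longleftrightarrow> x = y" if "x \<in> X" "y \<in> X" for x y
      using q diff[OF that] that by (auto simp: complete_fnorm_on_def)
    show "?d x z \<le> ?d x y + ?d y z" if "x \<in> X" "y \<in> X" "z \<in> X" for x y z
    proof -
      have "q ((x - y) + (y - z)) \<le> q (x - y) + q (y - z)"
        by (rule complete_fnorm_on_add[OF q diff[OF that(1,2)] diff[OF that(2,3)]])
      then show ?thesis using that by simp
    qed
  qed
  interpret Metric_space X ?d by (rule M)
  show mcomplete
    unfolding mcomplete_def
  proof (intro allI impI)
    fix u assume u: "MCauchy u"
    then have ran: "range u \<subseteq> X" by (simp add: MCauchy_def)
    have uX: "u n \<in> X" for n using ran by blast
    have "\<forall>e>0. \<exists>n0. \<forall>m\<ge>n0. \<forall>n\<ge>n0. q (u m - u n) < e"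
      using u uX unfolding MCauchy_def by (simp add: uX)
    then obtain l where l: "l \<in> X" "(\<lambda>n. q (u n - l)) \<longlonglongrightarrow> 0"
      using complete_fnorm_on_complete[OF q ran] by blast
    then have "limitin mtopology u l sequentially"
      unfolding limitin_metric_dist_null using uX by (simp add: l)
    then show "\<exists>x. limitin mtopology u x sequentially" by blast
  qed
qed

text \<open>
  If the closure of an absolutely convex set contains a ball around \<open>x\<close>, then also one around \<open>- x\<close>,
  and halving the sum gives a ball around \<open>0\<close>.
\<close>

lemma web_approximation:
  fixes P :: "nat list \<Rightarrow> 'v set"
  assumes q: "complete_fnorm_on Q q" and P0: "P [] = Q" and PQ: "\<And>s. P s \<subseteq> Q"
    and P: "\<And>s. P s \<subseteq> (\<Union>m. P (s @ [m]))" and conv: "\<And>s. absolutely_convex (P s)"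
  shows "\<exists>\<sigma>. \<forall>i. \<exists>e>0. \<forall>u\<in>Q. q u < e \<longrightarrow> (\<forall>d>0. \<exists>x\<in>P (map \<sigma> [0..<i]). q (u - x) < d)"
proof -
  let ?d = "\<lambda>x y. if x \<in> Q \<and> y \<in> Q then q (x - y) else 0"
  interpret Metric_space Q ?d by (rule Metric_space_fnorm[OF q])
  have Q: "subspace Q" using q by (simp add: complete_fnorm_on_def)
  have "Q \<noteq> {}" using subspace_0[OF Q] by blast
  from nonmeagre_web[where P = P, OF Metric_space_fnorm(2)[OF q] this P0 PQ P]
  obtain \<sigma> where \<sigma>: "\<And>i. mtopology interior_of (mtopology closure_of P (map \<sigma> [0..<i])) \<noteq> {}"
    by blast
  have tri: "q (x + y) \<le> q x + q y" "q (- x) = q x" "q ((1/2) *C x) \<le> q x" if "x \<in> Q" "y \<in> Q" for x y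
    using q that by (auto simp: complete_fnorm_on_def)
  show ?thesis
  proof (intro exI[of _ \<sigma>] allI)
    fix i
    let ?P = "P (map \<sigma> [0..<i])"
    obtain x0 where x0i: "x0 \<in> mtopology interior_of (mtopology closure_of ?P)" using \<sigma>[of i] by blast
    obtain r where x0: "x0 \<in> Q" and r: "r > 0" "mball x0 r \<subseteq> mtopology interior_of (mtopology closure_of ?P)"
      using openin_interior_of[of mtopology "mtopology closure_of ?P", unfolded openin_mtopology] x0i
      by blast
    have approx: "\<exists>a\<in>?P. q (v - a) < d" if v: "v \<in> Q" "q (x0 - v) < r" "d > 0" for v d
    proof -
      have "v \<in> mball x0 r" using v x0 by simp
      then have "v \<in> mtopology closure_of ?P"
        using r(2) interior_of_subset[of mtopology "mtopology closure_of ?P"] by (meson subsetD)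
      then obtain a where "a \<in> ?P" "a \<in> mball v d" using v(3) unfolding metric_closure_of by blast
      then show ?thesis using v(1) by (auto split: if_splits)
    qed
    show "\<exists>e>0. \<forall>u\<in>Q. q u < e \<longrightarrow> (\<forall>d>0. \<exists>x\<in>?P. q (u - x) < d)"
    proof (intro exI[of _ r] conjI ballI impI allI r(1))
      fix u and d :: real assume u: "u \<in> Q" "q u < r" and d: "d > 0"
      have "q (x0 - (x0 + u)) < r" "q (x0 - (x0 - u)) < r" using u tri(2)[of u] by auto
      moreover have "x0 + u \<in> Q" "x0 - u \<in> Q" using Q x0 u(1) by (auto simp: subspace_add subspace_diff)
      ultimately obtain a b where a: "a \<in> ?P" "q ((x0 + u) - a) < d/2" and b: "b \<in> ?P" "q ((x0 - u) - b) < d/2"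
        using approx[of "x0 + u" "d/2"] approx[of "x0 - u" "d/2"] d by auto
      have aQ: "a \<in> Q" "b \<in> Q" using a b PQ by auto
      define v w where "v = (x0 + u) - a" and "w = - ((x0 - u) - b)"
      have vw: "v \<in> Q" "w \<in> Q" "v + w \<in> Q" unfolding v_def w_def
        using Q x0 u(1) aQ by (auto intro!: subspace_add subspace_diff subspace_neg)
      show "\<exists>x\<in>?P. q (u - x) < d"
      proof (intro bexI)
        show "(1/2) *C a + (- 1/2) *C b \<in> ?P" by (rule absolutely_convexD[OF conv a(1) b(1)]) simp
        have "u = (1/2) *C u + (1/2) *C u"
          by (simp flip: scale_left_distrib)
        then have "u - ((1/2) *C a + (- 1/2) *C b) = (1/2) *C (v + w)"
          unfolding v_def w_def by (simp add: algebra_simps)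
        also have "q \<dots> \<le> q (v + w)" using tri(3) vw by blast
        also have "\<dots> \<le> q v + q w" using tri(1) vw by blast
        also have "q w = q ((x0 - u) - b)" unfolding w_def using Q x0 u(1) aQ
          by (intro tri(2)) (auto intro!: subspace_diff)
        also have "q v + q ((x0 - u) - b) < d" using a(2) b(2) by (simp add: v_def)
        finally show "q (u - ((1/2) *C a + (- 1/2) *C b)) < d" .
      qed
    qed
  qed
qed

text \<open>The iteration of the open mapping theorem: approximate the residual w by x, continue
  with 2 (w - x). The remainder after L terms is then 2^-L times the L-th residual. Each
  approximation is taken one level deeper on the branch, so that later terms obey more of the
  constraints.\<close>

lemma web_expansion:
  fixes P :: "nat list \<Rightarrow> 'v set"
  assumes q: "complete_fnorm_on Q q" and P0: "P [] = Q" and PQ: "\<And>s. P s \<subseteq> Q"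
    and P: "\<And>s. P s \<subseteq> (\<Union>m. P (s @ [m]))" and conv: "\<And>s. absolutely_convex (P s)"
  shows "\<exists>\<sigma>. \<forall>i. \<exists>e>0. \<forall>u\<in>Q. q u < e \<longrightarrow>
    (\<exists>x. (\<forall>l. x l \<in> P (map \<sigma> [0..<i + l])) \<and> (\<lambda>L. q (u - (\<Sum>l<L. (1/2)^l *C x l))) \<longlonglongrightarrow> 0)"
proof -
  have Q: "subspace Q" using q by (simp add: complete_fnorm_on_def)
  have q0: "0 \<le> q x" "q ((1/2) *C x) \<le> q x" if "x \<in> Q" for x
    using q that by (auto simp: complete_fnorm_on_def)
  obtain \<sigma> e where e: "\<And>i. e i > 0"
    "\<And>i u d. u \<in> Q \<Longrightarrow> q u < e i \<Longrightarrow> d > 0 \<Longrightarrow> \<exists>x\<in>P (map \<sigma> [0..<i]). q (u - x) < d"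
    using web_approximation[OF assms] by metis
  \<comment> \<open>Besides admitting the next approximation, the residuals themselves must tend to
    0: without homogeneity the factor 2^-L only ensures that q does not grow.\<close>
  define r where "r i = min (e i) (inverse (real (Suc i)))" for i
  have r: "r i > 0" for i using e(1) by (simp add: r_def)
  show ?thesis
  proof (intro exI[of _ \<sigma>] allI)
    fix i
    show "\<exists>e>0. \<forall>u\<in>Q. q u < e \<longrightarrow>
      (\<exists>x. (\<forall>l. x l \<in> P (map \<sigma> [0..<i + l])) \<and> (\<lambda>L. q (u - (\<Sum>l<L. (1/2)^l *C x l))) \<longlonglongrightarrow> 0)"
    proof (intro exI[of _ "r i"] conjI ballI impI r)
      fix u assume u: "u \<in> Q" "q u < r i"
      have "\<exists>w. \<forall>l. (w l \<in> Q \<and> q (w l) < r (i + l) \<and> (l = 0 \<longrightarrow> w l = u)) \<and>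
          (\<exists>x\<in>P (map \<sigma> [0..<i + l]). w (Suc l) = 2 *C (w l - x))"
      proof (rule dependent_nat_choice)
        show "\<exists>w. w \<in> Q \<and> q w < r (i + 0) \<and> (0 = (0::nat) \<longrightarrow> w = u)" using u by auto
        fix w l assume w: "w \<in> Q \<and> q w < r (i + l) \<and> (l = 0 \<longrightarrow> w = u)"
        then obtain x where x: "x \<in> P (map \<sigma> [0..<i + l])" "q (w - x) < r (i + Suc l) / 2"
          using e(2)[of w "i + l" "r (i + Suc l) / 2"] r[of "i + Suc l"] by (auto simp: r_def)
        have wx: "w - x \<in> Q" using w x PQ Q by (auto intro!: subspace_diff)
        have "2 *C (w - x) = (w - x) + (w - x)"
          using scale_left_distrib[of 1 1 "w - x"] by simp
        then have "q (2 *C (w - x)) \<le> q (w - x) + q (w - x)"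
          using complete_fnorm_on_add[OF q wx wx] by simp
        then show "\<exists>y. (y \<in> Q \<and> q y < r (i + Suc l) \<and> (Suc l = 0 \<longrightarrow> y = u)) \<and>
            (\<exists>x\<in>P (map \<sigma> [0..<i + l]). y = 2 *C (w - x))"
          using x wx Q by (intro exI[of _ "2 *C (w - x)"]) (auto intro: subspace_scale)
      qed
      then obtain w where w: "\<And>l. w l \<in> Q" "\<And>l. q (w l) < r (i + l)" "w 0 = u"
          "\<And>l. \<exists>x\<in>P (map \<sigma> [0..<i + l]). w (Suc l) = 2 *C (w l - x)" by metis
      then obtain x where x: "\<And>l. x l \<in> P (map \<sigma> [0..<i + l])" "\<And>l. w (Suc l) = 2 *C (w l - x l)" by metis
      have sum: "u - (\<Sum>l<L. (1/2)^l *C x l) = (1/2)^L *C w L" for L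
      proof (induction L)
        case (Suc L)
        have "u - (\<Sum>l<Suc L. (1/2)^l *C x l) = (1/2)^L *C (w L - x L)"
          using Suc by (simp add: scale_right_diff_distrib algebra_simps)
        also have "\<dots> = (1/2)^Suc L *C (2 *C (w L - x L))"
          by (simp only: scale_scale) simp
        finally show ?case using x(2) by simp
      qed (simp add: w(3))
      have small: "q ((1/2)^L *C y) \<le> q y" if "y \<in> Q" for L y
      proof (induction L)
        case (Suc L)
        have "q ((1/2) *C ((1/2)^L *C y)) \<le> q ((1/2)^L *C y)"
          using that Q by (intro q0) (auto intro: subspace_scale)
        then show ?case using Suc by simp
      qed simp
      have "(\<lambda>L. q ((1/2)^L *C w L)) \<longlonglongrightarrow> 0"
      proof (rule tendsto_sandwich)
        show "\<forall>\<^sub>F L in sequentially. 0 \<le> q ((1/2)^L *C w L)"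
          using w(1) Q by (auto intro!: always_eventually q0 subspace_scale)
        show "\<forall>\<^sub>F L in sequentially. q ((1/2)^L *C w L) \<le> inverse (real (Suc (i + L)))"
        proof (intro always_eventually allI)
          fix L
          have "q ((1/2)^L *C w L) \<le> q (w L)" using small w(1) by blast
          also have "\<dots> \<le> inverse (real (Suc (i + L)))" using w(2)[of L] by (simp add: r_def)
          finally show "q ((1/2)^L *C w L) \<le> inverse (real (Suc (i + L)))" .
        qed
        show "(\<lambda>L. inverse (real (Suc (i + L)))) \<longlonglongrightarrow> 0"
          using LIMSEQ_ignore_initial_segment[OF LIMSEQ_inverse_real_of_nat, of i]
          by (simp add: add.commute)
      qed auto
      then show "\<exists>x. (\<forall>l. x l \<in> P (map \<sigma> [0..<i + l])) \<and> (\<lambda>L. q (u - (\<Sum>l<L. (1/2)^l *C x l))) \<longlonglongrightarrow> 0"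
        using x(1) sum by (intro exI[of _ x]) simp
    qed
  qed
qed

section \<open>Barrels and Banach discs\<close>

text \<open>Multiples of the barrel cover the Banach space spanned by B, so one of them is dense
  near 0 in the gauge norm. As B is bounded, gauge convergence implies convergence in T, and
  closedness of A in T turns density into inclusion.\<close>

lemma barrel_absorbs_banach_disc:
  assumes T: "vector_topology T" and A: "barrel T A" and B: "banach_disc T B"
  shows "absorbs A B"
proof (cases "B = {}")
  case True
  then show ?thesis by (auto simp: absorbs_def intro: exI[of _ 1])
next
  case False
  have Ac: "absolutely_convex A" and Acl: "closedin T A" and Aab: "\<And>x. x \<in> topspace T \<Longrightarrow> absorbs A {x}"
    using A by (auto simp: barrel_def)
  have Bc: "absolutely_convex B" and Bb: "bounded_set T B" and ban: "banach_on (span B) (gauge_of B)"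
    using B by (auto simp: banach_disc_def)
  have topT: "subspace (topspace T)" using T by (simp add: vector_topology_def)
  have spT: "span B \<subseteq> topspace T" using Bb topT by (intro span_minimal) (auto simp: bounded_set_def)
  have semi: "seminorm_on (span B) (gauge_of B)" by (rule seminorm_on_gauge[OF Bc False])
  let ?c = "\<lambda>m. complex_of_real (inverse (real (Suc m)))"
  \<comment> \<open>One application of Baire is enough, so only the first entry of the list matters
    and the tree is constant below the first level.\<close>
  define P where "P s = (case s of [] \<Rightarrow> span B | m # _ \<Rightarrow> {x\<in>span B. ?c m *C x \<in> A})" for s
  have web: "P s \<subseteq> (\<Union>m. P (s @ [m]))" for s
  proof (cases s)
    case Nil
    have "\<exists>m. ?c m *C x \<in> A" if x: "x \<in> span B" for x
    proof -
      obtain c where c: "c > 0" "complex_of_real c *C x \<in> A"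
        using Aab[of x] absorbs_iff[OF Ac] x spT by blast
      obtain m where "inverse (real (Suc m)) < c" using reals_Archimedean[OF c(1)] by blast
      then have "?c m *C x \<in> A"
        by (intro absolutely_convex_shrink[OF Ac c(2)]) (simp only: norm_of_real, simp)
      then show ?thesis by blast
    qed
    then show ?thesis by (auto simp: P_def Nil)
  qed (auto simp: P_def)
  have "absolutely_convex (P s)" for s
  proof (cases s)
    case Nil
    show ?thesis using subspace_span[of B] by (auto simp: P_def Nil absolutely_convex_def intro: span_add span_scale)
  next
    case (Cons m t)
    show ?thesis
      unfolding absolutely_convex_def
    proof (intro ballI allI impI)
      fix x y and \<alpha> \<beta> :: complex assume xy: "x \<in> P s" "y \<in> P s" "cmod \<alpha> + cmod \<beta> \<le> 1"
      then have "\<alpha> *C (?c m *C x) + \<beta> *C (?c m *C y) \<in> A"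
        by (intro absolutely_convexD[OF Ac]) (auto simp: P_def Cons)
      moreover have "\<alpha> *C (?c m *C x) + \<beta> *C (?c m *C y) = ?c m *C (\<alpha> *C x + \<beta> *C y)"
        by (simp only: scale_right_distrib scale_scale mult.commute)
      ultimately show "\<alpha> *C x + \<beta> *C y \<in> P s"
        using xy by (auto simp: P_def Cons intro: span_add span_scale)
    qed
  qed
  then have "\<exists>\<sigma>. \<forall>i. \<exists>e>0. \<forall>u\<in>span B. gauge_of B u < e \<longrightarrow>
      (\<forall>d>0. \<exists>x\<in>P (map \<sigma> [0..<i]). gauge_of B (u - x) < d)"
    using web by (intro web_approximation banach_on_imp_complete_fnorm_on[OF ban])
      (auto simp: P_def split: list.splits)
  then obtain \<sigma> where "\<exists>e>0. \<forall>u\<in>span B. gauge_of B u < e \<longrightarrow>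
      (\<forall>d>0. \<exists>x\<in>P (map \<sigma> [0..<1]). gauge_of B (u - x) < d)" by blast
  then obtain e where e: "e > 0"
    "\<And>u d. u \<in> span B \<Longrightarrow> gauge_of B u < e \<Longrightarrow> d > 0 \<Longrightarrow> \<exists>x\<in>P (map \<sigma> [0..<1]). gauge_of B (u - x) < d"
    by blast
  define m where "m = \<sigma> 0"
  have inA: "?c m *C u \<in> A" if u: "u \<in> span B" "gauge_of B u < e" for u
  proof (rule ccontr)
    assume notA: "?c m *C u \<notin> A"
    define y where "y = ?c m *C u"
    have yT: "y \<in> topspace T" using spT u(1) by (auto simp: y_def intro: span_scale)
    \<comment> \<open>If y lies outside the closed set A, then so does y + w for all w in a zero
      neighbourhood W; it will be contradicted by an approximation of u so good that its error falls
      into W.\<close>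
    define W where "W = {w \<in> topspace T. y + w \<in> topspace T - A}"
    have "continuous_map T T (\<lambda>w. y + w)"
    proof -
      have "continuous_map T (prod_topology T T) (\<lambda>w. (y, w))"
        using yT by (simp add: continuous_map_paired)
      from continuous_map_compose[OF this] T show ?thesis
        unfolding vector_topology_def by (fastforce simp: comp_def)
    qed
    then have "openin T W"
      unfolding W_def using Acl by (intro openin_continuous_map_preimage) auto
    moreover have "0 \<in> W" using yT notA subspace_0[OF topT] by (simp add: W_def y_def)
    ultimately have "zero_nbhd T W" by (intro zero_nbhd_openin[of T W]) (auto simp: W_def)
    then obtain t where t: "t > 0" "\<And>c. t \<le> cmod c \<Longrightarrow> B \<subseteq> (*C) c ` W"
      using Bb by (auto simp: bounded_set_def absorbs_def)
    define d where "d = inverse t"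
    have "d > 0" using t(1) by (simp add: d_def)
    from e(2)[OF u this] obtain x where x: "x \<in> span B" "?c m *C x \<in> A" "gauge_of B (u - x) < d"
      by (auto simp: P_def m_def)
    have xu: "u - x \<in> span B" using u x by (simp add: span_diff)
    have b: "complex_of_real (inverse d) *C (u - x) \<in> B"
      by (rule gauge_of_less(1)[OF Bc False xu x(3)])
    define b where "b = complex_of_real (inverse d) *C (u - x)"
    \<comment> \<open>The modulus t (m + 1) of k is at least t, so W absorbs b at this scale, and k
      is chosen so that \<open>inverse k *C b\<close> is exactly the error between the approximant
      and y.\<close>
    define k where "k = - complex_of_real (t * real (Suc m))"
    have "t \<le> cmod k" using t(1) by (simp add: k_def norm_mult del: of_nat_Suc)
    then have "b \<in> (*C) k ` W" using t(2) b by (auto simp: b_def)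
    moreover have k0: "k \<noteq> 0" using t(1) by (simp add: k_def del: of_nat_Suc)
    ultimately have "inverse k *C b \<in> W" using mem_scale_image by blast
    moreover have "inverse k *C b = - (?c m *C (u - x))"
      using t(1) by (simp add: b_def k_def d_def divide_simps del: of_nat_Suc)
    ultimately have "y - ?c m *C (u - x) \<notin> A" by (simp add: W_def)
    moreover have "y - ?c m *C (u - x) = ?c m *C x"
      by (simp add: y_def scale_right_diff_distrib)
    ultimately show False using x(2) by simp
  qed
  have "complex_of_real (inverse (real (Suc m)) * (e/2)) *C x \<in> A" if "x \<in> B" for x
  proof -
    have xs: "x \<in> span B" using that by (rule span_base)
    have "gauge_of B x \<le> 1" using that by (intro gauge_of_le) auto
    then have "gauge_of B (complex_of_real (e/2) *C x) < e"
      using seminorm_onD(3)[OF semi xs, of "complex_of_real (e/2)"] e(1)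
      by (simp only: norm_of_real) (simp add: mult_left_le order_le_less_trans[of _ "e/2"])
    from inA[OF span_scale[OF xs] this] show ?thesis by simp
  qed
  moreover have "inverse (real (Suc m)) * (e/2) > 0" using e(1) by simp
  ultimately show ?thesis unfolding absorbs_iff[OF Ac] by blast
qed

theorem ultrabornological_imp_barrelled:
  assumes "ultrabornological T"
  shows "barrelled T"
  unfolding barrelled_def
proof (intro conjI allI impI)
  show "locally_convex T" using assms by (simp add: ultrabornological_def)
  then have "vector_topology T" by (simp add: locally_convex_def)
  fix A assume A: "barrel T A"
  then have "A \<subseteq> topspace T" "absolutely_convex A" by (auto simp: barrel_def closedin_subset)
  then show "zero_nbhd T A"
    using assms barrel_absorbs_banach_disc[OF \<open>vector_topology T\<close> A]
    unfolding ultrabornological_def by blast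
qed

end

section \<open>Projective spectra of LB-spaces\<close>

text \<open>An F-norm for the product topology when all factors are discrete.\<close>

definition discrete_fnorm :: "(nat \<Rightarrow> 'v::ab_group_add) \<Rightarrow> real" where
  "discrete_fnorm x = (if x = 0 then 0 else (1/2)^(LEAST j. x j \<noteq> 0))"

lemma discrete_fnorm_less: "discrete_fnorm x < (1/2)^k \<longleftrightarrow> (\<forall>j\<le>k. x j = 0)"
proof (cases "x = 0")
  case False
  then have ex: "\<exists>j. x j \<noteq> 0" by (auto simp: fun_eq_iff)
  have "k < (LEAST j. x j \<noteq> 0) \<longleftrightarrow> (\<forall>j\<le>k. x j = 0)"
    using LeastI_ex[OF ex] not_less_Least[of _ "\<lambda>j. x j \<noteq> 0"]
    by (metis le_less_trans not_le)
  then show ?thesis using False by (simp add: discrete_fnorm_def power_strict_decreasing_iff)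
qed (simp add: discrete_fnorm_def)

context complex_space
begin

lemma complex_space_sequences: "complex_space (\<lambda>c (x :: nat \<Rightarrow> 'v) N. c *C x N)"
  by unfold_locales (simp_all add: fun_eq_iff scale_right_distrib scale_left_distrib)

text \<open>A Cauchy sequence is eventually constant in each coordinate, so the coordinatewise limit
  exists and stays in the factors.\<close>

lemma complete_fnorm_on_product:
  assumes E: "\<And>N. subspace (E N)"
  shows "complex_space.complete_fnorm_on (\<lambda>c x N. c *C x N) (Pi UNIV E) discrete_fnorm"
proof -
  interpret seq: complex_space "\<lambda>c (x :: nat \<Rightarrow> 'v) N. c *C x N" by (rule complex_space_sequences)
  show ?thesis
    unfolding seq.complete_fnorm_on_def
  proof (intro conjI ballI allI impI)
    show "seq.subspace (Pi UNIV E)"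
      unfolding seq.subspace_def
      by (simp add: Pi_iff subspace_0[OF E] subspace_add[OF E] subspace_scale[OF E])
    fix x :: "nat \<Rightarrow> 'v"
    show "0 \<le> discrete_fnorm x" by (simp add: discrete_fnorm_def)
    show "discrete_fnorm x = 0 \<longleftrightarrow> x = 0" by (simp add: discrete_fnorm_def)
    show "discrete_fnorm (- x) = discrete_fnorm x" by (simp add: discrete_fnorm_def)
    have half: "(\<lambda>N. (1/2) *C x N) = 0 \<longleftrightarrow> x = 0" by (simp add: fun_eq_iff)
    show "discrete_fnorm (\<lambda>N. (1/2) *C x N) \<le> discrete_fnorm x"
      using half by (simp add: discrete_fnorm_def)
    fix y
    show "discrete_fnorm (x + y) \<le> discrete_fnorm x + discrete_fnorm y"
    proof (rule ccontr)
      assume *: "\<not> ?thesis"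
      have nn: "0 \<le> discrete_fnorm x" "0 \<le> discrete_fnorm y" by (simp_all add: discrete_fnorm_def)
      then have "x + y \<noteq> 0" using * by (auto simp: discrete_fnorm_def[of "x + y"])
      \<comment> \<open>If the sum had value (1/2)^k above both summands, both would vanish up to
        index k, and so would their sum: the distance is even an ultrametric.\<close>
      then obtain k where k: "discrete_fnorm (x + y) = (1/2)^k"
        using discrete_fnorm_def[of "x + y"] by metis
      then have "discrete_fnorm x < (1/2)^k" "discrete_fnorm y < (1/2)^k" using * nn by linarith+
      then have "discrete_fnorm (x + y) < (1/2)^k" unfolding discrete_fnorm_less by simp
      with k show False by simp
    qed
  next
    fix u :: "nat \<Rightarrow> nat \<Rightarrow> 'v"
    assume u: "range u \<subseteq> Pi UNIV E \<and> (\<forall>e>0. \<exists>n0. \<forall>m\<ge>n0. \<forall>n\<ge>n0. discrete_fnorm (u m - u n) < e)"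
    have "\<exists>n0. \<forall>m\<ge>n0. \<forall>n\<ge>n0. discrete_fnorm (u m - u n) < (1/2)^k" for k
      using u by simp
    then obtain n0 where "\<And>k m n. m \<ge> n0 k \<Longrightarrow> n \<ge> n0 k \<Longrightarrow> discrete_fnorm (u m - u n) < (1/2)^k"
      by metis
    then have "(u m - u n) j = 0" if "m \<ge> n0 k" "n \<ge> n0 k" "j \<le> k" for k m n j
      using that unfolding discrete_fnorm_less by blast
    note this[unfolded fun_diff_def]
    then have n0: "u m j = u n j" if "m \<ge> n0 k" "n \<ge> n0 k" "j \<le> k" for k m n j
      using that by (meson eq_iff_diff_eq_0)
    define l where "l j = u (n0 j) j" for j
    have "u n \<in> Pi UNIV E" for n using u by blast
    then have "l \<in> Pi UNIV E" by (simp add: l_def Pi_iff)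
    moreover have "(\<lambda>n. discrete_fnorm (u n - l)) \<longlonglongrightarrow> 0"
    proof (rule LIMSEQ_I)
      fix r :: real assume "r > 0"
      then obtain k where k: "(1/2)^k < r" using real_arch_pow_inv[of r "1/2"] by auto
      define N where "N = Max (n0 ` {..k})"
      have N: "n0 j \<le> N" if "j \<le> k" for j unfolding N_def using that by (intro Max_ge) auto
      show "\<exists>no. \<forall>n\<ge>no. norm (discrete_fnorm (u n - l) - 0) < r"
      proof (intro exI[of _ N] allI impI)
        fix n assume "n \<ge> N"
        then have "u n j = l j" if "j \<le> k" for j
          unfolding l_def using N[OF that] by (intro n0[of j]) auto
        then have "discrete_fnorm (u n - l) < (1/2)^k" unfolding discrete_fnorm_less by simp
        moreover have "0 \<le> discrete_fnorm (u n - l)" by (simp add: discrete_fnorm_def)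
        ultimately show "norm (discrete_fnorm (u n - l) - 0) < r" using k by simp
      qed
    qed
    ultimately show "\<exists>l\<in>Pi UNIV E. (\<lambda>n. discrete_fnorm (u n - l)) \<longlonglongrightarrow> 0" by blast
  qed
qed

end

text \<open>The class of x is an element of the quotient, hence the zero class; x belongs to its own
  class because 0 is in the image of the difference map.\<close>

lemma Proj1_is_zero_imp_surj:
  assumes "Proj1_is_zero X" "x \<in> Pi UNIV X" "\<And>N. 0 \<in> X N"
  shows "\<exists>y\<in>Pi UNIV X. x = spectrum_diff y"
proof -
  let ?R = "{(x, y). x \<in> Pi UNIV X \<and> y \<in> Pi UNIV X \<and> x - y \<in> spectrum_diff ` Pi UNIV X}"
  have "(0 :: nat \<Rightarrow> 'a) = spectrum_diff 0" by (auto simp: spectrum_diff_def fun_eq_iff)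
  then have "x - x \<in> spectrum_diff ` Pi UNIV X" using assms(3) by (intro image_eqI[of _ _ 0]) auto
  then have "x \<in> ?R `` {x}" using assms(2) by auto
  moreover have "?R `` {x} \<in> Proj1 X" unfolding Proj1_def using assms(2) by (rule quotientI)
  ultimately show ?thesis using assms(1) unfolding Proj1_is_zero_def by auto
qed

text \<open>The abstract setting of (i) ==> (ii): a double sequence of Banach spaces, growing with
  the inductive index and shrinking with the projective one, all inclusions being contractions.
  Functions enter only when the weighted spaces are shown to be an instance.\<close>

locale plb = complex_space scale
  for scale :: "complex \<Rightarrow> 'v::ab_group_add \<Rightarrow> 'v"  (infixr \<open>*C\<close> 75) +
  fixes X :: "nat \<Rightarrow> nat \<Rightarrow> 'v set" and p :: "nat \<Rightarrow> nat \<Rightarrow> 'v \<Rightarrow> real"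
  assumes banach: "\<And>N n. banach_on (X N n) (p N n)"
    and X_Suc: "\<And>N n. X N n \<subseteq> X N (Suc n)"
    and p_Suc: "\<And>N n x. x \<in> X N n \<Longrightarrow> p N (Suc n) x \<le> p N n x"
    and X_Suc': "\<And>N n. X (Suc N) n \<subseteq> X N n"
    and p_Suc': "\<And>N n x. x \<in> X (Suc N) n \<Longrightarrow> p N n x \<le> p (Suc N) n x"
begin

text \<open>
  In \<open>bal N m\<close> the index \<open>m\<close> is both the step and the radius, so that a single sequence of
  natural numbers selects balls in all the LB-spaces \<open>E N\<close>.
\<close>

definition E where "E N = (\<Union>n. X N n)"
definition Y where "Y = (\<Inter>N. E N)"
definition T where "T N = inductive_limit (\<lambda>n. norm_topology (X N n) (p N n))"
definition bal where "bal N m = {x \<in> X N m. p N m x \<le> real m}"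
text \<open>A finite stage of a branch s of choices of balls; at level 0 there is no constraint at
  all.\<close>

definition cyl where "cyl s i = {x. \<forall>j<i. x \<in> bal j (s j)}" for s :: "nat \<Rightarrow> nat" and i

lemma norm: "norm_on (X N n) (p N n)" using banach by (simp add: banach_on_def)
lemma semi: "seminorm_on (X N n) (p N n)" by (rule norm_on_imp_seminorm_on[OF norm])
lemma subspace_X: "subspace (X N n)" by (rule seminorm_onD(1)[OF semi])

lemma X_p_mono:
  assumes "N' \<le> N" "n \<le> n'" "x \<in> X N n"
  shows "x \<in> X N' n'" "p N' n' x \<le> p N n x"
proof -
  have A: "x \<in> X N' n \<and> p N' n x \<le> p N n x" using assms(1,3)
  proof (induction N rule: dec_induct)
    case (step N)
    then show ?case using X_Suc'[of N n] p_Suc'[of x N n] by fastforce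
  qed simp
  have "x \<in> X N' n' \<and> p N' n' x \<le> p N' n x" using assms(2)
  proof (induction rule: dec_induct)
    case (step k)
    then show ?case using X_Suc[of N' k] p_Suc[of x N' k] by fastforce
  qed (use A in simp)
  with A show "x \<in> X N' n'" "p N' n' x \<le> p N n x" by auto
qed

lemma subspace_E: "subspace (E N)"
  unfolding E_def by (rule subspace_increasing_UN[where X = "X N", OF subspace_X X_Suc])

lemma E_mono: "N' \<le> N \<Longrightarrow> E N \<subseteq> E N'"
  unfolding E_def using X_p_mono(1) by blast

lemma subspace_Y: "subspace Y"
  using subspace_E unfolding Y_def subspace_def by auto

lemma Y_E: "x \<in> Y \<Longrightarrow> x \<in> E N" by (auto simp: Y_def)

lemma Y_I: "(\<And>N. N \<ge> M \<Longrightarrow> x \<in> E N) \<Longrightarrow> x \<in> Y"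
  unfolding Y_def using E_mono by (metis INT_I nle_le subsetD)

lemma topspace_T: "topspace (T N) = E N"
  unfolding T_def E_def by (rule topspace_inductive_limit[where X = "X N" and p = "p N", OF semi X_Suc])

lemma locally_convex_T: "locally_convex (T N)"
  unfolding T_def by (rule locally_convex_inductive_limit[where X = "X N" and p = "p N", OF semi X_Suc])

lemma T_Suc: "openin (T N) U \<Longrightarrow> openin (T (Suc N)) (U \<inter> topspace (T (Suc N)))"
  unfolding topspace_T
  unfolding T_def E_def
  by (rule openin_inductive_limit_restrict[where X = "X N" and p = "p N" and Y = "X (Suc N)" and q = "p (Suc N)", OF semi X_Suc semi X_Suc X_Suc' p_Suc'])

lemma topspace_T_mono: "topspace (T (Suc N)) \<subseteq> topspace (T N)"
  unfolding topspace_T by (rule E_mono) simp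

lemmas projective_facts = locally_convex_T topspace_T_mono T_Suc

lemma locally_convex_limit: "locally_convex (projective_limit T)"
  by (rule locally_convex_projective_limit[where T = T, OF projective_facts])

lemma topspace_limit: "topspace (projective_limit T) = Y"
  using topspace_projective_limit[where T = T, OF projective_facts] by (simp add: topspace_T Y_def)

lemma zero_nbhd_limitD:
  assumes "zero_nbhd (projective_limit T) V"
  shows "\<exists>N. \<forall>M\<ge>N. \<forall>n. \<exists>e>0. \<forall>x\<in>X M n \<inter> Y. p M n x < e \<longrightarrow> x \<in> V"
proof -
  obtain N where N: "\<And>M. M \<ge> N \<Longrightarrow> \<exists>W. openin (T M) W \<and> 0 \<in> W \<and> W \<inter> Y \<subseteq> V"
    using zero_nbhd_projective_limitD[where T = T, OF projective_facts assms] unfolding topspace_T Y_def[symmetric]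
    by blast
  have "\<exists>e>0. \<forall>x\<in>X M n \<inter> Y. p M n x < e \<longrightarrow> x \<in> V" if M: "M \<ge> N" for M n
  proof -
    obtain W where W: "openin (T M) W" "0 \<in> W" "W \<inter> Y \<subseteq> V" using N[OF M] by blast
    from openin_inductive_limit_ball[where X = "X M" and p = "p M", OF semi X_Suc W(1)[unfolded T_def] W(2)]
    show ?thesis using W(3) by blast
  qed
  then show ?thesis by blast
qed

lemma zero_nbhd_limitI:
  assumes "absolutely_convex U" "U \<subseteq> E M" "U \<inter> Y \<subseteq> V" "V \<subseteq> Y"
    and "\<And>n. \<exists>e>0. \<forall>x\<in>X M n. p M n x < e \<longrightarrow> x \<in> U"
  shows "zero_nbhd (projective_limit T) V"
proof (rule zero_nbhd_projective_limitI[where T = T, OF projective_facts])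
  show "zero_nbhd (T M) U"
    unfolding T_def by (rule zero_nbhd_inductive_limit[where X = "X M" and p = "p M", OF semi X_Suc assms(1) assms(2)[unfolded E_def] assms(5)])
qed (use assms in \<open>auto simp: topspace_T Y_def\<close>)

lemma openin_limit_seminorm:
  assumes "seminorm_on (E N) q" "\<And>n x. x \<in> X N n \<Longrightarrow> q x \<le> C n * p N n x"
    and "openin (norm_topology (E N) q) U"
  shows "openin (projective_limit T) (U \<inter> Y)"
proof -
  have "openin (T N) U"
    using openin_inductive_limit_seminorm[where X = "X N" and p = "p N", OF semi X_Suc, of q C U] assms unfolding T_def E_def by blast
  from openin_projective_limit[where T = T, OF projective_facts this] show ?thesis by (simp add: topspace_T Y_def)
qed

lemma bal_mono: "N' \<le> N \<Longrightarrow> m \<le> m' \<Longrightarrow> bal N m \<subseteq> bal N' m'"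
  unfolding bal_def using X_p_mono[of N' N m m'] by fastforce

lemma absolutely_convex_bal: "absolutely_convex (bal N m)"
  unfolding bal_def by (rule absolutely_convex_seminorm_ball[OF semi])

lemma bal_subset_E: "bal N m \<subseteq> E N" by (auto simp: bal_def E_def)

lemma in_bal:
  assumes "x \<in> E N"
  shows "\<exists>m. x \<in> bal N m"
proof -
  obtain n where n: "x \<in> X N n" using assms by (auto simp: E_def)
  obtain k where k: "p N n x \<le> real k" using real_arch_simple by blast
  have "x \<in> X N (max n k)" "p N (max n k) x \<le> p N n x" using X_p_mono[of N N n "max n k" x] n by auto
  then have "x \<in> bal N (max n k)" using k by (auto simp: bal_def)
  then show ?thesis by blast
qed

text \<open>The weights 2^-l sum to 2, so sums of series land in twice a ball. Doubling the index
  doubles the radius and moves to a later step, where the norm is no larger.\<close>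

lemma in_bal_double:
  assumes "(1/2) *C x \<in> bal N m"
  shows "x \<in> bal N (2 * m)"
proof -
  have x: "(1/2) *C x \<in> X N m" "p N m ((1/2) *C x) \<le> m" using assms by (auto simp: bal_def)
  have "2 *C ((1/2) *C x) \<in> X N m" by (rule subspace_scale[OF subspace_X x(1)])
  then have "x \<in> X N m" by simp
  then show ?thesis
    using x seminorm_onD(3)[OF semi, of x N m "1/2"] X_p_mono[of N N m "2 * m" x] by (auto simp: bal_def)
qed

lemma absolutely_convex_cyl: "absolutely_convex (cyl s i)"
  using absolutely_convex_bal unfolding cyl_def absolutely_convex_def by blast

text \<open>
  Convergence in some step of \<open>E 0\<close>. Since every step of every \<open>E N\<close> embeds continuously into a step
  of \<open>E 0\<close>, it identifies limits taken in different Banach spaces.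
\<close>

definition converges :: "(nat \<Rightarrow> 'v) \<Rightarrow> 'v \<Rightarrow> bool" where
  "converges u l \<longleftrightarrow> (\<exists>n. (\<forall>\<^sub>F k in sequentially. u k - l \<in> X 0 n) \<and> (\<lambda>k. p 0 n (u k - l)) \<longlonglongrightarrow> 0)"

lemma converges_step_mono:
  assumes "\<forall>\<^sub>F k in sequentially. u k - l \<in> X N n" "(\<lambda>k. p N n (u k - l)) \<longlonglongrightarrow> 0"
    and le: "N' \<le> N" "n \<le> n'"
  shows "\<forall>\<^sub>F k in sequentially. u k - l \<in> X N' n'" "(\<lambda>k. p N' n' (u k - l)) \<longlonglongrightarrow> 0"
proof -
  show ev: "\<forall>\<^sub>F k in sequentially. u k - l \<in> X N' n'"
    using assms(1) by eventually_elim (rule X_p_mono(1)[OF le])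
  show "(\<lambda>k. p N' n' (u k - l)) \<longlonglongrightarrow> 0"
  proof (rule tendsto_sandwich[OF _ _ tendsto_const assms(2)])
    show "\<forall>\<^sub>F k in sequentially. 0 \<le> p N' n' (u k - l)"
      using ev by eventually_elim (rule seminorm_onD(2)[OF semi])
    show "\<forall>\<^sub>F k in sequentially. p N' n' (u k - l) \<le> p N n (u k - l)"
      using assms(1) by eventually_elim (rule X_p_mono(2)[OF le])
  qed
qed

lemma convergesI:
  assumes "\<forall>\<^sub>F k in sequentially. u k - l \<in> X N n" "(\<lambda>k. p N n (u k - l)) \<longlonglongrightarrow> 0"
  shows "converges u l"
  unfolding converges_def using converges_step_mono[OF assms, of 0 n] by auto

lemma converges_add:
  assumes "converges u l" "converges v k"
  shows "converges (\<lambda>i. u i + v i) (l + k)"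
proof -
  obtain m n where "\<forall>\<^sub>F i in sequentially. u i - l \<in> X 0 m" "(\<lambda>i. p 0 m (u i - l)) \<longlonglongrightarrow> 0"
    "\<forall>\<^sub>F i in sequentially. v i - k \<in> X 0 n" "(\<lambda>i. p 0 n (v i - k)) \<longlonglongrightarrow> 0"
    using assms by (auto simp: converges_def)
  then obtain n where u: "\<forall>\<^sub>F i in sequentially. u i - l \<in> X 0 n" "(\<lambda>i. p 0 n (u i - l)) \<longlonglongrightarrow> 0"
    and v: "\<forall>\<^sub>F i in sequentially. v i - k \<in> X 0 n" "(\<lambda>i. p 0 n (v i - k)) \<longlonglongrightarrow> 0"
    using converges_step_mono[of u l 0 m 0 "max m n"] converges_step_mono[of v k 0 n 0 "max m n"] by auto
  have eq: "u i + v i - (l + k) = (u i - l) + (v i - k)" for i by simp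
  have ev: "\<forall>\<^sub>F i in sequentially. u i + v i - (l + k) \<in> X 0 n"
    using u(1) v(1) unfolding eq by eventually_elim (rule subspace_add[OF subspace_X])
  have "(\<lambda>i. p 0 n (u i + v i - (l + k))) \<longlonglongrightarrow> 0"
  proof (rule tendsto_sandwich[OF _ _ tendsto_const])
    show "\<forall>\<^sub>F i in sequentially. 0 \<le> p 0 n (u i + v i - (l + k))"
      using ev by eventually_elim (rule seminorm_onD(2)[OF semi])
    show "\<forall>\<^sub>F i in sequentially. p 0 n (u i + v i - (l + k)) \<le> p 0 n (u i - l) + p 0 n (v i - k)"
      using u(1) v(1) unfolding eq by eventually_elim (rule seminorm_onD(4)[OF semi])
    show "(\<lambda>i. p 0 n (u i - l) + p 0 n (v i - k)) \<longlonglongrightarrow> 0" using tendsto_add[OF u(2) v(2)] by simp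
  qed
  with ev show ?thesis by (rule convergesI)
qed

lemma converges_scale:
  assumes "converges u l"
  shows "converges (\<lambda>i. c *C u i) (c *C l)"
proof -
  obtain n where u: "\<forall>\<^sub>F i in sequentially. u i - l \<in> X 0 n" "(\<lambda>i. p 0 n (u i - l)) \<longlonglongrightarrow> 0"
    using assms by (auto simp: converges_def)
  have eq: "c *C u i - c *C l = c *C (u i - l)" for i by (simp add: scale_right_diff_distrib)
  have "\<forall>\<^sub>F i in sequentially. c *C u i - c *C l \<in> X 0 n"
    using u(1) unfolding eq by eventually_elim (rule subspace_scale[OF subspace_X])
  moreover have "(\<lambda>i. p 0 n (c *C u i - c *C l)) \<longlonglongrightarrow> 0"
  proof (rule tendsto_cong[THEN iffD2])
    show "\<forall>\<^sub>F i in sequentially. p 0 n (c *C u i - c *C l) = cmod c * p 0 n (u i - l)"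
      using u(1) unfolding eq by eventually_elim (rule seminorm_onD(3)[OF semi])
    show "(\<lambda>i. cmod c * p 0 n (u i - l)) \<longlonglongrightarrow> 0" using tendsto_mult_right_zero[OF u(2)] by simp
  qed
  ultimately show ?thesis by (rule convergesI)
qed

lemma converges_diff:
  "converges u l \<Longrightarrow> converges v k \<Longrightarrow> converges (\<lambda>i. u i - v i) (l - k)"
  using converges_add[of u l "\<lambda>i. (-1) *C v i" "(-1) *C k"] converges_scale[of v k "-1"] by simp

lemma converges_const: "converges (\<lambda>_. l) l"
  by (rule convergesI[where N = 0 and n = 0]) (use subspace_0[OF subspace_X] seminorm_on_0[OF semi] in auto)

lemma converges_cong:
  "\<forall>\<^sub>F i in sequentially. u i = v i \<Longrightarrow> converges u l \<Longrightarrow> converges v l"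
proof -
  assume eq: "\<forall>\<^sub>F i in sequentially. u i = v i" and "converges u l"
  then obtain n where u: "\<forall>\<^sub>F i in sequentially. u i - l \<in> X 0 n" "(\<lambda>i. p 0 n (u i - l)) \<longlonglongrightarrow> 0"
    by (auto simp: converges_def)
  have "\<forall>\<^sub>F i in sequentially. v i - l \<in> X 0 n" using eq u(1) by eventually_elim simp
  moreover have "(\<lambda>i. p 0 n (v i - l)) \<longlonglongrightarrow> 0"
    by (rule tendsto_cong[THEN iffD1, OF _ u(2)]) (use eq in eventually_elim, simp)
  ultimately show ?thesis by (rule convergesI)
qed

lemma converges_offset:
  assumes "converges (\<lambda>i. u (i + k)) l"
  shows "converges u l"
proof -
  obtain n where "\<forall>\<^sub>F i in sequentially. u (i + k) - l \<in> X 0 n" "(\<lambda>i. p 0 n (u (i + k) - l)) \<longlonglongrightarrow> 0"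
    using assms by (auto simp: converges_def)
  then have "\<forall>\<^sub>F i in sequentially. u i - l \<in> X 0 n" "(\<lambda>i. p 0 n (u i - l)) \<longlonglongrightarrow> 0"
    using eventually_sequentially_seg[of "\<lambda>i. u i - l \<in> X 0 n" k] LIMSEQ_offset[of "\<lambda>i. p 0 n (u i - l)" k] by auto
  then show ?thesis by (rule convergesI)
qed

text \<open>The two witnesses may live in different steps, but the difference sequence lies
  eventually in a common step of \<open>E 0\<close>, where the norm is definite.\<close>

lemma converges_unique:
  assumes "converges u l" "converges u k"
  shows "l = k"
proof -
  have "converges (\<lambda>i. 0) (l - k)" using converges_diff[OF assms] by simp
  then obtain n where n: "\<forall>\<^sub>F i in sequentially. - (l - k) \<in> X 0 n" "(\<lambda>i::nat. p 0 n (- (l - k))) \<longlonglongrightarrow> 0"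
    unfolding converges_def by auto
  then have "- (l - k) \<in> X 0 n" by simp
  moreover have "p 0 n (- (l - k)) = 0" using n(2) by (simp add: LIMSEQ_const_iff)
  ultimately have "- (l - k) = 0" using norm[of 0 n] unfolding norm_on_def by blast
  then show ?thesis by simp
qed

section \<open>Series with geometric weights\<close>

text \<open>The terms are bounded by m 2^-l in one Banach space, so the partial sums are Cauchy
  there. The limit has norm at most 2 m, which is recorded by halving it.\<close>

lemma series_bal:
  assumes b: "\<And>l. b l \<in> bal N m"
  shows "\<exists>S. (1/2) *C S \<in> bal N m \<and> converges (\<lambda>L. \<Sum>l<L. (1/2)^l *C b l) S"
proof -
  define c where "c L = (\<Sum>l<L. (1/2)^l *C b l)" for L
  have bX: "b l \<in> X N m" "p N m (b l) \<le> m" for l using b[of l] by (auto simp: bal_def)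
  have cX: "c L \<in> X N m" for L unfolding c_def by (intro subspace_sum[OF subspace_X] subspace_scale[OF subspace_X] bX)
  \<comment> \<open>The factor 1 - 2^-k makes this the exact value of the geometric sum over k
    terms, so that the induction closes.\<close>
  have tail: "p N m (c (j + k) - c j) \<le> 2 * m * (1/2)^j * (1 - (1/2)^k)" for j k
  proof (induction k)
    case (Suc k)
    have "c (j + Suc k) - c j = (c (j + k) - c j) + (1/2)^(j + k) *C b (j + k)" by (simp add: c_def)
    also have "p N m \<dots> \<le> p N m (c (j + k) - c j) + p N m ((1/2)^(j + k) *C b (j + k))"
      by (intro seminorm_onD(4)[OF semi] subspace_diff[OF subspace_X] cX subspace_scale[OF subspace_X] bX)
    also have "p N m ((1/2)^(j + k) *C b (j + k)) = (1/2)^(j + k) * p N m (b (j + k))"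
      by (simp add: seminorm_onD(3)[OF semi bX(1)] norm_power norm_divide)
    also have "\<dots> \<le> (1/2)^(j + k) * m" by (intro mult_left_mono bX) auto
    finally have "p N m (c (j + Suc k) - c j) \<le> 2 * m * (1/2)^j * (1 - (1/2)^k) + (1/2)^(j + k) * m"
      using Suc by simp
    also have "\<dots> = 2 * m * (1/2)^j * (1 - (1/2)^Suc k)" by (simp add: power_add field_simps)
    finally show ?case .
  qed (simp add: seminorm_on_0[OF semi])
  have tail': "p N m (c i - c j) \<le> 2 * m * (1/2)^j" if "j \<le> i" for i j
  proof -
    have "p N m (c (j + (i - j)) - c j) \<le> 2 * m * (1/2)^j * (1 - (1/2)^(i - j))" by (rule tail)
    also have "\<dots> \<le> 2 * m * (1/2)^j * 1" by (intro mult_left_mono) auto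
    finally show ?thesis using that by simp
  qed
  have "\<exists>n0. \<forall>i\<ge>n0. \<forall>j\<ge>n0. p N m (c i - c j) < e" if "e > 0" for e
  proof -
    have "(\<lambda>j. 2 * real m * (1/2)^j) \<longlonglongrightarrow> 0" by (intro tendsto_mult_right_zero LIMSEQ_power_zero) simp
    then have "\<exists>n0. \<forall>j\<ge>n0. 2 * real m * (1/2)^j < e"
      using order_tendstoD(2)[of "\<lambda>j. 2 * real m * (1/2)^j" 0 sequentially e] that
      unfolding eventually_sequentially by blast
    then obtain n0 where n0: "\<And>j. j \<ge> n0 \<Longrightarrow> 2 * real m * (1/2)^j < e" by blast
    have "p N m (c i - c j) < e" if "i \<ge> n0" "j \<ge> n0" for i j
      using tail'[of i j] tail'[of j i] n0[OF that(1)] n0[OF that(2)] seminorm_on_commute[OF semi cX cX, of i j]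
      by (cases "i \<le> j") auto
    then show ?thesis by blast
  qed
  then obtain S where S: "S \<in> X N m" "(\<lambda>L. p N m (c L - S)) \<longlonglongrightarrow> 0"
    using complete_fnorm_on_complete[OF banach_on_imp_complete_fnorm_on[OF banach], of c N m] cX by blast
  have "converges c S"
    by (intro convergesI[OF _ S(2)] always_eventually allI subspace_diff[OF subspace_X] cX S(1))
  moreover have "p N m S \<le> 2 * m"
  proof (rule LIMSEQ_le_const)
    show "(\<lambda>L. p N m (c L - S) + 2 * m) \<longlonglongrightarrow> 2 * m" using tendsto_add[OF S(2) tendsto_const] by simp
    show "\<exists>K. \<forall>L\<ge>K. p N m S \<le> p N m (c L - S) + 2 * m"
    proof (intro exI allI impI)
      fix L
      have "p N m S = p N m (c L - (c L - S))" by simp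
      also have "\<dots> = p N m ((c L - S) - c L)" by (intro seminorm_on_commute[OF semi] cX subspace_diff[OF subspace_X] S)
      also have "\<dots> = p N m ((c L - S) + - c L)" by simp
      also have "\<dots> \<le> p N m (c L - S) + p N m (- c L)"
        by (intro seminorm_onD(4)[OF semi] cX subspace_diff[OF subspace_X] subspace_neg[OF subspace_X] S)
      also have "p N m (- c L) = p N m (c L)" by (rule seminorm_on_minus[OF semi cX])
      also have "p N m (c L) \<le> 2 * m" using tail'[of 0 L] by (simp add: c_def)
      finally show "p N m S \<le> p N m (c L - S) + 2 * m" by simp
    qed
  qed
  then have "(1/2) *C S \<in> bal N m"
    using subspace_scale[OF subspace_X S(1)] seminorm_onD(3)[OF semi S(1), of "1/2"] by (simp add: bal_def)
  ultimately show ?thesis unfolding c_def by blast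
qed

text \<open>Finitely many terms outside the ball do not affect convergence, only which ball the sum
  lies in. Hence the conclusion is membership in \<open>E N\<close> instead of a bound.\<close>

lemma series_E:
  assumes b: "\<And>l. b l \<in> E N" and tail: "\<And>l. l \<ge> k \<Longrightarrow> b l \<in> bal N m"
  shows "\<exists>S\<in>E N. converges (\<lambda>L. \<Sum>l<L. (1/2)^l *C b l) S"
proof -
  obtain S where S: "(1/2) *C S \<in> bal N m" "converges (\<lambda>L. \<Sum>l<L. (1/2)^l *C b (l + k)) S"
    using series_bal[of "\<lambda>l. b (l + k)" N m] tail by auto
  let ?a = "\<Sum>l<k. (1/2)^l *C b l"
  have eq: "(\<Sum>l<L + k. (1/2)^l *C b l) = ?a + (1/2)^k *C (\<Sum>l<L. (1/2)^l *C b (l + k))" for L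
    by (induction L) (simp_all add: scale_right_distrib power_add mult.commute add.assoc)
  have "converges (\<lambda>L. \<Sum>l<L + k. (1/2)^l *C b l) (?a + (1/2)^k *C S)"
    unfolding eq by (intro converges_add converges_const converges_scale S)
  then have "converges (\<lambda>L. \<Sum>l<L. (1/2)^l *C b l) (?a + (1/2)^k *C S)" by (rule converges_offset)
  moreover have "S \<in> E N" using in_bal_double[OF S(1)] bal_subset_E by blast
  then have "?a + (1/2)^k *C S \<in> E N"
    by (intro subspace_add[OF subspace_E] subspace_sum[OF subspace_E] subspace_scale[OF subspace_E] b)
  ultimately show ?thesis by blast
qed

lemma cyl_mono: "i \<le> j \<Longrightarrow> cyl s j \<subseteq> cyl s i"
  by (auto simp: cyl_def)

lemma zero_in_bal: "0 \<in> bal N m"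
  using subspace_0[OF subspace_X] seminorm_on_0[OF semi] by (simp add: bal_def)

section \<open>The two Baire arguments\<close>

text \<open>Expand a sequence u, whose only nonzero entry z is at position M, into images of
  sequences constrained by the branch. Summing the preimages gives S with differences u, so S is
  constant up to M and constant beyond M. The later constant lies in every \<open>E N\<close>, hence
  in \<open>Y\<close>; the earlier one lies in the balls below i, and z is the difference of the
  two.\<close>

lemma Proj1_zero_decomposition:
  assumes "Proj1_is_zero E"
  shows "\<exists>s. \<forall>i. \<exists>M\<ge>i. \<forall>z\<in>E M. \<exists>y\<in>Y. z - y \<in> cyl s i"
proof -
  interpret seq: complex_space "\<lambda>c (x :: nat \<Rightarrow> 'v) N. c *C x N" by (rule complex_space_sequences)
  let ?Q = "Pi UNIV E"
  have Q: "seq.complete_fnorm_on ?Q discrete_fnorm" by (rule complete_fnorm_on_product[OF subspace_E])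
  \<comment> \<open>The constraints are put on the preimages y, and the Baire argument runs in the
    image space; surjectivity makes the root the whole product.\<close>
  define P where "P s = {spectrum_diff y | y. y \<in> ?Q \<and> (\<forall>j<length s. y j \<in> bal j (s ! j))}" for s
  have diff: "spectrum_diff y \<in> ?Q" if "y \<in> ?Q" for y
  proof (rule Pi_I)
    fix N
    have "y (Suc N) \<in> E N" using that E_mono[of N "Suc N"] by auto
    then show "spectrum_diff y N \<in> E N"
      using that unfolding spectrum_diff_def by (intro subspace_diff[OF subspace_E]) auto
  qed
  have P0: "P [] = ?Q"
  proof
    show "P [] \<subseteq> ?Q" using diff by (auto simp: P_def)
    show "?Q \<subseteq> P []"
    proof
      fix x assume "x \<in> ?Q"
      from Proj1_is_zero_imp_surj[OF assms this subspace_0[OF subspace_E]]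
      show "x \<in> P []" by (auto simp: P_def)
    qed
  qed
  have PQ: "P s \<subseteq> ?Q" for s using diff by (auto simp: P_def)
  have web: "P s \<subseteq> (\<Union>m. P (s @ [m]))" for s
  proof
    fix x assume "x \<in> P s"
    then obtain y where y: "x = spectrum_diff y" "y \<in> ?Q" "\<And>j. j < length s \<Longrightarrow> y j \<in> bal j (s ! j)"
      by (auto simp: P_def)
    have "y (length s) \<in> E (length s)" using y(2) by blast
    then obtain m where m: "y (length s) \<in> bal (length s) m" using in_bal by blast
    have "y j \<in> bal j ((s @ [m]) ! j)" if "j < length (s @ [m])" for j
      using that y(3)[of j] m by (cases "j = length s") (auto simp: nth_append)
    then have "x \<in> P (s @ [m])" unfolding P_def using y(1,2) by blast
    then show "x \<in> (\<Union>m. P (s @ [m]))" by blast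
  qed
  have conv: "seq.absolutely_convex (P s)" for s
    unfolding seq.absolutely_convex_def
  proof (intro ballI allI impI)
    fix x x' and \<alpha> \<beta> :: complex
    assume "x \<in> P s" "x' \<in> P s" and ab: "cmod \<alpha> + cmod \<beta> \<le> 1"
    then obtain y y' where y: "x = spectrum_diff y" "y \<in> ?Q" "\<And>j. j < length s \<Longrightarrow> y j \<in> bal j (s ! j)"
      and y': "x' = spectrum_diff y'" "y' \<in> ?Q" "\<And>j. j < length s \<Longrightarrow> y' j \<in> bal j (s ! j)"
      by (auto simp: P_def)
    define w where "w N = \<alpha> *C y N + \<beta> *C y' N" for N
    have "w \<in> ?Q" using y(2) y'(2) unfolding w_def
      by (intro Pi_I subspace_add[OF subspace_E] subspace_scale[OF subspace_E]) auto
    moreover have "w j \<in> bal j (s ! j)" if "j < length s" for j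
      unfolding w_def by (rule absolutely_convexD[OF absolutely_convex_bal y(3)[OF that] y'(3)[OF that] ab])
    moreover have "(\<lambda>N. \<alpha> *C x N) + (\<lambda>N. \<beta> *C x' N) = spectrum_diff w"
      by (simp add: fun_eq_iff y(1) y'(1) spectrum_diff_def w_def scale_right_diff_distrib)
    ultimately show "(\<lambda>N. \<alpha> *C x N) + (\<lambda>N. \<beta> *C x' N) \<in> P s" unfolding P_def by blast
  qed
  obtain \<sigma> where \<sigma>: "\<And>i. \<exists>e>0. \<forall>u\<in>?Q. discrete_fnorm u < e \<longrightarrow>
      (\<exists>x. (\<forall>l. x l \<in> P (map \<sigma> [0..<i + l])) \<and>
        (\<lambda>L. discrete_fnorm (u - (\<Sum>l<L. (\<lambda>N. (1/2)^l *C x l N)))) \<longlonglongrightarrow> 0)"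
    using seq.web_expansion[where P = P, OF Q P0 PQ web conv] by blast
  show ?thesis
  proof (intro exI[of _ "\<lambda>j. 2 * \<sigma> j"] allI)
    fix i
    obtain e where e: "e > 0" "\<And>u. u \<in> ?Q \<Longrightarrow> discrete_fnorm u < e \<Longrightarrow>
      \<exists>x. (\<forall>l. x l \<in> P (map \<sigma> [0..<i + l])) \<and>
        (\<lambda>L. discrete_fnorm (u - (\<Sum>l<L. (\<lambda>N. (1/2)^l *C x l N)))) \<longlonglongrightarrow> 0"
      using \<sigma>[of i] by blast
    obtain k where k: "(1/2)^k < e" using real_arch_pow_inv[OF e(1), of "1/2"] by auto
    \<comment> \<open>M > k makes u vanish up to k, so u is small for every z; M > i makes S agree
      with S M at all positions below i.\<close>
    define M where "M = Suc (max k i)"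
    show "\<exists>M\<ge>i. \<forall>z\<in>E M. \<exists>y\<in>Y. z - y \<in> cyl (\<lambda>j. 2 * \<sigma> j) i"
    proof (intro exI[of _ M] conjI ballI)
      show "M \<ge> i" by (simp add: M_def)
      fix z assume z: "z \<in> E M"
      define u where "u j = (if j = M then z else 0)" for j
      have "u \<in> ?Q" using z subspace_0[OF subspace_E] by (auto simp: u_def)
      moreover have "discrete_fnorm u < (1/2)^k" unfolding discrete_fnorm_less by (auto simp: u_def M_def)
      ultimately obtain x where x: "\<And>l. x l \<in> P (map \<sigma> [0..<i + l])"
        "(\<lambda>L. discrete_fnorm (u - (\<Sum>l<L. (\<lambda>N. (1/2)^l *C x l N)))) \<longlonglongrightarrow> 0"
        using e(2)[of u] k by auto
      from x(1) have "\<exists>y. x l = spectrum_diff y \<and> y \<in> ?Q \<and> (\<forall>j<i + l. y j \<in> bal j (\<sigma> j))" for l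
        unfolding P_def by fastforce
      then obtain y where y: "\<And>l. x l = spectrum_diff (y l)" "\<And>l. y l \<in> ?Q"
        "\<And>l j. j < i + l \<Longrightarrow> y l j \<in> bal j (\<sigma> j)" by metis
      have yE: "y l j \<in> E j" for l j using y(2)[of l] by blast
      \<comment> \<open>For j < i every term obeys the constraint at j, so the sum is controlled
        uniformly in z. For other j the constraint holds from the term \<open>Suc j\<close> on,
        which still gives convergence.\<close>
      have "\<exists>S. S \<in> E j \<and> converges (\<lambda>L. \<Sum>l<L. (1/2)^l *C y l j) S \<and> (j < i \<longrightarrow> (1/2) *C S \<in> bal j (\<sigma> j))" for j
      proof (cases "j < i")
        case True
        then obtain S where S: "(1/2) *C S \<in> bal j (\<sigma> j)" "converges (\<lambda>L. \<Sum>l<L. (1/2)^l *C y l j) S"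
          using series_bal[of "\<lambda>l. y l j" j "\<sigma> j"] y(3) by auto
        then show ?thesis using in_bal_double[OF S(1)] bal_subset_E by blast
      next
        case False
        then show ?thesis using series_E[of "\<lambda>l. y l j" j "Suc j" "\<sigma> j"] yE y(3) by auto
      qed
      then obtain S where S: "\<And>j. S j \<in> E j" "\<And>j. converges (\<lambda>L. \<Sum>l<L. (1/2)^l *C y l j) (S j)"
        "\<And>j. j < i \<Longrightarrow> (1/2) *C S j \<in> bal j (\<sigma> j)" by metis
      \<comment> \<open>Convergence in the discrete product is eventual equality at each coordinate
        j. So the partial sums of the differences converge to u j as well, and uniqueness of limits
        identifies the two.\<close>
      have diffS: "S (Suc j) - S j = u j" for j
      proof (rule converges_unique)
        have sum_apply: "(\<Sum>l<L. (\<lambda>N. (1/2)^l *C x l N)) j = (\<Sum>l<L. (1/2)^l *C x l j)" for L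
          by (induction L) auto
        have "converges (\<lambda>L. (\<Sum>l<L. (1/2)^l *C y l (Suc j)) - (\<Sum>l<L. (1/2)^l *C y l j)) (S (Suc j) - S j)"
          by (intro converges_diff S)
        then show "converges (\<lambda>L. \<Sum>l<L. (1/2)^l *C x l j) (S (Suc j) - S j)"
          by (simp add: y(1) spectrum_diff_def scale_right_diff_distrib sum_subtractf)
        have "\<forall>\<^sub>F L in sequentially. discrete_fnorm (u - (\<Sum>l<L. (\<lambda>N. (1/2)^l *C x l N))) < (1/2)^j"
          using order_tendstoD(2)[OF x(2), of "(1/2)^j"] by simp
        then have "\<forall>\<^sub>F L in sequentially. u j = (\<Sum>l<L. (1/2)^l *C x l j)"
        proof eventually_elim
          case (elim L)
          then have "(u - (\<Sum>l<L. (\<lambda>N. (1/2)^l *C x l N))) j = 0" unfolding discrete_fnorm_less by blast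
          then show ?case using sum_apply[of L] by simp
        qed
        then show "converges (\<lambda>L. \<Sum>l<L. (1/2)^l *C x l j) (u j)"
          by (rule converges_cong) (rule converges_const)
      qed
      have low: "S j = S 0" if "j \<le> M" for j
        using that
      proof (induction j)
        case (Suc j)
        then show ?case using diffS[of j] by (simp add: u_def)
      qed simp
      have high: "S j = S (Suc M)" if "j \<ge> Suc M" for j
        using that
      proof (induction j rule: dec_induct)
        case (step j)
        then show ?case using diffS[of j] by (simp add: u_def)
      qed simp
      have "S (Suc M) \<in> Y"
        by (rule Y_I[of "Suc M"]) (use high S(1) in metis)
      moreover have "z - S (Suc M) \<in> cyl (\<lambda>j. 2 * \<sigma> j) i"
        unfolding cyl_def
      proof (intro CollectI allI impI)
        fix j assume j: "j < i"
        then have "S j = S M" using low[of j] low[of M] by (simp add: M_def)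
        then have eq: "z - S (Suc M) = (-1) *C S j" using diffS[of M] by (simp add: u_def algebra_simps)
        have "(-1) *C ((1/2) *C S j) \<in> bal j (\<sigma> j)"
          by (rule absolutely_convex_scale[OF absolutely_convex_bal S(3)[OF j]]) simp
        then have "(1/2) *C (z - S (Suc M)) \<in> bal j (\<sigma> j)" by (simp add: eq)
        then show "z - S (Suc M) \<in> bal j (2 * \<sigma> j)" by (rule in_bal_double)
      qed
      ultimately show "\<exists>y\<in>Y. z - y \<in> cyl (\<lambda>j. 2 * \<sigma> j) i" by blast
    qed
  qed
qed

text \<open>The same expansion inside one Banach space, with the remainder z - y kept in a fixed set
  while y meets one more ball at each level. The gain is that y itself becomes controlled for small
  z; the price is a factor 2 on the remainder.\<close>

lemma banach_decomposition:
  assumes cover: "\<And>z. z \<in> X M m \<Longrightarrow> \<exists>y\<in>Y. z - y \<in> cyl s0 i0" and i0: "i0 > 0"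
  shows "\<exists>s. \<forall>i. \<exists>e>0. \<forall>z\<in>X M m. p M m z < e \<longrightarrow>
    (\<exists>y\<in>Y. y \<in> cyl s i \<and> (1/2) *C (z - y) \<in> cyl s0 i0)"
proof -
  define P where "P s = {x \<in> X M m. \<exists>y\<in>Y. x - y \<in> cyl s0 i0 \<and> (\<forall>j<length s. y \<in> bal j (s ! j))}" for s
  have P0: "P [] = X M m" using cover by (auto simp: P_def)
  have PQ: "P s \<subseteq> X M m" for s by (auto simp: P_def)
  have web: "P s \<subseteq> (\<Union>m. P (s @ [m]))" for s
  proof
    fix x assume "x \<in> P s"
    then obtain y where y: "x \<in> X M m" "y \<in> Y" "x - y \<in> cyl s0 i0" "\<And>j. j < length s \<Longrightarrow> y \<in> bal j (s ! j)"
      by (auto simp: P_def)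
    obtain k where k: "y \<in> bal (length s) k" using in_bal[OF Y_E[OF y(2)]] by blast
    have "y \<in> bal j ((s @ [k]) ! j)" if "j < length (s @ [k])" for j
      using that y(4)[of j] k by (cases "j = length s") (auto simp: nth_append)
    then have "x \<in> P (s @ [k])" unfolding P_def using y(1,2,3) by blast
    then show "x \<in> (\<Union>m. P (s @ [m]))" by blast
  qed
  have conv: "absolutely_convex (P s)" for s
    unfolding absolutely_convex_def
  proof (intro ballI allI impI)
    fix x x' and \<alpha> \<beta> :: complex
    assume "x \<in> P s" "x' \<in> P s" and ab: "cmod \<alpha> + cmod \<beta> \<le> 1"
    then obtain y y' where y: "x \<in> X M m" "y \<in> Y" "x - y \<in> cyl s0 i0" "\<And>j. j < length s \<Longrightarrow> y \<in> bal j (s ! j)"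
      and y': "x' \<in> X M m" "y' \<in> Y" "x' - y' \<in> cyl s0 i0" "\<And>j. j < length s \<Longrightarrow> y' \<in> bal j (s ! j)"
      by (auto simp: P_def)
    have "\<alpha> *C x + \<beta> *C x' \<in> X M m"
      by (intro subspace_add[OF subspace_X] subspace_scale[OF subspace_X] y y')
    moreover have "\<alpha> *C y + \<beta> *C y' \<in> Y"
      by (intro subspace_add[OF subspace_Y] subspace_scale[OF subspace_Y] y y')
    moreover have "\<alpha> *C (x - y) + \<beta> *C (x' - y') \<in> cyl s0 i0"
      by (rule absolutely_convexD[OF absolutely_convex_cyl y(3) y'(3) ab])
    then have "(\<alpha> *C x + \<beta> *C x') - (\<alpha> *C y + \<beta> *C y') \<in> cyl s0 i0"
      by (simp add: scale_right_diff_distrib algebra_simps)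
    moreover have "\<alpha> *C y + \<beta> *C y' \<in> bal j (s ! j)" if "j < length s" for j
      by (rule absolutely_convexD[OF absolutely_convex_bal y(4)[OF that] y'(4)[OF that] ab])
    ultimately show "\<alpha> *C x + \<beta> *C x' \<in> P s" unfolding P_def by blast
  qed
  obtain \<sigma> where \<sigma>: "\<And>i. \<exists>e>0. \<forall>u\<in>X M m. p M m u < e \<longrightarrow>
      (\<exists>x. (\<forall>l. x l \<in> P (map \<sigma> [0..<i + l])) \<and> (\<lambda>L. p M m (u - (\<Sum>l<L. (1/2)^l *C x l))) \<longlonglongrightarrow> 0)"
    using web_expansion[where P = P, OF banach_on_imp_complete_fnorm_on[OF banach] P0 PQ web conv] by blast
  show ?thesis
  proof (intro exI[of _ "\<lambda>j. 2 * \<sigma> j"] allI)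
    fix i
    obtain e where e: "e > 0" "\<And>u. u \<in> X M m \<Longrightarrow> p M m u < e \<Longrightarrow>
      \<exists>x. (\<forall>l. x l \<in> P (map \<sigma> [0..<i + l])) \<and> (\<lambda>L. p M m (u - (\<Sum>l<L. (1/2)^l *C x l))) \<longlonglongrightarrow> 0"
      using \<sigma>[of i] by blast
    show "\<exists>e>0. \<forall>z\<in>X M m. p M m z < e \<longrightarrow> (\<exists>y\<in>Y. y \<in> cyl (\<lambda>j. 2 * \<sigma> j) i \<and> (1/2) *C (z - y) \<in> cyl s0 i0)"
    proof (intro exI[of _ e] conjI ballI impI e(1))
      fix z assume z: "z \<in> X M m" "p M m z < e"
      obtain x where x: "\<And>l. x l \<in> P (map \<sigma> [0..<i + l])"
        "(\<lambda>L. p M m (z - (\<Sum>l<L. (1/2)^l *C x l))) \<longlonglongrightarrow> 0"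
        using e(2)[OF z] by blast
      have xX: "x l \<in> X M m" for l using x(1) PQ by blast
      have sumX: "(\<Sum>l<L. (1/2)^l *C x l) \<in> X M m" for L
        by (intro subspace_sum[OF subspace_X] subspace_scale[OF subspace_X] xX)
      have zlim: "converges (\<lambda>L. \<Sum>l<L. (1/2)^l *C x l) z"
      proof (rule convergesI)
        show "\<forall>\<^sub>F L in sequentially. (\<Sum>l<L. (1/2)^l *C x l) - z \<in> X M m"
          by (intro always_eventually allI subspace_diff[OF subspace_X] sumX z)
        show "(\<lambda>L. p M m ((\<Sum>l<L. (1/2)^l *C x l) - z)) \<longlonglongrightarrow> 0"
          using x(2) seminorm_on_commute[OF semi z(1) sumX] by simp
      qed
      from x(1) have "\<exists>y\<in>Y. x l - y \<in> cyl s0 i0 \<and> (\<forall>j<i + l. y \<in> bal j (\<sigma> j))" for l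
        unfolding P_def by fastforce
      then obtain y where y: "\<And>l. y l \<in> Y" "\<And>l. x l - y l \<in> cyl s0 i0"
        "\<And>l j. j < i + l \<Longrightarrow> y l \<in> bal j (\<sigma> j)" by metis
      \<comment> \<open>For each j the terms lie eventually in one ball of \<open>E j\<close>, which
        gives a sum in \<open>E j\<close>. These sums coincide by uniqueness of limits, so the
        common value belongs to \<open>Y\<close>.\<close>
      have "\<exists>S\<in>E j. converges (\<lambda>L. \<Sum>l<L. (1/2)^l *C y l) S" for j
        using series_E[of y j "Suc j" "\<sigma> j"] Y_E[OF y(1)] y(3) by auto
      then obtain S0 where S0: "\<And>j. S0 j \<in> E j" "\<And>j. converges (\<lambda>L. \<Sum>l<L. (1/2)^l *C y l) (S0 j)" by metis
      define S where "S = S0 0"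
      have S: "converges (\<lambda>L. \<Sum>l<L. (1/2)^l *C y l) S" using S0(2) by (simp add: S_def)
      have "S0 j = S" for j by (rule converges_unique[OF S0(2) S])
      then have "S \<in> E j" for j using S0(1)[of j] by simp
      then have SY: "S \<in> Y" by (simp add: Y_def)
      have "S \<in> cyl (\<lambda>j. 2 * \<sigma> j) i"
        unfolding cyl_def
      proof (intro CollectI allI impI)
        fix j assume "j < i"
        then obtain S' where S': "(1/2) *C S' \<in> bal j (\<sigma> j)" "converges (\<lambda>L. \<Sum>l<L. (1/2)^l *C y l) S'"
          using series_bal[of y j "\<sigma> j"] y(3) by auto
        have "S' = S" by (rule converges_unique[OF S'(2) S])
        with in_bal_double[OF S'(1)] show "S \<in> bal j (2 * \<sigma> j)" by simp
      qed
      moreover have "(1/2) *C (z - S) \<in> cyl s0 i0"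
        unfolding cyl_def
      proof (intro CollectI allI impI)
        fix j assume "j < i0"
        then obtain D where D: "(1/2) *C D \<in> bal j (s0 j)"
            "converges (\<lambda>L. \<Sum>l<L. (1/2)^l *C (x l - y l)) D"
          using series_bal[of "\<lambda>l. x l - y l" j "s0 j"] y(2) by (auto simp: cyl_def)
        have "converges (\<lambda>L. (\<Sum>l<L. (1/2)^l *C x l) - (\<Sum>l<L. (1/2)^l *C y l)) (z - S)"
          by (rule converges_diff[OF zlim S])
        then have "converges (\<lambda>L. \<Sum>l<L. (1/2)^l *C (x l - y l)) (z - S)"
          by (simp add: scale_right_diff_distrib sum_subtractf)
        from converges_unique[OF D(2) this] D(1) show "(1/2) *C (z - S) \<in> bal j (s0 j)" by simp
      qed
      ultimately show "\<exists>y\<in>Y. y \<in> cyl (\<lambda>j. 2 * \<sigma> j) i \<and> (1/2) *C (z - y) \<in> cyl s0 i0"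
        using SY by blast
    qed
  qed
qed

section \<open>Banach discs of the limit and ultrabornologicity\<close>

text \<open>The full branch belonging to \<open>cyl\<close>. These are the only Banach discs on
  which the absorption hypothesis is used.\<close>

definition disc where "disc s = {x. \<forall>j. x \<in> bal j (s j)}" for s :: "nat \<Rightarrow> nat"

lemma absolutely_convex_disc: "absolutely_convex (disc s)"
  using absolutely_convex_bal unfolding disc_def absolutely_convex_def by blast

lemma disc_subset_Y: "disc s \<subseteq> Y"
  using bal_subset_E unfolding disc_def Y_def by blast

lemma zero_in_disc: "0 \<in> disc s"
  by (simp add: disc_def zero_in_bal)

lemma disc_scaled:
  assumes "t > 0"
  shows "complex_of_real (inverse t) *C x \<in> disc s \<longleftrightarrow> (\<forall>j. x \<in> X j (s j) \<and> p j (s j) x \<le> t * s j)"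
proof -
  have "complex_of_real (inverse t) *C x \<in> bal j m \<longleftrightarrow> x \<in> X j m \<and> p j m x \<le> t * m" for j m
  proof
    assume "complex_of_real (inverse t) *C x \<in> bal j m"
    then have *: "complex_of_real (inverse t) *C x \<in> X j m" "p j m (complex_of_real (inverse t) *C x) \<le> m"
      by (auto simp: bal_def)
    have "complex_of_real t *C (complex_of_real (inverse t) *C x) \<in> X j m"
      by (rule subspace_scale[OF subspace_X *(1)])
    then have x: "x \<in> X j m" using assms by simp
    have "p j m (complex_of_real (inverse t) *C x) = inverse t * p j m x"
      using seminorm_onD(3)[OF semi x, of "complex_of_real (inverse t)"] assms by (simp only: norm_of_real) simp
    with *(2) have "inverse t * p j m x \<le> m" by (simp only:)
    with x show "x \<in> X j m \<and> p j m x \<le> t * m" using assms by (simp add: field_simps)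
  next
    assume x: "x \<in> X j m \<and> p j m x \<le> t * m"
    then have "p j m (complex_of_real (inverse t) *C x) = inverse t * p j m x"
      using seminorm_onD(3)[OF semi, of x j m "complex_of_real (inverse t)"] assms by (simp only: norm_of_real) simp
    moreover have "inverse t * p j m x \<le> m" using x assms by (simp add: field_simps)
    ultimately show "complex_of_real (inverse t) *C x \<in> bal j m"
      unfolding bal_def using x subspace_scale[OF subspace_X] by (simp only: mem_Collect_eq)
  qed
  then show ?thesis by (simp add: disc_def)
qed

text \<open>The gauge controls the norm of the step \<open>s j\<close> in every \<open>E j\<close>
  at once, with constant \<open>s j\<close>. Cauchy sequences therefore converge in all these steps,
  the limits coincide by uniqueness, and the estimates for all j together bound the gauge of the
  error.\<close>

lemma banach_disc_disc: "banach_disc (projective_limit T) (disc s)"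
  unfolding banach_disc_def
proof (intro conjI)
  show "absolutely_convex (disc s)" by (rule absolutely_convex_disc)
  show "bounded_set (projective_limit T) (disc s)"
    unfolding bounded_set_def topspace_limit
  proof (intro conjI allI impI disc_subset_Y)
    fix V assume "zero_nbhd (projective_limit T) V"
    then obtain N where "\<And>n. \<exists>e>0. \<forall>x\<in>X N n \<inter> Y. p N n x < e \<longrightarrow> x \<in> V"
      using zero_nbhd_limitD by blast
    then obtain e where e: "e > 0" "\<And>x. x \<in> X N (s N) \<Longrightarrow> x \<in> Y \<Longrightarrow> p N (s N) x < e \<Longrightarrow> x \<in> V"
      by blast
    show "absorbs V (disc s)"
      unfolding absorbs_def
    \<comment> \<open>The summand 1 keeps the bound positive when \<open>s N\<close> is 0.\<close>
    proof (intro exI[of _ "s N / e + 1"] conjI allI impI subsetI)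
      show "0 < s N / e + 1" using e(1) by (simp add: add_nonneg_pos)
      fix c x assume c: "s N / e + 1 \<le> cmod c" and x: "x \<in> disc s"
      have xN: "x \<in> X N (s N)" "p N (s N) x \<le> s N" using x by (auto simp: disc_def bal_def)
      have c0: "cmod c > 0" using c e(1) by (smt (verit) divide_nonneg_pos of_nat_0_le_iff)
      have "inverse c *C x \<in> V"
      proof (rule e(2))
        show "inverse c *C x \<in> X N (s N)" by (rule subspace_scale[OF subspace_X xN(1)])
        show "inverse c *C x \<in> Y" using x disc_subset_Y by (intro subspace_scale[OF subspace_Y]) auto
        have "p N (s N) (inverse c *C x) = cmod (inverse c) * p N (s N) x"
          by (rule seminorm_onD(3)[OF semi xN(1)])
        also have "\<dots> \<le> inverse (cmod c) * s N"
          using xN(2) by (simp only: norm_inverse) (intro mult_left_mono, auto)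
        also have "\<dots> < e"
        proof -
          have "s N / e < cmod c" using c by simp
          then show ?thesis using c0 e(1) by (simp add: field_simps)
        qed
        finally show "p N (s N) (inverse c *C x) < e" .
      qed
      then show "x \<in> (*C) c ` V" using c0 mem_scale_image by simp
    qed
  qed
  have ne: "disc s \<noteq> {}" using zero_in_disc by blast
  let ?g = "gauge_of (disc s)" and ?B = "span (disc s)"
  have semig: "seminorm_on ?B ?g" by (rule seminorm_on_gauge[OF absolutely_convex_disc ne])
  have gD: "x \<in> X j (s j)" "p j (s j) x \<le> t * s j" if "x \<in> ?B" "?g x < t" for x j and t :: real
    using gauge_of_less[OF absolutely_convex_disc ne that] disc_scaled[of t x s] by auto
  have gI: "x \<in> ?B" "?g x \<le> t" if "t > 0" "\<And>j. x \<in> X j (s j)" "\<And>j. p j (s j) x \<le> t * s j" for x and t :: real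
  proof -
    have *: "complex_of_real (inverse t) *C x \<in> disc s" using disc_scaled[OF that(1)] that(2,3) by blast
    show "?g x \<le> t" by (rule gauge_of_le[OF that(1) *])
    have "complex_of_real t *C (complex_of_real (inverse t) *C x) \<in> ?B"
      by (rule span_scale[OF span_base[OF *]])
    then show "x \<in> ?B" using that(1) by simp
  qed
  show "banach_on ?B ?g"
    unfolding banach_on_def
  proof (intro conjI allI impI)
    have "x = 0" if x: "x \<in> ?B" "?g x = 0" for x
    proof -
      have xX: "x \<in> X 0 (s 0)" using gD(1)[OF x(1), of 1 0] x(2) by simp
      have "p 0 (s 0) x \<le> e" if "e > 0" for e
      proof -
        \<comment> \<open>Dividing by \<open>s 0 + 1\<close> instead of \<open>s 0\<close> covers
          the case of radius 0.\<close>
        have "p 0 (s 0) x \<le> (e / (s 0 + 1)) * s 0" using gD(2)[OF x(1), of "e / (s 0 + 1)" 0] x(2) that by simp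
        also have "\<dots> \<le> e" using that by (simp add: field_simps)
        finally show ?thesis .
      qed
      then have "p 0 (s 0) x \<le> 0" by (rule dense_ge)
      then have "p 0 (s 0) x = 0" using seminorm_onD(2)[OF semi xX] by simp
      then show "x = 0" using norm[of 0 "s 0"] xX unfolding norm_on_def by blast
    qed
    then show "norm_on ?B ?g"
      using semig unfolding norm_on_def seminorm_on_def by blast
    fix u :: "nat \<Rightarrow> 'v"
    assume u: "range u \<subseteq> ?B \<and> (\<forall>e>0. \<exists>n0. \<forall>m\<ge>n0. \<forall>n\<ge>n0. ?g (u m - u n) < e)"
    then have uB: "u n \<in> ?B" for n by blast
    have cauchy: "\<exists>n0. \<forall>m\<ge>n0. \<forall>n\<ge>n0. ?g (u m - u n) < e" if "e > 0" for e
      using conjunct2[OF u] that by simp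
    have diffB: "u m - u n \<in> ?B" for m n by (rule span_diff[OF uB uB])
    have uX: "u n \<in> X j (s j)" for n j
      by (rule gD(1)[OF uB, of _ "?g (u n) + 1"]) simp
    have "\<exists>l\<in>X j (s j). (\<lambda>n. p j (s j) (u n - l)) \<longlonglongrightarrow> 0" for j
    proof (rule complete_fnorm_on_complete[OF banach_on_imp_complete_fnorm_on[OF banach]])
      show "range u \<subseteq> X j (s j)" using uX by blast
      show "\<forall>e>0. \<exists>n0. \<forall>m\<ge>n0. \<forall>n\<ge>n0. p j (s j) (u m - u n) < e"
      proof (intro allI impI)
        fix e :: real assume "e > 0"
        define d where "d = e / (s j + 1)"
        have "d > 0" using \<open>e > 0\<close> by (simp add: d_def)
        obtain n0 where n0: "\<And>m n. m \<ge> n0 \<Longrightarrow> n \<ge> n0 \<Longrightarrow> ?g (u m - u n) < d"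
          using cauchy[OF \<open>d > 0\<close>] by blast
        have "d * s j < e" using \<open>e > 0\<close> by (simp add: d_def field_simps)
        then have "p j (s j) (u m - u n) < e" if "m \<ge> n0" "n \<ge> n0" for m n
          using gD(2)[OF diffB n0[OF that], of j] by simp
        then show "\<exists>n0. \<forall>m\<ge>n0. \<forall>n\<ge>n0. p j (s j) (u m - u n) < e" by blast
      qed
    qed
    then obtain l0 where l0: "\<And>j. l0 j \<in> X j (s j)" "\<And>j. (\<lambda>n. p j (s j) (u n - l0 j)) \<longlonglongrightarrow> 0" by metis
    have lim: "converges u (l0 j)" for j
      by (intro convergesI[OF _ l0(2)] always_eventually allI subspace_diff[OF subspace_X] uX l0(1))
    define l where "l = l0 0"
    have eq: "l0 j = l" for j unfolding l_def by (rule converges_unique[OF lim lim])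
    have l: "l \<in> X j (s j)" "(\<lambda>n. p j (s j) (u n - l)) \<longlonglongrightarrow> 0" for j using l0[of j] eq by auto
    \<comment> \<open>For fixed m let n tend to infinity in the step norms; the gauge is not known
      to be continuous along this limit, so the estimate is made for every j and then
      reassembled.\<close>
    have close: "u m - l \<in> ?B" "?g (u m - l) \<le> e"
      if "e > 0" and n0: "\<And>m n. m \<ge> n0 \<Longrightarrow> n \<ge> n0 \<Longrightarrow> ?g (u m - u n) < e" and "m \<ge> n0" for e n0 m
    proof -
      have "p j (s j) (u m - l) \<le> e * s j" for j
      proof (rule LIMSEQ_le_const)
        show "(\<lambda>n. e * s j + p j (s j) (u n - l)) \<longlonglongrightarrow> e * s j" using tendsto_add[OF tendsto_const l(2)] by simp
        show "\<exists>N. \<forall>n\<ge>N. p j (s j) (u m - l) \<le> e * s j + p j (s j) (u n - l)"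
        proof (intro exI allI impI)
          fix n assume "n \<ge> n0"
          then have "p j (s j) (u m - u n) \<le> e * s j" using gD(2)[OF diffB n0] that(3) by blast
          then show "p j (s j) (u m - l) \<le> e * s j + p j (s j) (u n - l)"
            using seminorm_on_triangle_diff[OF semi uX uX l(1), of j m n] by simp
        qed
      qed
      then show "u m - l \<in> ?B" "?g (u m - l) \<le> e"
        using gI[OF that(1), of "u m - l"] subspace_diff[OF subspace_X uX l(1)] by auto
    qed
    obtain n1 where n1: "\<And>m n. m \<ge> n1 \<Longrightarrow> n \<ge> n1 \<Longrightarrow> ?g (u m - u n) < 1"
      using cauchy[OF zero_less_one] by blast
    have "u n1 - (u n1 - l) \<in> ?B" by (rule span_diff[OF uB close(1)[OF _ n1]]) auto
    then have "l \<in> ?B" by simp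
    moreover have "(\<lambda>n. ?g (u n - l)) \<longlonglongrightarrow> 0"
    proof (rule LIMSEQ_I)
      fix r :: real assume "r > 0"
      then obtain n0 where n0: "\<And>m n. m \<ge> n0 \<Longrightarrow> n \<ge> n0 \<Longrightarrow> ?g (u m - u n) < r/2"
        using cauchy[of "r/2"] by auto
      have "norm (?g (u m - l) - 0) < r" if "m \<ge> n0" for m
        using close[OF _ n0 that] \<open>r > 0\<close> seminorm_onD(2)[OF semig, of "u m - l"] by auto
      then show "\<exists>no. \<forall>n\<ge>no. norm (?g (u n - l) - 0) < r" by blast
    qed
    ultimately show "\<exists>l\<in>?B. (\<lambda>n. ?g (u n - l)) \<longlonglongrightarrow> 0" by blast
  qed
qed

text \<open>If no level worked, there would be points x i in \<open>cyl s i\<close> with x i/(i + 1)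
  outside A. At each coordinate only finitely many of them violate the constraint of s, so enlarging
  s puts them all into one Banach disc, which A absorbs.\<close>

lemma absorbs_cyl:
  assumes A: "absolutely_convex A" and disc: "\<And>B. banach_disc (projective_limit T) B \<Longrightarrow> absorbs A B"
  shows "\<exists>i. \<exists>c>0. \<forall>x\<in>Y. x \<in> cyl s i \<longrightarrow> complex_of_real c *C x \<in> A"
proof (rule ccontr)
  assume *: "\<not> ?thesis"
  have "\<exists>x\<in>Y. x \<in> cyl s i \<and> complex_of_real (inverse (real (Suc i))) *C x \<notin> A" for i
  proof -
    have "inverse (real (Suc i)) > 0" by simp
    then show ?thesis using * by blast
  qed
  then obtain x where x: "\<And>i. x i \<in> Y" "\<And>i. x i \<in> cyl s i"
    "\<And>i. complex_of_real (inverse (real (Suc i))) *C x i \<notin> A" by metis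
  have "\<exists>m. x i \<in> bal j m" for i j by (rule in_bal[OF Y_E[OF x(1)]])
  then obtain m where m: "\<And>i j. x i \<in> bal j (m i j)" by metis
  \<comment> \<open>At coordinate j only the points with i <= j can exceed \<open>s j\<close>; the
    finite sum is large enough for all of them.\<close>
  define s' where "s' j = s j + (\<Sum>i\<le>j. m i j)" for j
  have "x i \<in> disc s'" for i
    unfolding disc_def
  proof (intro CollectI allI)
    fix j
    show "x i \<in> bal j (s' j)"
    proof (cases "j < i")
      case True
      then have "x i \<in> bal j (s j)" using x(2)[of i] by (simp add: cyl_def)
      then show ?thesis using bal_mono[of j j "s j" "s' j"] by (auto simp: s'_def)
    next
      case False
      then have "m i j \<le> (\<Sum>i\<le>j. m i j)" by (intro member_le_sum) auto
      then show ?thesis using m[of i j] bal_mono[of j j "m i j" "s' j"] by (auto simp: s'_def)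
    qed
  qed
  moreover obtain c where c: "c > 0" "\<And>y. y \<in> disc s' \<Longrightarrow> complex_of_real c *C y \<in> A"
    using disc[OF banach_disc_disc] absorbs_iff[OF A] by blast
  moreover obtain i where "inverse (real (Suc i)) < c" using reals_Archimedean[OF c(1)] by blast
  then have "cmod (complex_of_real (inverse (real (Suc i)))) \<le> c" by (simp only: norm_of_real) simp
  ultimately show False
    using absolutely_convex_shrink[OF A, of c "x i" "complex_of_real (inverse (real (Suc i)))"] x(3)[of i] by blast
qed

theorem Proj1_zero_imp_ultrabornological:
  assumes "Proj1_is_zero E"
  shows "ultrabornological (projective_limit T)"
  unfolding ultrabornological_def
proof (intro conjI allI impI)
  show "locally_convex (projective_limit T)" by (rule locally_convex_limit)
  fix A assume "A \<subseteq> topspace (projective_limit T) \<and> absolutely_convex A \<and>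
    (\<forall>B. banach_disc (projective_limit T) B \<longrightarrow> absorbs A B)"
  then have AY: "A \<subseteq> Y" and A: "absolutely_convex A"
    and disc: "\<And>B. banach_disc (projective_limit T) B \<Longrightarrow> absorbs A B"
    by (auto simp: topspace_limit)
  obtain s where s: "\<And>i. \<exists>M\<ge>i. \<forall>z\<in>E M. \<exists>y\<in>Y. z - y \<in> cyl s i"
    using Proj1_zero_decomposition[OF assms] by blast
  obtain i0 c0 where c0: "c0 > 0" "\<And>x. x \<in> Y \<Longrightarrow> x \<in> cyl s i0 \<Longrightarrow> complex_of_real c0 *C x \<in> A"
    using absorbs_cyl[OF A disc] by blast
  \<comment> \<open>The successor excludes level 0, at which \<open>cyl\<close> is the whole
    space.\<close>
  define i where "i = Suc i0"
  define c where "c = min c0 1"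
  have c: "c > 0" "c \<le> 1" using c0(1) by (auto simp: c_def)
  have cA: "complex_of_real c *C x \<in> A" if "x \<in> Y" "x \<in> cyl s i" for x
  proof (rule absolutely_convex_shrink[OF A])
    show "complex_of_real c0 *C x \<in> A" using that cyl_mono[of i0 i s] by (intro c0(2)) (auto simp: i_def)
    show "cmod (complex_of_real c) \<le> c0" using c by (simp add: c_def)
  qed
  obtain M where M: "M \<ge> i" "\<And>z. z \<in> E M \<Longrightarrow> \<exists>y\<in>Y. z - y \<in> cyl s i" using s[of i] by blast
  \<comment> \<open>The coefficients are chosen for the trace on \<open>Y\<close>: if x and a lie in
    \<open>Y\<close>, then so does d, hence c d lies in A and x is the midpoint of a and c
    d.\<close>
  define U where "U = {x \<in> E M. \<exists>a\<in>A. \<exists>d\<in>cyl s i. x = (1/2) *C a + complex_of_real (c/2) *C d}"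
  show "zero_nbhd (projective_limit T) A"
  proof (rule zero_nbhd_limitI[of U M])
    show "absolutely_convex U"
      unfolding absolutely_convex_def
    proof (intro ballI allI impI)
      fix x y and \<alpha> \<beta> :: complex assume "x \<in> U" "y \<in> U" and ab: "cmod \<alpha> + cmod \<beta> \<le> 1"
      then obtain a d a' d' where x: "x \<in> E M" "a \<in> A" "d \<in> cyl s i" "x = (1/2) *C a + complex_of_real (c/2) *C d"
        and y: "y \<in> E M" "a' \<in> A" "d' \<in> cyl s i" "y = (1/2) *C a' + complex_of_real (c/2) *C d'"
        unfolding U_def by blast
      have "\<alpha> *C x + \<beta> *C y \<in> E M"
        by (intro subspace_add[OF subspace_E] subspace_scale[OF subspace_E] x y)
      moreover have "\<alpha> *C a + \<beta> *C a' \<in> A" by (rule absolutely_convexD[OF A x(2) y(2) ab])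
      moreover have "\<alpha> *C d + \<beta> *C d' \<in> cyl s i" by (rule absolutely_convexD[OF absolutely_convex_cyl x(3) y(3) ab])
      moreover have "\<alpha> *C x + \<beta> *C y = (1/2) *C (\<alpha> *C a + \<beta> *C a') + complex_of_real (c/2) *C (\<alpha> *C d + \<beta> *C d')"
        unfolding x(4) y(4) by (simp add: scale_right_distrib mult.commute add_ac)
      ultimately show "\<alpha> *C x + \<beta> *C y \<in> U" unfolding U_def by blast
    qed
    show "U \<subseteq> E M" by (auto simp: U_def)
    show "A \<subseteq> Y" by (rule AY)
    show "U \<inter> Y \<subseteq> A"
    proof
      fix x assume "x \<in> U \<inter> Y"
      then obtain a d where x: "x \<in> Y" "a \<in> A" "d \<in> cyl s i" "x = (1/2) *C a + complex_of_real (c/2) *C d"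
        unfolding U_def by blast
      have "complex_of_real (2/c) *C (x - (1/2) *C a) \<in> Y"
        using AY x(1,2) by (intro subspace_scale[OF subspace_Y] subspace_diff[OF subspace_Y]) auto
      then have "d \<in> Y" using x(4) c(1) by simp
      from absolutely_convexD[OF A x(2) cA[OF this x(3)], of "1/2" "1/2"]
      show "x \<in> A" using x(4) by simp
    qed
    fix m
    have "\<exists>y\<in>Y. z - y \<in> cyl s i" if "z \<in> X M m" for z
      using that M(2) by (auto simp: E_def)
    moreover have "i > 0" by (simp add: i_def)
    ultimately obtain s' where s': "\<And>i'. \<exists>e>0. \<forall>z\<in>X M m. p M m z < e \<longrightarrow>
        (\<exists>y\<in>Y. y \<in> cyl s' i' \<and> (1/2) *C (z - y) \<in> cyl s i)"
      using banach_decomposition[of M m s i] by blast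
    obtain i' c' where c': "c' > 0" "\<And>x. x \<in> Y \<Longrightarrow> x \<in> cyl s' i' \<Longrightarrow> complex_of_real c' *C x \<in> A"
      using absorbs_cyl[OF A disc] by blast
    obtain e where e: "e > 0" "\<And>z. z \<in> X M m \<Longrightarrow> p M m z < e \<Longrightarrow>
        \<exists>y\<in>Y. y \<in> cyl s' i' \<and> (1/2) *C (z - y) \<in> cyl s i" using s'[of i'] by blast
    \<comment> \<open>With z = x/t, split x = t y + t (z - y). The first part is a/2 with a = 2 t y,
      which lies in A if 2 t <= c'. The second is (c/2) d with d = (4 t/c) (z - y)/2, which lies in
      the cylinder if 4 t <= c.\<close>
    define t where "t = min (c'/2) (c/4)"
    have t: "t > 0" "2 * t \<le> c'" "4 * t / c \<le> 1" using c c' by (auto simp: t_def field_simps)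
    show "\<exists>e>0. \<forall>x\<in>X M m. p M m x < e \<longrightarrow> x \<in> U"
    proof (intro exI[of _ "t * e"] conjI ballI impI)
      show "t * e > 0" using t(1) e(1) by simp
      fix x assume x: "x \<in> X M m" "p M m x < t * e"
      define z where "z = complex_of_real (inverse t) *C x"
      have z: "z \<in> X M m" unfolding z_def by (rule subspace_scale[OF subspace_X x(1)])
      have "p M m z = inverse t * p M m x"
        using seminorm_onD(3)[OF semi x(1), of "complex_of_real (inverse t)"] t(1) unfolding z_def
        by (simp only: norm_of_real) simp
      also have "\<dots> < e" using x(2) t(1) by (simp add: field_simps)
      finally have "p M m z < e" .
      from e(2)[OF z this] obtain y where y: "y \<in> Y" "y \<in> cyl s' i'" "(1/2) *C (z - y) \<in> cyl s i" by blast
      define a d where "a = complex_of_real (2 * t) *C y"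
        and "d = complex_of_real (4 * t / c) *C ((1/2) *C (z - y))"
      have "a \<in> A" unfolding a_def
      proof (rule absolutely_convex_shrink[OF A c'(2)[OF y(1,2)]])
        show "cmod (complex_of_real (2 * t)) \<le> c'" using t(1,2) by (simp only: norm_of_real)
      qed
      moreover have "d \<in> cyl s i" unfolding d_def
      proof (rule absolutely_convex_scale[OF absolutely_convex_cyl y(3)])
        have "0 \<le> 4 * t / c" using t(1) c(1) by simp
        then show "cmod (complex_of_real (4 * t / c)) \<le> 1" using t(3) by (simp only: norm_of_real)
      qed
      moreover have "x = (1/2) *C a + complex_of_real (c/2) *C d"
      proof -
        have "complex_of_real (c/2) *C d = complex_of_real t *C (z - y)"
          using c(1) by (simp add: d_def)
        moreover have "(1/2) *C a = complex_of_real t *C y" by (simp add: a_def)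
        moreover have "x = complex_of_real t *C z" using t(1) by (simp add: z_def)
        ultimately show ?thesis by (simp add: scale_right_diff_distrib)
      qed
      moreover have "x \<in> E M" using x(1) by (auto simp: E_def)
      ultimately show "x \<in> U" unfolding U_def by blast
    qed
  qed
qed

end

section \<open>Banach spaces of holomorphic functions of several variables\<close>

lemma norm_vector_scalar_mult: "norm (c *s x) = cmod c * norm x" for x :: "complex ^ 'd"
proof -
  have "norm (c *s x) = L2_set (\<lambda>i. cmod c * cmod (x $ i)) UNIV"
    by (simp add: norm_vec_def norm_mult)
  also have "\<dots> = cmod c * L2_set (\<lambda>i. cmod (x $ i)) UNIV"
    by (rule L2_set_right_distrib[symmetric]) simp
  finally show ?thesis by (simp add: norm_vec_def)
qed

lemma bounded_linear_vector_scalar_mult: "bounded_linear (\<lambda>c. c *s (x :: complex ^ 'd))"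
  by (rule bounded_linear_intro[of _ "norm x"])
    (simp_all add: norm_vector_scalar_mult vec_eq_iff algebra_simps)

lemma Hol_has_derivative:
  assumes "f \<in> Hol G" "z \<in> G"
  obtains f' where "(f has_derivative f') (at z)" "\<And>c h. f' (c *s h) = c * f' h"
  using assms unfolding Hol_def by blast

lemma Hol_outside: "f \<in> Hol G \<Longrightarrow> z \<notin> G \<Longrightarrow> f z = 0"
  by (simp add: Hol_def)

lemma continuous_on_Hol: "f \<in> Hol G \<Longrightarrow> continuous_on G f"
  by (rule continuous_at_imp_continuous_on) (auto elim!: Hol_has_derivative dest: has_derivative_continuous)

lemma Hol_line_derivative:
  assumes "f \<in> Hol G" "z + \<zeta> *s h \<in> G"
    and f': "(f has_derivative f') (at (z + \<zeta> *s h))" "\<And>c h. f' (c *s h) = c * f' h"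
  shows "((\<lambda>\<zeta>. f (z + \<zeta> *s h)) has_field_derivative f' h) (at \<zeta>)"
proof -
  have "((\<lambda>\<zeta>. z + \<zeta> *s h) has_derivative (\<lambda>\<zeta>. \<zeta> *s h)) (at \<zeta>)"
    using has_derivative_add[OF has_derivative_const
        bounded_linear_imp_has_derivative[OF bounded_linear_vector_scalar_mult]] by simp
  from has_derivative_compose[OF this f'(1)]
  have "((\<lambda>\<zeta>. f (z + \<zeta> *s h)) has_derivative (\<lambda>\<zeta>. f' (\<zeta> *s h))) (at \<zeta>)" .
  moreover have "(\<lambda>\<zeta>. f' (\<zeta> *s h)) = (*) (f' h)" by (simp add: fun_eq_iff f'(2) mult.commute)
  ultimately show ?thesis unfolding has_field_derivative_def by simp
qed

lemma Hol_line_holomorphic: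
  assumes "f \<in> Hol G" "\<And>\<zeta>. \<zeta> \<in> S \<Longrightarrow> z + \<zeta> *s h \<in> G"
  shows "(\<lambda>\<zeta>. f (z + \<zeta> *s h)) holomorphic_on S"
  unfolding holomorphic_on_def
proof
  fix \<zeta> assume "\<zeta> \<in> S"
  then have G: "z + \<zeta> *s h \<in> G" by (rule assms(2))
  obtain f' where f': "(f has_derivative f') (at (z + \<zeta> *s h))" "\<And>c h. f' (c *s h) = c * f' h"
    using Hol_has_derivative[OF assms(1) G] by blast
  have "((\<lambda>\<zeta>. f (z + \<zeta> *s h)) has_field_derivative f' h) (at \<zeta>)"
    by (rule Hol_line_derivative[OF assms(1) G f'])
  then show "(\<lambda>\<zeta>. f (z + \<zeta> *s h)) field_differentiable at \<zeta> within S"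
    unfolding field_differentiable_def using has_field_derivative_at_within by blast
qed

lemma Hol_subspace: "cfun.subspace (Hol G)"
  unfolding cfun.subspace_def
proof (intro conjI ballI allI)
  have "((0 :: complex ^ 'd \<Rightarrow> complex) has_derivative (\<lambda>_. 0)) (at z)" for z by (simp add: zero_fun_def)
  then show "0 \<in> Hol G" by (auto simp: Hol_def intro!: exI[of _ "\<lambda>_. 0"])
  fix f g assume f: "f \<in> Hol G" and g: "g \<in> Hol G"
  show "f + g \<in> Hol G"
    unfolding Hol_def
  proof (intro CollectI conjI ballI allI impI)
    fix z assume z: "z \<in> G"
    obtain f' where f': "(f has_derivative f') (at z)" "\<And>c h. f' (c *s h) = c * f' h"
      using Hol_has_derivative[OF f z] by blast
    obtain g' where g': "(g has_derivative g') (at z)" "\<And>c h. g' (c *s h) = c * g' h"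
      using Hol_has_derivative[OF g z] by blast
    have "((\<lambda>x. f x + g x) has_derivative (\<lambda>h. f' h + g' h)) (at z)"
      by (rule has_derivative_add[OF f'(1) g'(1)])
    then have "((f + g) has_derivative (\<lambda>h. f' h + g' h)) (at z)" by (simp add: plus_fun_def)
    then show "\<exists>D. ((f + g) has_derivative D) (at z) \<and> (\<forall>c h. D (c *s h) = c * D h)"
      using f'(2) g'(2) by (intro exI[of _ "\<lambda>h. f' h + g' h"]) (simp add: algebra_simps)
  qed (use f g in \<open>simp add: Hol_outside\<close>)
next
  fix c f assume f: "f \<in> Hol G"
  show "(\<lambda>z. c * f z) \<in> Hol G"
    unfolding Hol_def
  proof (intro CollectI conjI ballI allI impI)
    fix z assume z: "z \<in> G"
    obtain f' where f': "(f has_derivative f') (at z)" "\<And>c h. f' (c *s h) = c * f' h"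
      using Hol_has_derivative[OF f z] by blast
    have "((\<lambda>x. c * f x) has_derivative (\<lambda>h. c * f' h)) (at z)"
      by (rule has_derivative_mult_right[OF f'(1)])
    then show "\<exists>D. ((\<lambda>x. c * f x) has_derivative D) (at z) \<and> (\<forall>b h. D (b *s h) = b * D h)"
      using f'(2) by (intro exI[of _ "\<lambda>h. c * f' h"]) simp
  qed (use f in \<open>simp add: Hol_outside\<close>)
qed

lemma Hol_diff: "f \<in> Hol G \<Longrightarrow> g \<in> Hol G \<Longrightarrow> f - g \<in> Hol G"
  by (rule cfun.subspace_diff[OF Hol_subspace])

section \<open>Cauchy estimates and locally uniform limits\<close>

text \<open>Restrict f to the complex line through z in direction h; there f is holomorphic on a
  disc of radius r/|h|, and the one-variable Cauchy inequality applies.\<close>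

lemma Hol_derivative_bound:
  assumes f: "f \<in> Hol G" and f': "(f has_derivative f') (at z)" "\<And>c h. f' (c *s h) = c * f' h"
    and r: "r > 0" "cball z r \<subseteq> G" and B: "\<And>x. x \<in> cball z r \<Longrightarrow> cmod (f x) \<le> B"
  shows "cmod (f' h) \<le> B / r * norm h"
proof (cases "h = 0")
  case True
  have "f' (0 *s 0) = 0 * f' 0" by (rule f'(2))
  then show ?thesis using True by simp
next
  case False
  define \<rho> where "\<rho> = r / norm h"
  have \<rho>: "\<rho> > 0" using r False by (simp add: \<rho>_def)
  have ball: "z + \<zeta> *s h \<in> cball z r" if "cmod \<zeta> \<le> \<rho>" for \<zeta>
    using that False by (simp add: dist_norm norm_vector_scalar_mult \<rho>_def field_simps)
  have hol: "(\<lambda>\<zeta>. f (z + \<zeta> *s h)) holomorphic_on cball 0 \<rho>"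
    by (rule Hol_line_holomorphic[OF f]) (use ball r in auto)
  have "cmod ((deriv ^^ 1) (\<lambda>\<zeta>. f (z + \<zeta> *s h)) 0) \<le> fact 1 * B / \<rho> ^ 1"
  proof (rule Cauchy_inequality)
    show "(\<lambda>\<zeta>. f (z + \<zeta> *s h)) holomorphic_on ball 0 \<rho>" using hol by (rule holomorphic_on_subset) auto
    show "continuous_on (cball 0 \<rho>) (\<lambda>\<zeta>. f (z + \<zeta> *s h))" using hol by (rule holomorphic_on_imp_continuous_on)
  qed (use \<rho> ball B in auto)
  moreover have "deriv (\<lambda>\<zeta>. f (z + \<zeta> *s h)) 0 = f' h"
    using r f' by (intro DERIV_imp_deriv Hol_line_derivative[OF f]) auto
  ultimately show ?thesis using False r by (simp add: \<rho>_def)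
qed

text \<open>By the derivative bound, a uniform Cauchy condition for the functions on a ball passes
  to their derivatives on a smaller ball. So the limit may be differentiated termwise, and complex
  homogeneity of the derivative survives pointwise limits.\<close>

lemma Hol_uniform_limit:
  assumes G: "open G" and f: "\<And>n. f n \<in> Hol G" and g0: "\<And>z. z \<notin> G \<Longrightarrow> g z = 0"
    and lim: "\<And>K. compact K \<Longrightarrow> K \<subseteq> G \<Longrightarrow> uniform_limit K f g sequentially"
  shows "g \<in> Hol G"
  unfolding Hol_def
proof (intro CollectI conjI ballI allI impI)
  fix z assume z: "z \<in> G"
  obtain R where R: "R > 0" "cball z R \<subseteq> G" using G z open_contains_cball by blast
  \<comment> \<open>Balls of radius r around points of \<open>ball z r\<close> stay in
    \<open>cball z R\<close>, where the uniform estimate is available.\<close>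
  define r where "r = R / 2"
  have r: "r > 0" using R by (simp add: r_def)
  have ball: "cball x r \<subseteq> cball z R" if "x \<in> ball z r" for x
  proof
    fix y assume "y \<in> cball x r"
    then show "y \<in> cball z R" using that dist_triangle[of z y x] by (simp add: r_def)
  qed
  have inG: "x \<in> G" if "x \<in> ball z r" for x
    using ball[OF that] R(2) r centre_in_cball[of x r] by (meson less_imp_le subsetD)
  define D where "D n x = (SOME D. (f n has_derivative D) (at x) \<and> (\<forall>c h. D (c *s h) = c * D h))" for n x
  have Dx: "(f n has_derivative D n x) (at x) \<and> (\<forall>c h. D n x (c *s h) = c * D n x h)" if x: "x \<in> G" for n x
  proof -
    obtain f' where "(f n has_derivative f') (at x)" "\<And>c h. f' (c *s h) = c * f' h"
      using Hol_has_derivative[OF f x] by blast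
    then show ?thesis
      using someI[of "\<lambda>D. (f n has_derivative D) (at x) \<and> (\<forall>c h. D (c *s h) = c * D h)" f']
      unfolding D_def by simp
  qed
  have D: "(f n has_derivative D n x) (at x)" "D n x (c *s h) = c * D n x h" if "x \<in> G" for n x c h
    using Dx[OF that] by auto
  have uc: "uniformly_convergent_on (cball z R) f"
    unfolding uniformly_convergent_on_def using lim[OF compact_cball R(2)] by blast
  have cauchy: "\<exists>N. \<forall>m\<ge>N. \<forall>n\<ge>N. \<forall>x\<in>ball z r. \<forall>h. cmod (D m x h - D n x h) \<le> e * norm h" if e: "e > 0" for e
  proof -
    obtain N where N: "\<And>m n x. m \<ge> N \<Longrightarrow> n \<ge> N \<Longrightarrow> x \<in> cball z R \<Longrightarrow> dist (f m x) (f n x) < e * r"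
    proof -
      have "e * r > 0" using e r by simp
      then show thesis
        using uniformly_convergent_Cauchy[OF uc, unfolded uniformly_Cauchy_on_def, rule_format] that by meson
    qed
    have "cmod (D m x h - D n x h) \<le> e * norm h" if "m \<ge> N" "n \<ge> N" "x \<in> ball z r" for m n x h
    proof -
      have "((f m - f n) has_derivative (\<lambda>h. D m x h - D n x h)) (at x)"
        using has_derivative_diff[OF D(1)[OF inG[OF that(3)], of m] D(1)[OF inG[OF that(3)], of n]]
        by (simp add: fun_diff_def)
      then have "cmod (D m x h - D n x h) \<le> (e * r) / r * norm h"
      proof (rule Hol_derivative_bound[OF Hol_diff[OF f f]])
        show "cball x r \<subseteq> G" using ball[OF that(3)] R(2) by blast
        show "cmod ((f m - f n) y) \<le> e * r" if "y \<in> cball x r" for y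
          using N[of m n y] \<open>m \<ge> N\<close> \<open>n \<ge> N\<close> ball[OF \<open>x \<in> ball z r\<close>] that
          by (auto simp: dist_norm subset_iff intro: less_imp_le)
      qed (use D(2)[OF inG[OF that(3)]] r in \<open>auto simp: algebra_simps\<close>)
      then show ?thesis using r by simp
    qed
    then show ?thesis by blast
  qed
  have conv: "convergent (\<lambda>n. D n x h)" if x: "x \<in> ball z r" for x h
    unfolding Cauchy_convergent_iff[symmetric]
  proof (rule metric_CauchyI)
    fix e :: real assume "e > 0"
    then have "e / (norm h + 1) > 0" by (simp add: add_nonneg_pos)
    then obtain N where N: "\<And>m n. m \<ge> N \<Longrightarrow> n \<ge> N \<Longrightarrow> cmod (D m x h - D n x h) \<le> e / (norm h + 1) * norm h"
      using cauchy x by meson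
    have "norm h + 1 > 0" by (simp add: add_nonneg_pos)
    then have "e / (norm h + 1) * norm h < e" using \<open>e > 0\<close> by (simp add: field_simps)
    then show "\<exists>M. \<forall>m\<ge>M. \<forall>n\<ge>M. dist (D m x h) (D n x h) < e"
      using N by (intro exI[of _ N]) (auto simp: dist_norm intro: order_le_less_trans)
  qed
  define D' where "D' x h = lim (\<lambda>n. D n x h)" for x h
  have D'lim: "(\<lambda>n. D n x h) \<longlonglongrightarrow> D' x h" if "x \<in> ball z r" for x h
    using conv[OF that] by (simp add: D'_def convergent_LIMSEQ_iff)
  have "\<exists>k. \<forall>x\<in>ball z r. (\<lambda>n. f n x) \<longlonglongrightarrow> k x \<and> (k has_derivative D' x) (at x within ball z r)"
  proof (rule has_derivative_sequence)
    show "convex (ball z r)" by simp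
    show "(f n has_derivative D n x) (at x within ball z r)" if "x \<in> ball z r" for n x
      using D(1)[OF inG[OF that]] by (rule has_derivative_at_withinI)
    show "z \<in> ball z r" using r by simp
    show "(\<lambda>n. f n z) \<longlonglongrightarrow> g z"
      by (rule tendsto_uniform_limitI[OF lim[of "{z}"]]) (use z in auto)
    fix e :: real assume "e > 0"
    then obtain N where N: "\<And>m n x h. m \<ge> N \<Longrightarrow> n \<ge> N \<Longrightarrow> x \<in> ball z r \<Longrightarrow> cmod (D m x h - D n x h) \<le> e * norm h"
      using cauchy by meson
    have "cmod (D n x h - D' x h) \<le> e * norm h" if "n \<ge> N" "x \<in> ball z r" for n x h
    proof (rule LIMSEQ_le_const2)
      show "(\<lambda>m. cmod (D n x h - D m x h)) \<longlonglongrightarrow> cmod (D n x h - D' x h)"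
        by (intro tendsto_intros D'lim that)
      show "\<exists>N. \<forall>m\<ge>N. cmod (D n x h - D m x h) \<le> e * norm h" using N that by blast
    qed
    then show "\<forall>\<^sub>F n in sequentially. \<forall>x\<in>ball z r. \<forall>h. cmod (D n x h - D' x h) \<le> e * norm h"
      unfolding eventually_sequentially by blast
  qed
  then obtain k where k: "\<And>x. x \<in> ball z r \<Longrightarrow> (\<lambda>n. f n x) \<longlonglongrightarrow> k x"
    "\<And>x. x \<in> ball z r \<Longrightarrow> (k has_derivative D' x) (at x within ball z r)" by blast
  have zb: "z \<in> ball z r" using r by simp
  have kg: "k x = g x" if "x \<in> ball z r" for x
  proof (rule LIMSEQ_unique[OF k(1)[OF that]])
    show "(\<lambda>n. f n x) \<longlonglongrightarrow> g x"
      by (rule tendsto_uniform_limitI[OF lim[of "{x}"]]) (use inG[OF that] in auto)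
  qed
  have "(k has_derivative D' z) (at z)"
    using k(2)[OF zb] at_within_open[OF zb open_ball] by simp
  then have "(g has_derivative D' z) (at z)"
    by (rule has_derivative_transform_within_open[OF _ open_ball zb kg])
  moreover have "D' z (c *s h) = c * D' z h" for c h
  proof (rule LIMSEQ_unique[OF D'lim[OF zb]])
    show "(\<lambda>n. D n z (c *s h)) \<longlonglongrightarrow> c * D' z h"
      unfolding D(2)[OF z] by (intro tendsto_intros D'lim zb)
  qed
  ultimately show "\<exists>D. (g has_derivative D) (at z) \<and> (\<forall>c h. D (c *s h) = c * D h)" by blast
qed (rule g0)

section \<open>Functions vanishing at infinity\<close>

lemma vanishes_at_infinity_onE:
  assumes "vanishes_at_infinity_on G f" "e > 0"
  obtains K where "compact K" "K \<subseteq> G" "\<And>z. z \<in> G - K \<Longrightarrow> \<bar>f z\<bar> < e"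
proof -
  have "\<exists>K. compact K \<and> K \<subseteq> G \<and> (\<forall>z\<in>G - K. \<bar>f z\<bar> < e)"
    using assms unfolding vanishes_at_infinity_on_def by simp
  then show thesis using that by blast
qed

lemma vanishes_at_infinity_on_mono:
  assumes "vanishes_at_infinity_on G f" "\<And>z. z \<in> G \<Longrightarrow> \<bar>g z\<bar> \<le> \<bar>f z\<bar>"
  shows "vanishes_at_infinity_on G g"
  unfolding vanishes_at_infinity_on_def
proof (intro allI impI)
  fix e :: real assume "e > 0"
  then obtain K where K: "compact K" "K \<subseteq> G" "\<And>z. z \<in> G - K \<Longrightarrow> \<bar>f z\<bar> < e"
    using vanishes_at_infinity_onE[OF assms(1)] by blast
  have "\<bar>g z\<bar> < e" if "z \<in> G - K" for z
    using assms(2)[of z] K(3)[OF that] that by simp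
  with K(1,2) show "\<exists>K. compact K \<and> K \<subseteq> G \<and> (\<forall>z\<in>G - K. \<bar>g z\<bar> < e)" by blast
qed

lemma vanishes_at_infinity_on_approx:
  assumes "\<And>e. e > 0 \<Longrightarrow> \<exists>g. vanishes_at_infinity_on G g \<and> (\<forall>z\<in>G. \<bar>f z\<bar> \<le> \<bar>g z\<bar> + e)"
  shows "vanishes_at_infinity_on G f"
  unfolding vanishes_at_infinity_on_def
proof (intro allI impI)
  fix e :: real assume "e > 0"
  then obtain g where g: "vanishes_at_infinity_on G g" "\<And>z. z \<in> G \<Longrightarrow> \<bar>f z\<bar> \<le> \<bar>g z\<bar> + e/2"
    using assms[of "e/2"] by auto
  have "e/2 > 0" using \<open>e > 0\<close> by simp
  then obtain K where K: "compact K" "K \<subseteq> G" "\<And>z. z \<in> G - K \<Longrightarrow> \<bar>g z\<bar> < e/2"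
    using vanishes_at_infinity_onE[OF g(1)] by blast
  have "\<bar>f z\<bar> < e" if "z \<in> G - K" for z
    using g(2)[of z] K(3)[OF that] that by simp
  with K(1,2) show "\<exists>K. compact K \<and> K \<subseteq> G \<and> (\<forall>z\<in>G - K. \<bar>f z\<bar> < e)" by blast
qed

lemma vanishes_at_infinity_on_add:
  assumes "vanishes_at_infinity_on G f" "vanishes_at_infinity_on G g"
  shows "vanishes_at_infinity_on G (\<lambda>z. \<bar>f z\<bar> + \<bar>g z\<bar>)"
  unfolding vanishes_at_infinity_on_def
proof (intro allI impI)
  fix e :: real assume "e > 0"
  then have "e/2 > 0" by simp
  then obtain K L where K: "compact K" "K \<subseteq> G" "\<And>z. z \<in> G - K \<Longrightarrow> \<bar>f z\<bar> < e/2"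
    and L: "compact L" "L \<subseteq> G" "\<And>z. z \<in> G - L \<Longrightarrow> \<bar>g z\<bar> < e/2"
    using vanishes_at_infinity_onE[OF assms(1)] vanishes_at_infinity_onE[OF assms(2)] by metis
  have "\<bar>\<bar>f z\<bar> + \<bar>g z\<bar>\<bar> < e" if "z \<in> G - (K \<union> L)" for z
    using K(3)[of z] L(3)[of z] that by simp
  with compact_Un[OF K(1) L(1)] K(2) L(2)
  show "\<exists>K. compact K \<and> K \<subseteq> G \<and> (\<forall>z\<in>G - K. \<bar>\<bar>f z\<bar> + \<bar>g z\<bar>\<bar> < e)" by blast
qed

lemma vanishes_at_infinity_on_cmult:
  assumes "vanishes_at_infinity_on G f"
  shows "vanishes_at_infinity_on G (\<lambda>z. c * f z)"
  unfolding vanishes_at_infinity_on_def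
proof (intro allI impI)
  fix e :: real assume "e > 0"
  then have "e / (\<bar>c\<bar> + 1) > 0" by (simp add: add_nonneg_pos)
  then obtain K where K: "compact K" "K \<subseteq> G" "\<And>z. z \<in> G - K \<Longrightarrow> \<bar>f z\<bar> < e / (\<bar>c\<bar> + 1)"
    using vanishes_at_infinity_onE[OF assms] by blast
  have "\<bar>c * f z\<bar> < e" if "z \<in> G - K" for z
  proof -
    have "\<bar>c * f z\<bar> \<le> (\<bar>c\<bar> + 1) * \<bar>f z\<bar>" by (simp add: abs_mult algebra_simps)
    also have "\<dots> < e" using K(3)[OF that] by (simp add: field_simps add_nonneg_pos)
    finally show ?thesis .
  qed
  with K(1,2) show "\<exists>K. compact K \<and> K \<subseteq> G \<and> (\<forall>z\<in>G - K. \<bar>c * f z\<bar> < e)" by blast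
qed

section \<open>Completeness of the weighted spaces\<close>

context
  fixes G :: "(complex ^ 'd) set" and a :: "complex ^ 'd \<Rightarrow> real"
  assumes G: "open G" "G \<noteq> {}" and a: "weight_on G a"
begin

text \<open>The norm is a real supremum, which carries information only for bounded sets. Off a
  compact set the product is below 1, and on the compact set continuity bounds it.\<close>

lemma Ha0_bdd:
  assumes f: "f \<in> Ha0 G a"
  shows "bdd_above ((\<lambda>z. a z * cmod (f z)) ` G)"
proof -
  obtain K where K: "compact K" "K \<subseteq> G" "\<And>z. z \<in> G - K \<Longrightarrow> \<bar>a z * cmod (f z)\<bar> < 1"
  proof -
    have "vanishes_at_infinity_on G (\<lambda>z. a z * cmod (f z))" using f by (simp add: Ha0_def)
    then have "\<exists>K. compact K \<and> K \<subseteq> G \<and> (\<forall>z\<in>G - K. \<bar>a z * cmod (f z)\<bar> < 1)"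
      unfolding vanishes_at_infinity_on_def using zero_less_one by blast
    then show thesis using that by blast
  qed
  have "continuous_on K (\<lambda>z. a z * cmod (f z))"
    using a f K(2) continuous_on_Hol[of f G]
    by (intro continuous_intros) (auto simp: weight_on_def Ha0_def intro: continuous_on_subset)
  then have "bounded ((\<lambda>z. a z * cmod (f z)) ` K)"
    using K(1) by (intro compact_imp_bounded compact_continuous_image)
  then obtain B where B: "\<And>z. z \<in> K \<Longrightarrow> \<bar>a z * cmod (f z)\<bar> \<le> B" unfolding bounded_iff by auto
  show ?thesis
  proof (rule bdd_aboveI2)
    fix z assume "z \<in> G"
    then show "a z * cmod (f z) \<le> max 1 B"
      using K(3)[of z] B[of z] by (cases "z \<in> K") auto
  qed
qed

lemma wnorm_upper: "f \<in> Ha0 G a \<Longrightarrow> z \<in> G \<Longrightarrow> a z * cmod (f z) \<le> wnorm G a f"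
  unfolding wnorm_def by (rule cSUP_upper[OF _ Ha0_bdd])

lemma wnorm_least: "(\<And>z. z \<in> G \<Longrightarrow> a z * cmod (f z) \<le> c) \<Longrightarrow> wnorm G a f \<le> c"
  unfolding wnorm_def using G(2) by (rule cSUP_least)

lemma wnorm_nonneg: "f \<in> Ha0 G a \<Longrightarrow> 0 \<le> wnorm G a f"
proof -
  assume f: "f \<in> Ha0 G a"
  obtain z where z: "z \<in> G" using G(2) by blast
  then have "0 \<le> a z * cmod (f z)" using a by (simp add: weight_on_def less_imp_le)
  with wnorm_upper[OF f z] show ?thesis by simp
qed

lemma Ha0_subspace: "cfun.subspace (Ha0 G a)"
  unfolding cfun.subspace_def
proof (intro conjI ballI allI)
  have pos: "0 \<le> a z" if "z \<in> G" for z using a that by (simp add: weight_on_def less_imp_le)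
  show "0 \<in> Ha0 G a"
    using cfun.subspace_0[OF Hol_subspace]
    by (auto simp: Ha0_def vanishes_at_infinity_on_def intro!: exI[of _ "{}"])
  fix f g assume f: "f \<in> Ha0 G a" and g: "g \<in> Ha0 G a"
  have "vanishes_at_infinity_on G (\<lambda>z. a z * cmod ((f + g) z))"
  proof (rule vanishes_at_infinity_on_mono)
    show "vanishes_at_infinity_on G (\<lambda>z. \<bar>a z * cmod (f z)\<bar> + \<bar>a z * cmod (g z)\<bar>)"
      using f g by (intro vanishes_at_infinity_on_add) (auto simp: Ha0_def)
    fix z assume z: "z \<in> G"
    have "a z * cmod ((f + g) z) \<le> a z * (cmod (f z) + cmod (g z))"
      using pos[OF z] by (intro mult_left_mono) (auto intro: norm_triangle_ineq)
    then show "\<bar>a z * cmod ((f + g) z)\<bar> \<le> \<bar>\<bar>a z * cmod (f z)\<bar> + \<bar>a z * cmod (g z)\<bar>\<bar>"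
      using pos[OF z] by (simp add: algebra_simps)
  qed
  then show "f + g \<in> Ha0 G a"
    using f g cfun.subspace_add[OF Hol_subspace] by (auto simp: Ha0_def)
next
  fix c f assume f: "f \<in> Ha0 G a"
  have "vanishes_at_infinity_on G (\<lambda>z. cmod c * (a z * cmod (f z)))"
    using f by (intro vanishes_at_infinity_on_cmult) (auto simp: Ha0_def)
  moreover have "(\<lambda>z. cmod c * (a z * cmod (f z))) = (\<lambda>z. a z * cmod (c * f z))"
    by (simp add: norm_mult algebra_simps)
  ultimately show "(\<lambda>z. c * f z) \<in> Ha0 G a"
    using f cfun.subspace_scale[OF Hol_subspace] by (auto simp: Ha0_def)
qed

lemma norm_on_Ha0: "cfun.norm_on (Ha0 G a) (wnorm G a)"
  unfolding cfun.norm_on_def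
proof (intro conjI ballI allI impI)
  have pos: "0 < a z" if "z \<in> G" for z using a that by (simp add: weight_on_def)
  show "cfun.subspace (Ha0 G a)" by (rule Ha0_subspace)
  fix f assume f: "f \<in> Ha0 G a"
  show "0 \<le> wnorm G a f" by (rule wnorm_nonneg[OF f])
  show "f = 0" if "wnorm G a f = 0"
  proof
    fix z
    show "f z = 0 z"
    proof (cases "z \<in> G")
      case True
      then have "a z * cmod (f z) \<le> 0" using wnorm_upper[OF f] that by metis
      then show ?thesis using pos[OF True] by (simp add: mult_le_0_iff)
    next
      case False
      then show ?thesis using f Hol_outside[of f G z] by (simp add: Ha0_def)
    qed
  qed
  fix c
  show "wnorm G a (\<lambda>z. c * f z) = cmod c * wnorm G a f"
  proof (rule antisym)
    have "a z * cmod (c * f z) \<le> cmod c * wnorm G a f" if "z \<in> G" for z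
      using mult_left_mono[OF wnorm_upper[OF f that], of "cmod c"] by (simp add: norm_mult algebra_simps)
    then show "wnorm G a (\<lambda>z. c * f z) \<le> cmod c * wnorm G a f" by (rule wnorm_least)
    show "cmod c * wnorm G a f \<le> wnorm G a (\<lambda>z. c * f z)"
    proof (cases "c = 0")
      case True
      then show ?thesis using wnorm_nonneg[OF cfun.subspace_scale[OF Ha0_subspace f, of c]] by simp
    next
      case False
      have "a z * cmod (f z) \<le> wnorm G a (\<lambda>z. c * f z) / cmod c" if "z \<in> G" for z
        using wnorm_upper[OF cfun.subspace_scale[OF Ha0_subspace f, of c] that] False
        by (simp add: norm_mult field_simps)
      then have "wnorm G a f \<le> wnorm G a (\<lambda>z. c * f z) / cmod c" by (rule wnorm_least)
      then show ?thesis using False by (simp add: field_simps)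
    qed
  qed
next
  fix f g assume f: "f \<in> Ha0 G a" and g: "g \<in> Ha0 G a"
  show "wnorm G a (f + g) \<le> wnorm G a f + wnorm G a g"
  proof (rule wnorm_least)
    fix z assume z: "z \<in> G"
    have "a z * cmod ((f + g) z) \<le> a z * (cmod (f z) + cmod (g z))"
      using a z by (intro mult_left_mono) (auto intro: norm_triangle_ineq simp: weight_on_def less_imp_le)
    also have "\<dots> \<le> wnorm G a f + wnorm G a g"
      using wnorm_upper[OF f z] wnorm_upper[OF g z] by (simp add: algebra_simps)
    finally show "a z * cmod ((f + g) z) \<le> wnorm G a f + wnorm G a g" .
  qed
qed

text \<open>A weight has a positive minimum on every compact set, so convergence in the norm is
  locally uniform and the limit is holomorphic. Vanishing at infinity passes to uniform limits of
  the weighted moduli.\<close>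

lemma banach_on_Ha0: "cfun.banach_on (Ha0 G a) (wnorm G a)"
  unfolding cfun.banach_on_def
proof (intro conjI allI impI norm_on_Ha0)
  have pos: "0 < a z" if "z \<in> G" for z using a that by (simp add: weight_on_def)
  fix u :: "nat \<Rightarrow> complex ^ 'd \<Rightarrow> complex"
  assume u: "range u \<subseteq> Ha0 G a \<and> (\<forall>e>0. \<exists>n0. \<forall>m\<ge>n0. \<forall>n\<ge>n0. wnorm G a (u m - u n) < e)"
  then have uH: "u n \<in> Ha0 G a" for n by blast
  have diff: "u m - u n \<in> Ha0 G a" for m n by (rule cfun.subspace_diff[OF Ha0_subspace uH uH])
  have cauchy: "\<exists>n0. \<forall>m\<ge>n0. \<forall>n\<ge>n0. wnorm G a (u m - u n) < e" if "e > 0" for e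
    using conjunct2[OF u] that by simp
  have bound: "a z * cmod (u m z - u n z) \<le> wnorm G a (u m - u n)" if "z \<in> G" for m n z
    using wnorm_upper[OF diff that] by simp
  have conv: "convergent (\<lambda>n. u n z)" for z
  proof (cases "z \<in> G")
    case True
    show ?thesis
      unfolding Cauchy_convergent_iff[symmetric]
    proof (rule metric_CauchyI)
      fix e :: real assume "e > 0"
      then obtain n0 where n0: "\<And>m n. m \<ge> n0 \<Longrightarrow> n \<ge> n0 \<Longrightarrow> wnorm G a (u m - u n) < a z * e"
        using cauchy[of "a z * e"] pos[OF True] by auto
      have "dist (u m z) (u n z) < e" if "m \<ge> n0" "n \<ge> n0" for m n
      proof -
        have "a z * cmod (u m z - u n z) < a z * e" using bound[OF True, of m n] n0[OF that] by simp
        then show ?thesis using pos[OF True] by (simp add: dist_norm)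
      qed
      then show "\<exists>M. \<forall>m\<ge>M. \<forall>n\<ge>M. dist (u m z) (u n z) < e" by blast
    qed
  next
    case False
    then have "u n z = 0" for n using uH[of n] Hol_outside[of "u n" G z] by (simp add: Ha0_def)
    then show ?thesis by (simp add: convergent_const)
  qed
  define l where "l z = lim (\<lambda>n. u n z)" for z
  have l: "(\<lambda>n. u n z) \<longlonglongrightarrow> l z" for z using conv by (simp add: l_def convergent_LIMSEQ_iff)
  have close: "\<exists>n0. \<forall>m\<ge>n0. \<forall>z\<in>G. a z * cmod (u m z - l z) \<le> e" if e: "e > 0" for e
  proof -
    obtain n0 where n0: "\<And>m n. m \<ge> n0 \<Longrightarrow> n \<ge> n0 \<Longrightarrow> wnorm G a (u m - u n) < e" using cauchy[OF e] by blast
    have "a z * cmod (u m z - l z) \<le> e" if "m \<ge> n0" "z \<in> G" for m z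
    proof (rule LIMSEQ_le_const2)
      show "(\<lambda>n. a z * cmod (u m z - u n z)) \<longlonglongrightarrow> a z * cmod (u m z - l z)" by (intro tendsto_intros l)
      show "\<exists>N. \<forall>n\<ge>N. a z * cmod (u m z - u n z) \<le> e"
        using bound[OF that(2), of m] n0[OF that(1)] by (meson less_imp_le order_trans)
    qed
    then show ?thesis by blast
  qed
  have "l \<in> Hol G"
  proof (rule Hol_uniform_limit[OF G(1)])
    show "u n \<in> Hol G" for n using uH by (simp add: Ha0_def)
    show "l z = 0" if "z \<notin> G" for z
    proof (rule LIMSEQ_unique[OF l])
      have "u n z = 0" for n using uH[of n] Hol_outside[of "u n" G z] that by (simp add: Ha0_def)
      then show "(\<lambda>n. u n z) \<longlonglongrightarrow> 0" by simp
    qed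
    fix K assume K: "compact K" "K \<subseteq> G"
    show "uniform_limit K u l sequentially"
    proof (cases "K = {}")
      case False
      \<comment> \<open>The weight at its minimum point on K converts the weighted estimate into an
        unweighted one on K.\<close>
      obtain x where x: "x \<in> K" "\<And>y. y \<in> K \<Longrightarrow> a x \<le> a y"
        using continuous_attains_inf[OF K(1) False continuous_on_subset[OF _ K(2)], of a] a
        unfolding weight_on_def by blast
      have ax: "a x > 0" using pos x(1) K(2) by blast
      show ?thesis
      proof (rule uniform_limitI)
        fix e :: real assume "e > 0"
        then have "a x * e / 2 > 0" using ax by simp
        then obtain n0 where n0: "\<And>m z. m \<ge> n0 \<Longrightarrow> z \<in> G \<Longrightarrow> a z * cmod (u m z - l z) \<le> a x * e / 2"
          using close by meson
        have "dist (u m z) (l z) < e" if "m \<ge> n0" "z \<in> K" for m z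
        proof -
          have "a x * cmod (u m z - l z) \<le> a z * cmod (u m z - l z)"
            using x(2)[OF that(2)] by (intro mult_right_mono) auto
          also have "\<dots> \<le> a x * e / 2" using n0 that K(2) by blast
          also have "\<dots> < a x * e" using ax \<open>e > 0\<close> by simp
          finally show ?thesis using ax by (simp add: dist_norm)
        qed
        then show "\<forall>\<^sub>F n in sequentially. \<forall>z\<in>K. dist (u n z) (l z) < e"
          unfolding eventually_sequentially by blast
      qed
    qed (simp add: uniform_limit_iff)
  qed
  moreover have "vanishes_at_infinity_on G (\<lambda>z. a z * cmod (l z))"
  proof (rule vanishes_at_infinity_on_approx)
    fix e :: real assume "e > 0"
    then obtain m where m: "\<And>z. z \<in> G \<Longrightarrow> a z * cmod (u m z - l z) \<le> e" using close by blast
    have "\<bar>a z * cmod (l z)\<bar> \<le> \<bar>a z * cmod (u m z)\<bar> + e" if z: "z \<in> G" for z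
    proof -
      have "a z * cmod (l z) \<le> a z * (cmod (u m z) + cmod (u m z - l z))"
        using pos[OF z] norm_triangle_sub[of "l z" "u m z"]
        by (intro mult_left_mono) (auto simp: norm_minus_commute)
      also have "\<dots> \<le> a z * cmod (u m z) + e" using m[OF z] by (simp add: algebra_simps)
      finally show ?thesis using pos[OF z] by simp
    qed
    moreover have "vanishes_at_infinity_on G (\<lambda>z. a z * cmod (u m z))" using uH[of m] by (simp add: Ha0_def)
    ultimately show "\<exists>g. vanishes_at_infinity_on G g \<and> (\<forall>z\<in>G. \<bar>a z * cmod (l z)\<bar> \<le> \<bar>g z\<bar> + e)"
      by blast
  qed
  ultimately have lH: "l \<in> Ha0 G a" by (simp add: Ha0_def)
  moreover have "(\<lambda>n. wnorm G a (u n - l)) \<longlonglongrightarrow> 0"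
  proof (rule LIMSEQ_I)
    fix r :: real assume "r > 0"
    then obtain n0 where n0: "\<And>m z. m \<ge> n0 \<Longrightarrow> z \<in> G \<Longrightarrow> a z * cmod (u m z - l z) \<le> r/2"
      using close[of "r/2"] by auto
    have "norm (wnorm G a (u m - l) - 0) < r" if "m \<ge> n0" for m
    proof -
      have "wnorm G a (u m - l) \<le> r/2" using n0[OF that] by (intro wnorm_least) simp
      moreover have "0 \<le> wnorm G a (u m - l)"
        by (intro wnorm_nonneg cfun.subspace_diff[OF Ha0_subspace uH lH])
      ultimately show ?thesis using \<open>r > 0\<close> by simp
    qed
    then show "\<exists>no. \<forall>n\<ge>no. norm (wnorm G a (u n - l) - 0) < r" by blast
  qed
  ultimately show "\<exists>l\<in>Ha0 G a. (\<lambda>n. wnorm G a (u n - l)) \<longlonglongrightarrow> 0" by blast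
qed

end

section \<open>Polynomials in several variables\<close>

unbundle no fps_syntax

lemma polynomials_add:
  assumes "p \<in> polynomials" "q \<in> polynomials"
  shows "(\<lambda>z. p z + q z) \<in> (polynomials :: (complex ^ 'd \<Rightarrow> complex) set)"
proof -
  let ?m = "\<lambda>(z :: complex ^ 'd) \<alpha>. \<Prod>i\<in>UNIV. (z $ i) ^ \<alpha> i"
  obtain I c where p: "finite I" "p = (\<lambda>z. \<Sum>\<alpha>\<in>I. c \<alpha> * ?m z \<alpha>)"
    using assms(1) unfolding polynomials_def by blast
  obtain J d where q: "finite J" "q = (\<lambda>z. \<Sum>\<alpha>\<in>J. d \<alpha> * ?m z \<alpha>)"
    using assms(2) unfolding polynomials_def by blast
  define e where "e \<alpha> = (if \<alpha> \<in> I then c \<alpha> else 0) + (if \<alpha> \<in> J then d \<alpha> else 0)" for \<alpha>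
  have "p z + q z = (\<Sum>\<alpha>\<in>I \<union> J. e \<alpha> * ?m z \<alpha>)" for z
  proof -
    have "p z = (\<Sum>\<alpha>\<in>I \<union> J. (if \<alpha> \<in> I then c \<alpha> else 0) * ?m z \<alpha>)"
      unfolding p(2) using p(1) q(1) by (intro sum.mono_neutral_cong_left) auto
    moreover have "q z = (\<Sum>\<alpha>\<in>I \<union> J. (if \<alpha> \<in> J then d \<alpha> else 0) * ?m z \<alpha>)"
      unfolding q(2) using p(1) q(1) by (intro sum.mono_neutral_cong_left) auto
    ultimately show ?thesis by (simp add: e_def sum.distrib algebra_simps)
  qed
  then show ?thesis unfolding polynomials_def using p(1) q(1)
    by (intro CollectI exI[of _ "I \<union> J"] exI[of _ e]) auto
qed

lemma polynomials_cmult: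
  assumes "p \<in> polynomials"
  shows "(\<lambda>z. c * p z) \<in> polynomials"
proof -
  obtain I b where p: "finite I" "p = (\<lambda>z. \<Sum>\<alpha>\<in>I. b \<alpha> * (\<Prod>i\<in>UNIV. (z $ i) ^ \<alpha> i))"
    using assms unfolding polynomials_def by blast
  show ?thesis unfolding polynomials_def using p
    by (intro CollectI exI[of _ I] exI[of _ "\<lambda>\<alpha>. c * b \<alpha>"]) (simp add: sum_distrib_left mult.assoc)
qed

lemma polynomials_const: "(\<lambda>_. c) \<in> polynomials"
  unfolding polynomials_def by (intro CollectI exI[of _ "{\<lambda>_. 0}"] exI[of _ "\<lambda>_. c"]) simp

lemma polynomials_sum: "finite K \<Longrightarrow> (\<And>k. k \<in> K \<Longrightarrow> p k \<in> polynomials) \<Longrightarrow> (\<lambda>z. \<Sum>k\<in>K. p k z) \<in> polynomials"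
  by (induction K rule: finite_induct) (auto intro: polynomials_const polynomials_add)

lemma polynomials_coordinate:
  assumes "p \<in> polynomials"
  shows "(\<lambda>z. z $ j * p z) \<in> (polynomials :: (complex ^ 'd \<Rightarrow> complex) set)"
proof -
  obtain I b where p: "finite I" "p = (\<lambda>z. \<Sum>\<alpha>\<in>I. b \<alpha> * (\<Prod>i\<in>UNIV. (z $ i) ^ \<alpha> i))"
    using assms unfolding polynomials_def by blast
  \<comment> \<open>Multiplying by the j-th coordinate shifts exponents by s; the left inverse t
    recovers the coefficient belonging to a shifted exponent.\<close>
  define s where "s \<alpha> = \<alpha>(j := Suc (\<alpha> j))" for \<alpha> :: "'d \<Rightarrow> nat"
  define t where "t \<alpha> = \<alpha>(j := \<alpha> j - 1)" for \<alpha> :: "'d \<Rightarrow> nat"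
  have ts: "t (s \<alpha>) = \<alpha>" for \<alpha> by (auto simp: s_def t_def)
  then have inj: "inj_on s I" by (metis inj_onI)
  have mono: "z $ j * (\<Prod>i\<in>UNIV. (z $ i) ^ \<alpha> i) = (\<Prod>i\<in>UNIV. (z $ i) ^ s \<alpha> i)" for z :: "complex ^ 'd" and \<alpha>
  proof -
    have "(\<Prod>i\<in>UNIV. (z $ i) ^ s \<alpha> i) = (z $ j) ^ Suc (\<alpha> j) * (\<Prod>i\<in>UNIV - {j}. (z $ i) ^ s \<alpha> i)"
      by (subst prod.remove[of UNIV j]) (auto simp: s_def)
    also have "(\<Prod>i\<in>UNIV - {j}. (z $ i) ^ s \<alpha> i) = (\<Prod>i\<in>UNIV - {j}. (z $ i) ^ \<alpha> i)"
      by (intro prod.cong) (auto simp: s_def)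
    finally show ?thesis by (subst prod.remove[of UNIV j]) auto
  qed
  have "z $ j * p z = (\<Sum>\<alpha>\<in>s ` I. b (t \<alpha>) * (\<Prod>i\<in>UNIV. (z $ i) ^ \<alpha> i))" for z
    unfolding p(2) sum_distrib_left sum.reindex[OF inj] comp_def ts mono[symmetric]
    by (simp add: algebra_simps)
  then show ?thesis unfolding polynomials_def using p(1)
    by (intro CollectI exI[of _ "s ` I"] exI[of _ "\<lambda>\<alpha>. b (t \<alpha>)"]) auto
qed

lemma polynomials_poly_coordinate:
  assumes "p \<in> polynomials"
  shows "(\<lambda>z. poly q (z $ j) * p z) \<in> (polynomials :: (complex ^ 'd \<Rightarrow> complex) set)"
proof (induction q)
  case 0
  then show ?case using polynomials_const[of 0] by simp
next
  case (pCons c q)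
  have "(\<lambda>z. c * p z + z $ j * (poly q (z $ j) * p z)) \<in> polynomials"
    by (intro polynomials_add polynomials_cmult assms polynomials_coordinate pCons)
  then show ?case by (simp add: algebra_simps)
qed

section \<open>Separately polynomial functions\<close>

text \<open>The nodes 0, ..., n and hence the basis depend on n only. With one basis for all q, the
  coefficients of a polynomial slice become values of the function at fixed nodes.\<close>

lemma lagrange_interpolation:
  "\<exists>L :: nat \<Rightarrow> complex poly. \<forall>q. degree q \<le> n \<longrightarrow>
     (\<forall>x. poly q x = (\<Sum>j\<le>n. poly q (of_nat j) * poly (L j) x))"
proof -
  define L :: "nat \<Rightarrow> complex poly" where
    "L j = (\<Prod>m\<in>{..n} - {j}. smult (inverse (of_nat j - of_nat m)) [:- of_nat m, 1:])" for j
  have deg: "degree (L j) \<le> n" if "j \<le> n" for j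
  proof -
    have "degree (L j) \<le> (\<Sum>m\<in>{..n} - {j}. 1)"
      unfolding L_def
      by (rule order_trans[OF degree_prod_sum_le], simp, rule sum_mono)
        (simp add: order_trans[OF degree_smult_le])
    also have "\<dots> = n" using that by (simp add: card_Diff_singleton)
    finally show ?thesis .
  qed
  have eval: "poly (L j) (of_nat i) = (if i = j then 1 else 0)" if "i \<le> n" "j \<le> n" for i j
  proof (cases "i = j")
    case True
    have "poly (L j) (of_nat j) = (\<Prod>m\<in>{..n} - {j}. 1)"
      unfolding L_def poly_prod
    proof (intro prod.cong refl)
      fix m assume "m \<in> {..n} - {j}"
      then have "(of_nat j :: complex) - of_nat m \<noteq> 0" by auto
      then show "poly (smult (inverse (of_nat j - of_nat m)) [:- of_nat m, 1:]) (of_nat j) = (1 :: complex)"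
        by (simp add: left_diff_distrib[symmetric] right_diff_distrib[symmetric] mult.commute)
    qed
    then show ?thesis using True by simp
  next
    case False
    then have "i \<in> {..n} - {j}" using that by simp
    then show ?thesis using False unfolding L_def poly_prod by (auto intro!: prod_zero bexI[of _ i])
  qed
  have "poly q x = (\<Sum>j\<le>n. poly q (of_nat j) * poly (L j) x)" if q: "degree q \<le> n" for q x
  proof -
    define q' where "q' = (\<Sum>j\<le>n. smult (poly q (of_nat j)) (L j))"
    have "q = q'"
    proof (rule poly_eqI_degree)
      have c: "card ((of_nat :: nat \<Rightarrow> complex) ` {..n}) = Suc n"
        by (subst card_image) (auto intro: inj_on_subset[OF inj_of_nat])
      show "degree q < card ((of_nat :: nat \<Rightarrow> complex) ` {..n})" using q c by simp
      have "degree q' \<le> n" unfolding q'_def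
        by (intro degree_sum_le) (auto intro: order_trans[OF degree_smult_le] deg)
      then show "degree q' < card ((of_nat :: nat \<Rightarrow> complex) ` {..n})" using c by simp
      fix x :: complex assume "x \<in> of_nat ` {..n}"
      then obtain i where i: "i \<le> n" "x = of_nat i" by auto
      have "poly q' x = (\<Sum>j\<le>n. poly q (of_nat j) * (if i = j then 1 else 0))"
        unfolding q'_def poly_sum i(2) using eval[OF i(1)] by (intro sum.cong) auto
      also have "\<dots> = poly q x" using i by (simp add: if_distrib cong: if_cong)
      finally show "poly q x = poly q' x" by simp
    qed
    then have "poly q x = poly q' x" by simp
    then show ?thesis by (simp add: q'_def poly_sum)
  qed
  then show ?thesis by blast
qed

definition coord_upd :: "complex ^ 'd \<Rightarrow> 'd \<Rightarrow> complex \<Rightarrow> complex ^ 'd" where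
  "coord_upd z i u = (\<chi> j. if j = i then u else z $ j)"

lemma coord_upd_nth [simp]: "coord_upd z i u $ j = (if j = i then u else z $ j)"
  by (simp add: coord_upd_def)

text \<open>Induction on the set of variables on which F depends: interpolation in the variable i
  writes F as a combination of slices that no longer depend on i. The degree bound is common to all
  slices because the interpolation basis must not vary with the other variables.\<close>

lemma separately_polynomial_aux:
  fixes F :: "complex ^ 'd \<Rightarrow> complex"
  assumes "finite I"
    and "\<And>i z. \<exists>q. degree q \<le> n \<and> (\<forall>u. F (coord_upd z i u) = poly q u)"
    and "\<And>z y. (\<And>i. i \<in> I \<Longrightarrow> z $ i = y $ i) \<Longrightarrow> F z = F y"
  shows "F \<in> polynomials"
  using assms
proof (induction I arbitrary: F rule: finite_induct)
  case empty
  then have "F = (\<lambda>_. F 0)" by blast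
  then show ?case using polynomials_const by metis
next
  case (insert i I)
  obtain L :: "nat \<Rightarrow> complex poly" where L: "\<And>q x. degree q \<le> n \<Longrightarrow> poly q x = (\<Sum>j\<le>n. poly q (of_nat j) * poly (L j) x)"
    using lagrange_interpolation by blast
  have upd: "coord_upd z i (z $ i) = z" for z :: "complex ^ 'd" by (simp add: vec_eq_iff)
  have F: "F z = (\<Sum>j\<le>n. poly (L j) (z $ i) * F (coord_upd z i (of_nat j)))" for z
  proof -
    obtain q where q: "degree q \<le> n" "\<And>u. F (coord_upd z i u) = poly q u" using insert.prems(1) by blast
    have "F z = poly q (z $ i)" using q(2)[of "z $ i"] upd by simp
    also have "\<dots> = (\<Sum>j\<le>n. poly q (of_nat j) * poly (L j) (z $ i))" by (rule L[OF q(1)])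
    finally show ?thesis by (simp add: q(2) mult.commute)
  qed
  have "(\<lambda>z. F (coord_upd z i (of_nat j))) \<in> polynomials" for j
  proof (rule insert.IH)
    fix i' z
    show "\<exists>q. degree q \<le> n \<and> (\<forall>u. F (coord_upd (coord_upd z i' u) i (of_nat j)) = poly q u)"
    proof (cases "i' = i")
      case True
      have "coord_upd (coord_upd z i' u) i (of_nat j) = coord_upd z i (of_nat j)" for u
        using True by (simp add: vec_eq_iff)
      then show ?thesis by (intro exI[of _ "[:F (coord_upd z i (of_nat j)):]"]) simp
    next
      case False
      have "coord_upd (coord_upd z i' u) i (of_nat j) = coord_upd (coord_upd z i (of_nat j)) i' u" for u
        using False by (auto simp: vec_eq_iff)
      then show ?thesis using insert.prems(1)[of "coord_upd z i (of_nat j)" i'] by simp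
    qed
  next
    fix z y :: "complex ^ 'd" assume "\<And>k. k \<in> I \<Longrightarrow> z $ k = y $ k"
    then show "F (coord_upd z i (of_nat j)) = F (coord_upd y i (of_nat j))"
      by (intro insert.prems(2)) auto
  qed
  then have "(\<lambda>z. \<Sum>j\<le>n. poly (L j) (z $ i) * F (coord_upd z i (of_nat j))) \<in> polynomials"
    by (intro polynomials_sum polynomials_poly_coordinate) auto
  moreover have "F = (\<lambda>z. \<Sum>j\<le>n. poly (L j) (z $ i) * F (coord_upd z i (of_nat j)))"
    by (rule ext) (rule F)
  ultimately show ?case by metis
qed

lemma separately_polynomial:
  fixes F :: "complex ^ 'd \<Rightarrow> complex"
  assumes "\<And>i z. \<exists>q. degree q \<le> n \<and> (\<forall>u. F (coord_upd z i u) = poly q u)"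
  shows "F \<in> polynomials"
proof (rule separately_polynomial_aux[of UNIV n])
  fix z y :: "complex ^ 'd" assume "\<And>i. i \<in> UNIV \<Longrightarrow> z $ i = y $ i"
  then have "z = y" by (simp add: vec_eq_iff)
  then show "F z = F y" by simp
qed (use assms in auto)

section \<open>Homogeneous parts of holomorphic functions\<close>

text \<open>The k-homogeneous part of the Taylor expansion of g at 0, read off along the complex
  line through z. When 0 is interior to G, only values near 0 matter, so z may be any vector and
  need not lie in G.\<close>

definition hom_part :: "(complex ^ 'd \<Rightarrow> complex) \<Rightarrow> nat \<Rightarrow> complex ^ 'd \<Rightarrow> complex" where
  "hom_part g k z = (deriv ^^ k) (\<lambda>\<zeta>. g (\<zeta> *s z)) 0 / fact k"

lemma Hol_ray_holomorphic:
  assumes "g \<in> Hol G" "\<And>\<zeta>. \<zeta> \<in> S \<Longrightarrow> \<zeta> *s z \<in> G"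
  shows "(\<lambda>\<zeta>. g (\<zeta> *s z)) holomorphic_on S"
  using Hol_line_holomorphic[OF assms(1), of S 0 z] assms(2) by simp

lemma hom_part_bound:
  assumes g: "g \<in> Hol G" and \<rho>: "\<rho> > 0"
    and ray: "\<And>\<zeta>. cmod \<zeta> \<le> \<rho> \<Longrightarrow> \<zeta> *s z \<in> G" "\<And>\<zeta>. cmod \<zeta> \<le> \<rho> \<Longrightarrow> cmod (g (\<zeta> *s z)) \<le> C"
  shows "cmod (hom_part g k z) \<le> C / \<rho> ^ k"
proof -
  have hol: "(\<lambda>\<zeta>. g (\<zeta> *s z)) holomorphic_on cball 0 \<rho>"
    by (rule Hol_ray_holomorphic[OF g]) (use ray in auto)
  have "cmod ((deriv ^^ k) (\<lambda>\<zeta>. g (\<zeta> *s z)) 0) \<le> fact k * C / \<rho> ^ k"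
  proof (rule Cauchy_inequality)
    show "(\<lambda>\<zeta>. g (\<zeta> *s z)) holomorphic_on ball 0 \<rho>" using hol by (rule holomorphic_on_subset) auto
    show "continuous_on (cball 0 \<rho>) (\<lambda>\<zeta>. g (\<zeta> *s z))" using hol by (rule holomorphic_on_imp_continuous_on)
  qed (use \<rho> ray in auto)
  then show ?thesis by (simp add: hom_part_def norm_divide field_simps)
qed

lemma hom_part_sums:
  assumes g: "g \<in> Hol G" and ray: "\<And>\<zeta>. cmod \<zeta> < \<rho> \<Longrightarrow> \<zeta> *s z \<in> G" and t: "cmod t < \<rho>"
  shows "(\<lambda>k. hom_part g k z * t ^ k) sums g (t *s z)"
proof -
  have "(\<lambda>\<zeta>. g (\<zeta> *s z)) holomorphic_on ball 0 \<rho>"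
    by (rule Hol_ray_holomorphic[OF g]) (use ray in auto)
  from holomorphic_power_series[OF this, of t] t show ?thesis by (simp add: hom_part_def)
qed

text \<open>By the Cauchy bounds the tail is dominated by a geometric series with ratio
  |t|/\<rho>.\<close>

lemma hom_part_tail:
  assumes g: "g \<in> Hol G" and \<rho>: "\<rho> > 0"
    and ray: "\<And>\<zeta>. cmod \<zeta> \<le> \<rho> \<Longrightarrow> \<zeta> *s z \<in> G" "\<And>\<zeta>. cmod \<zeta> \<le> \<rho> \<Longrightarrow> cmod (g (\<zeta> *s z)) \<le> C"
    and t: "cmod t < \<rho>"
  shows "cmod (g (t *s z) - (\<Sum>l<k. hom_part g l z * t ^ l)) \<le> C * (cmod t / \<rho>) ^ k / (1 - cmod t / \<rho>)"
proof -
  define q where "q = cmod t / \<rho>"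
  have q: "0 \<le> q" "q < 1" using t \<rho> by (auto simp: q_def)
  have "(\<lambda>n. hom_part g (n + k) z * t ^ (n + k)) sums (g (t *s z) - (\<Sum>l<k. hom_part g l z * t ^ l))"
    by (rule sums_split_initial_segment[OF hom_part_sums[OF g _ t]]) (use ray in auto)
  moreover have "(\<lambda>n. C * q ^ k * q ^ n) sums (C * q ^ k * (1 / (1 - q)))"
    using q by (intro sums_mult geometric_sums) auto
  moreover have "cmod (hom_part g (n + k) z * t ^ (n + k)) \<le> C * q ^ k * q ^ n" for n
  proof -
    have "cmod (hom_part g (n + k) z * t ^ (n + k)) \<le> C / \<rho> ^ (n + k) * cmod t ^ (n + k)"
      unfolding norm_mult norm_power by (intro mult_right_mono hom_part_bound[OF g \<rho> ray]) auto
    also have "\<dots> = C * q ^ k * q ^ n" by (simp add: q_def power_divide power_add mult_ac)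
    finally show ?thesis .
  qed
  ultimately have "cmod (g (t *s z) - (\<Sum>l<k. hom_part g l z * t ^ l)) \<le> C * q ^ k * (1 / (1 - q))"
    by (rule norm_sums_le)
  then show ?thesis by (simp add: q_def)
qed

text \<open>The k-th part is the limit of (g (t y) minus the lower parts)/t^k as t tends to 0. By
  induction these quotients are holomorphic along the line, and the tail estimate makes the limit
  uniform on discs.\<close>

lemma hom_part_line_holomorphic:
  assumes g: "g \<in> Hol G" and r: "r > 0" "cball 0 r \<subseteq> G" and C: "\<And>z. z \<in> cball 0 r \<Longrightarrow> cmod (g z) \<le> C"
  shows "(\<lambda>u. hom_part g k (z + u *s h)) holomorphic_on UNIV"
proof (induction k rule: less_induct)
  case (less k)
  have C0: "0 \<le> C" using order_trans[OF norm_ge_zero C[of 0]] r(1) by simp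
  have hol: "(\<lambda>u. hom_part g k (z + u *s h)) holomorphic_on ball 0 U" if U: "U > 0" for U
  proof -
    \<comment> \<open>R bounds the points of the line over the disc of radius U; scaling them by at
      most \<rho> = r/R keeps them in the ball where g is bounded by C.\<close>
    define R where "R = norm z + U * norm h + 1"
    define \<rho> where "\<rho> = r / R"
    have R: "R > 0" using U by (simp add: R_def add_nonneg_pos)
    have \<rho>: "\<rho> > 0" using R r by (simp add: \<rho>_def)
    have zR: "norm (z + u *s h) \<le> R" if "u \<in> cball 0 U" for u
    proof -
      have "norm (z + u *s h) \<le> norm z + cmod u * norm h"
        using norm_triangle_ineq[of z "u *s h"] by (simp add: norm_vector_scalar_mult)
      also have "cmod u * norm h \<le> U * norm h" using that by (intro mult_right_mono) auto
      finally show ?thesis by (simp add: R_def)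
    qed
    have ray: "\<zeta> *s y \<in> cball 0 r" if "cmod \<zeta> \<le> \<rho>" "norm y \<le> R" for \<zeta> and y :: "complex ^ 'a"
    proof -
      have "cmod \<zeta> * norm y \<le> \<rho> * R" using that \<rho> by (intro mult_mono) auto
      also have "\<dots> = r" using R by (simp add: \<rho>_def)
      finally show ?thesis by (simp add: norm_vector_scalar_mult)
    qed
    \<comment> \<open>A null sequence of nonzero scalars; the 2 in the denominator gives |t| <=
      \<rho>/2, so the geometric factor in the tail is at most 2.\<close>
    define t where "t n = complex_of_real (\<rho> / (real n + 2))" for n
    have tn: "cmod (t n) = \<rho> / (real n + 2)" for n
      using \<rho> unfolding t_def by (simp only: norm_of_real) simp
    have t2: "cmod (t n) \<le> \<rho> / 2" for n unfolding tn using \<rho> by (intro divide_left_mono) auto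
    have t0: "t n \<noteq> 0" for n using \<rho> by (simp add: t_def add_nonneg_eq_0_iff del: of_real_divide)
    define f where "f n u = (g (t n *s (z + u *s h)) - (\<Sum>l<k. hom_part g l (z + u *s h) * t n ^ l)) / t n ^ k" for n u
    have fhol: "f n holomorphic_on cball 0 U" for n
    proof -
      have eq: "t n *s (z + u *s h) = t n *s z + u *s (t n *s h)" for u
        by (simp add: vec_eq_iff algebra_simps)
      have "(\<lambda>u. g (t n *s z + u *s (t n *s h))) holomorphic_on cball 0 U"
      proof (rule Hol_line_holomorphic[OF g])
        fix u :: complex assume u: "u \<in> cball 0 U"
        have "t n *s (z + u *s h) \<in> cball 0 r" using t2[of n] \<rho> by (intro ray zR[OF u]) auto
        then show "t n *s z + u *s (t n *s h) \<in> G" using r(2) unfolding eq by blast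
      qed
      then have "(\<lambda>u. g (t n *s (z + u *s h))) holomorphic_on cball 0 U" unfolding eq .
      moreover have "(\<lambda>u. hom_part g l (z + u *s h)) holomorphic_on cball 0 U" if "l < k" for l
        using less[OF that] by (rule holomorphic_on_subset) simp
      ultimately show ?thesis unfolding f_def using t0[of n] by (intro holomorphic_intros) auto
    qed
    have unif: "uniform_limit (cball 0 U) f (\<lambda>u. hom_part g k (z + u *s h)) sequentially"
    proof (rule uniform_limitI)
      fix e :: real assume e: "e > 0"
      obtain n0 :: nat where n0: "2 * C / \<rho> ^ k / e < real n0" using reals_Archimedean2 by blast
      have "dist (f n u) (hom_part g k (z + u *s h)) < e" if n: "n \<ge> n0" and u: "u \<in> cball 0 U" for n u
      proof -
        let ?y = "z + u *s h"
        have "cmod (g (t n *s ?y) - (\<Sum>l<Suc k. hom_part g l ?y * t n ^ l))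
            \<le> C * (cmod (t n) / \<rho>) ^ Suc k / (1 - cmod (t n) / \<rho>)"
          by (rule hom_part_tail[OF g \<rho>]) (use ray[OF _ zR[OF u]] r(2) C t2[of n] \<rho> in \<open>auto simp: subset_iff\<close>)
        also have "\<dots> \<le> C * (cmod (t n) / \<rho>) ^ Suc k / (1 / 2)"
        proof (rule divide_left_mono)
          have "cmod (t n) / \<rho> \<le> 1 / 2" using t2[of n] \<rho> by (simp add: field_simps)
          then show half: "1 / 2 \<le> 1 - cmod (t n) / \<rho>" by linarith
          show "0 < (1 - cmod (t n) / \<rho>) * (1 / 2)" by (rule mult_pos_pos) (use half in linarith)+
          show "0 \<le> C * (cmod (t n) / \<rho>) ^ Suc k" using C0 \<rho> by simp
        qed
        finally have tail: "cmod (g (t n *s ?y) - (\<Sum>l<Suc k. hom_part g l ?y * t n ^ l)) \<le> 2 * C * (cmod (t n) / \<rho>) ^ Suc k"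
          by (simp add: mult_ac)
        have "f n u - hom_part g k ?y = (g (t n *s ?y) - (\<Sum>l<Suc k. hom_part g l ?y * t n ^ l)) / t n ^ k"
          using t0[of n] by (simp add: f_def field_simps)
        then have "cmod (f n u - hom_part g k ?y) = cmod (g (t n *s ?y) - (\<Sum>l<Suc k. hom_part g l ?y * t n ^ l)) / cmod (t n) ^ k"
          by (simp add: norm_divide norm_power)
        also have "\<dots> \<le> 2 * C * (cmod (t n) / \<rho>) ^ Suc k / cmod (t n) ^ k"
          by (rule divide_right_mono[OF tail]) simp
        also have "\<dots> = 2 * C / \<rho> ^ k * (cmod (t n) / \<rho>)"
          using t0[of n] \<rho> by (simp add: power_divide field_simps)
        also have "cmod (t n) / \<rho> = 1 / (real n + 2)" using \<rho> by (simp add: tn)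
        also have "2 * C / \<rho> ^ k * (1 / (real n + 2)) < e"
        proof -
          have "2 * C / \<rho> ^ k < e * real n0"
            using n0 unfolding pos_divide_less_eq[OF e] by (simp only: mult.commute)
          also have "\<dots> \<le> e * (real n + 2)" using n e by (intro mult_left_mono) auto
          finally have "2 * C / \<rho> ^ k / (real n + 2) < e" by (subst pos_divide_less_eq) auto
          then show ?thesis by (simp only: times_divide_eq_right mult_1_right)
        qed
        finally show ?thesis by (simp add: dist_norm)
      qed
      then show "\<forall>\<^sub>F n in sequentially. \<forall>u\<in>cball 0 U. dist (f n u) (hom_part g k (z + u *s h)) < e"
        unfolding eventually_sequentially by blast
    qed
    show ?thesis
    proof (rule holomorphic_uniform_limit[OF _ unif])
      show "\<forall>\<^sub>F n in sequentially. continuous_on (cball 0 U) (f n) \<and> f n holomorphic_on ball 0 U"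
        by (intro always_eventually allI conjI holomorphic_on_imp_continuous_on fhol
            holomorphic_on_subset[OF fhol ball_subset_cball])
    qed auto
  qed
  show ?case
    unfolding holomorphic_on_def
  proof
    fix u :: complex
    have "(\<lambda>u. hom_part g k (z + u *s h)) field_differentiable at u"
      by (rule holomorphic_on_imp_differentiable_at[OF hol[of "cmod u + 1"]]) (auto simp: add_nonneg_pos)
    then show "(\<lambda>u. hom_part g k (z + u *s h)) field_differentiable at u within UNIV" by simp
  qed
qed

lemma Hol_bounded_near_zero:
  assumes "open G" "0 \<in> G" "g \<in> Hol G"
  obtains r C where "r > 0" "cball 0 r \<subseteq> G" "\<And>z. z \<in> cball 0 r \<Longrightarrow> cmod (g z) \<le> C"
proof -
  obtain r where r: "r > 0" "cball 0 r \<subseteq> G" using assms(1,2) open_contains_cball by blast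
  have "compact (g ` cball 0 r)"
    by (intro compact_continuous_image continuous_on_subset[OF continuous_on_Hol[OF assms(3)] r(2)]) simp
  then have "bounded (g ` cball 0 r)" by (rule compact_imp_bounded)
  then obtain C where "\<And>z. z \<in> cball 0 r \<Longrightarrow> cmod (g z) \<le> C" unfolding bounded_iff by blast
  with r show thesis using that by blast
qed

text \<open>Along each coordinate line the k-th part is entire and grows at most like |u|^k, so by
  Liouville it is a polynomial of degree at most k there, a bound common to all lines.\<close>

lemma hom_part_polynomial:
  fixes G :: "(complex ^ 'd) set"
  assumes G: "open G" "0 \<in> G" and g: "g \<in> Hol G"
  shows "hom_part g k \<in> polynomials"
proof (rule separately_polynomial[where n = k])
  fix i and z :: "complex ^ 'd"
  obtain r C where r: "r > 0" "cball 0 r \<subseteq> G" and C: "\<And>z. z \<in> cball 0 r \<Longrightarrow> cmod (g z) \<le> C"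
    using Hol_bounded_near_zero[OF G g] by blast
  have C0: "0 \<le> C" using order_trans[OF norm_ge_zero C[of 0]] r(1) by simp
  define y where "y = coord_upd z i 0"
  define h where "h = (axis i 1 :: complex ^ 'd)"
  have upd: "coord_upd z i u = y + u *s h" for u
    by (simp add: y_def h_def vec_eq_iff axis_def)
  define f where "f u = hom_part g k (y + u *s h)" for u
  have hol: "f holomorphic_on UNIV" unfolding f_def by (rule hom_part_line_holomorphic[OF g r C])
  define R where "R = norm y + norm h + 1"
  have R: "R > 0" by (simp add: R_def add_nonneg_pos)
  \<comment> \<open>The admissible radius along the ray shrinks like 1/|u|, which turns the Cauchy
    bound C/\<rho>^k into growth of order k. The condition |u| >= 1 absorbs the constant part of the
    line into R |u|.\<close>
  have bound: "cmod (f u) \<le> C * (R / r) ^ k * cmod u ^ k" if u: "1 \<le> cmod u" for u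
  proof -
    define \<rho> where "\<rho> = r / (R * cmod u)"
    have u0: "cmod u > 0" using u by linarith
    have \<rho>: "\<rho> > 0" using r R u0 by (simp add: \<rho>_def)
    have "norm (y + u *s h) \<le> norm y + cmod u * norm h"
      using norm_triangle_ineq[of y "u *s h"] by (simp add: norm_vector_scalar_mult)
    also have "\<dots> \<le> norm y * cmod u + cmod u * norm h + cmod u"
      using u mult_left_mono[OF u norm_ge_zero[of y]] by simp
    also have "\<dots> = R * cmod u" by (simp add: R_def algebra_simps)
    finally have yu: "norm (y + u *s h) \<le> R * cmod u" .
    have ray: "\<zeta> *s (y + u *s h) \<in> cball 0 r" if "cmod \<zeta> \<le> \<rho>" for \<zeta>
    proof -
      have "cmod \<zeta> * norm (y + u *s h) \<le> \<rho> * (R * cmod u)" using that yu \<rho> by (intro mult_mono) auto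
      also have "\<dots> = r" using R u0 by (simp add: \<rho>_def)
      finally show ?thesis by (simp only: mem_cball_0 norm_vector_scalar_mult)
    qed
    have "cmod (f u) \<le> C / \<rho> ^ k"
      unfolding f_def by (rule hom_part_bound[OF g \<rho>]) (use ray r(2) C in auto)
    also have "\<dots> = C * (R / r) ^ k * cmod u ^ k"
      using R r u0 by (simp add: \<rho>_def power_divide power_mult_distrib)
    finally show ?thesis .
  qed
  define q where "q = (\<Sum>j\<le>k. monom ((deriv ^^ j) f 0 / fact j) j)"
  have "degree q \<le> k"
    unfolding q_def by (intro degree_sum_le) (auto intro: order_trans[OF degree_monom_le])
  moreover have "f u = poly q u" for u
  proof -
    have "f u = (\<Sum>j\<le>k. (deriv ^^ j) f 0 / fact j * u ^ j)" by (rule Liouville_polynomial[OF hol bound])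
    then show ?thesis by (simp add: q_def poly_sum poly_monom)
  qed
  ultimately show "\<exists>q. degree q \<le> k \<and> (\<forall>u. hom_part g k (coord_upd z i u) = poly q u)"
    unfolding upd f_def by blast
qed

text \<open>
  The dilations \<open>z \<mapsto> g (r z)\<close> with \<open>r < 1\<close> satisfy the same bound by the maximum principle on
  discs, and their Taylor polynomials satisfy it up to a factor tending to \<open>1\<close>, because Cauchy's
  inequality bounds every homogeneous part of \<open>g\<close> by the radial majorant \<open>w\<close>.
\<close>

lemma Hol_bound_via_polynomials:
  assumes G: "open G" "balanced_set G" and z0: "z0 \<in> G" and g: "g \<in> Hol G"
    and w: "radial_on G w" "\<And>z. z \<in> G \<Longrightarrow> 0 < w z" and gw: "\<And>z. z \<in> G \<Longrightarrow> cmod (g z) \<le> w z"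
    and B: "\<And>p. p \<in> polynomials \<Longrightarrow> (\<And>z. z \<in> G \<Longrightarrow> cmod (p z) \<le> w z) \<Longrightarrow> cmod (p z0) \<le> B"
  shows "cmod (g z0) \<le> B"
proof -
  have bal: "c *s z \<in> G" if "z \<in> G" "cmod c \<le> 1" for c z
    using G(2) that by (simp add: balanced_set_def)
  have G0: "0 \<in> G" using bal[OF z0, of 0] by simp
  have disc: "cmod (g (\<zeta> *s z)) \<le> w z" if z: "z \<in> G" and \<zeta>: "cmod \<zeta> \<le> 1" for \<zeta> z
  proof (rule maximum_modulus_frontier[of "\<lambda>\<zeta>. g (\<zeta> *s z)" "cball 0 1"])
    have hol: "(\<lambda>\<zeta>. g (\<zeta> *s z)) holomorphic_on cball 0 1"
      by (rule Hol_ray_holomorphic[OF g]) (use bal[OF z] in auto)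
    show "(\<lambda>\<zeta>. g (\<zeta> *s z)) holomorphic_on interior (cball 0 1)"
      using hol by (rule holomorphic_on_subset) (rule interior_subset)
    show "continuous_on (closure (cball 0 1)) (\<lambda>\<zeta>. g (\<zeta> *s z))"
      using holomorphic_on_imp_continuous_on[OF hol] by simp
    fix \<xi> :: complex assume "\<xi> \<in> frontier (cball 0 1)"
    then have \<xi>: "cmod \<xi> = 1" by (simp add: frontier_cball)
    then have "cmod (g (\<xi> *s z)) \<le> w (\<xi> *s z)" by (intro gw bal[OF z]) simp
    also have "\<dots> = w z" using w(1) z \<xi> by (simp add: radial_on_def)
    finally show "cmod (g (\<xi> *s z)) \<le> w z" .
  qed (use \<zeta> in auto)
  have dil: "cmod (g (complex_of_real r *s z0)) \<le> B" if r: "0 < r" "r < 1" for r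
  proof -
    define \<theta> where "\<theta> n = r ^ n / (1 - r)" for n
    have \<theta>0: "\<theta> n \<ge> 0" for n using r by (simp add: \<theta>_def)
    define S where "S n z = (\<Sum>k<n. complex_of_real r ^ k * hom_part g k z)" for n z
    have tail: "cmod (g (complex_of_real r *s z) - S n z) \<le> w z * \<theta> n" if z: "z \<in> G" for n z
    proof -
      have "cmod (g (complex_of_real r *s z) - (\<Sum>k<n. hom_part g k z * complex_of_real r ^ k))
          \<le> w z * (cmod (complex_of_real r) / 1) ^ n / (1 - cmod (complex_of_real r) / 1)"
        by (rule hom_part_tail[OF g]) (use bal[OF z] disc[OF z] r in auto)
      then show ?thesis using r by (simp add: S_def \<theta>_def mult.commute)
    qed
    have Sn: "cmod (S n z0) \<le> (1 + \<theta> n) * B" for n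
    proof -
      have pos: "1 + \<theta> n > 0" using \<theta>0[of n] by simp
      have "cmod (complex_of_real (inverse (1 + \<theta> n)) * S n z0) \<le> B"
      proof (rule B)
        show "(\<lambda>z. complex_of_real (inverse (1 + \<theta> n)) * S n z) \<in> polynomials"
          unfolding S_def by (intro polynomials_cmult polynomials_sum hom_part_polynomial[OF G(1) G0 g]) auto
        fix z assume z: "z \<in> G"
        have "cmod (S n z) \<le> cmod (g (complex_of_real r *s z)) + cmod (g (complex_of_real r *s z) - S n z)"
          using norm_triangle_sub[of "S n z" "g (complex_of_real r *s z)"] by (simp add: norm_minus_commute)
        also have "\<dots> \<le> w z + w z * \<theta> n"
          using tail[OF z] disc[OF z, of "complex_of_real r"] r by (intro add_mono) auto
        finally have "cmod (S n z) \<le> (1 + \<theta> n) * w z" by (simp add: algebra_simps)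
        then have "inverse (1 + \<theta> n) * cmod (S n z) \<le> w z" using pos by (simp add: field_simps)
        then show "cmod (complex_of_real (inverse (1 + \<theta> n)) * S n z) \<le> w z"
          using pos by (simp only: norm_mult norm_of_real) simp
      qed
      then have "inverse (1 + \<theta> n) * cmod (S n z0) \<le> B"
        using pos by (simp only: norm_mult norm_of_real) simp
      then show ?thesis using pos by (simp add: field_simps)
    qed
    have \<theta>lim: "\<theta> \<longlonglongrightarrow> 0"
      unfolding \<theta>_def using r tendsto_divide[OF LIMSEQ_power_zero[of r] tendsto_const[of "1 - r"]] by simp
    have "cmod (g (complex_of_real r *s z0)) \<le> (1 + \<theta> n) * B + w z0 * \<theta> n" for n
      using tail[OF z0, of n] Sn[of n] norm_triangle_sub[of "g (complex_of_real r *s z0)" "S n z0"] by simp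
    moreover have "(\<lambda>n. (1 + \<theta> n) * B + w z0 * \<theta> n) \<longlonglongrightarrow> (1 + 0) * B + w z0 * 0"
      by (intro tendsto_intros \<theta>lim)
    ultimately show ?thesis by (intro LIMSEQ_le_const[where X = "\<lambda>n. (1 + \<theta> n) * B + w z0 * \<theta> n"]) auto
  qed
  \<comment> \<open>The 2 in the denominator keeps r n strictly between 0 and 1 already for n =
    0.\<close>
  define r where "r n = 1 - 1 / (real n + 2)" for n
  have r: "0 < r n" "r n < 1" for n by (auto simp: r_def field_simps)
  have "r \<longlonglongrightarrow> 1"
  proof -
    have "(\<lambda>n. 1 / real (n + 2)) \<longlonglongrightarrow> 0" using LIMSEQ_ignore_initial_segment[OF lim_1_over_n, of 2] by simp
    from tendsto_diff[OF tendsto_const[of 1] this] show ?thesis by (simp add: r_def[abs_def] add.commute)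
  qed
  have hol: "(\<lambda>\<zeta>. g (\<zeta> *s z0)) holomorphic_on cball 0 1"
    by (rule Hol_ray_holomorphic[OF g]) (use bal[OF z0] in auto)
  have "(\<lambda>n. g (complex_of_real (r n) *s z0)) \<longlonglongrightarrow> g (1 *s z0)"
    using holomorphic_on_imp_continuous_on[OF hol]
  proof (rule continuous_on_tendsto_compose)
    show "(\<lambda>n. complex_of_real (r n)) \<longlonglongrightarrow> 1" using tendsto_of_real[OF \<open>r \<longlonglongrightarrow> 1\<close>] by simp
    show "\<forall>\<^sub>F n in sequentially. complex_of_real (r n) \<in> cball 0 1"
      using r by (intro always_eventually allI) (simp add: less_imp_le)
  qed simp
  then have "(\<lambda>n. cmod (g (complex_of_real (r n) *s z0))) \<longlonglongrightarrow> cmod (g z0)"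
    using tendsto_norm by fastforce
  then show ?thesis by (rule LIMSEQ_le_const2) (use dil[OF r] in auto)
qed

section \<open>Weighted spaces of holomorphic functions\<close>

lemma wtilde_upper:
  assumes "g \<in> Hol G" "\<And>\<zeta>. \<zeta> \<in> G \<Longrightarrow> cmod (g \<zeta>) \<le> w \<zeta>" "z \<in> G"
  shows "cmod (g z) \<le> wtilde G w z"
  unfolding wtilde_def
  by (rule cSup_upper) (use assms in \<open>auto intro!: bdd_aboveI[of _ "w z"]\<close>)

text \<open>Nonnegativity of w makes the zero function admissible, so the supremum is taken over a
  nonempty set.\<close>

lemma wtilde_least:
  assumes "\<And>z. z \<in> G \<Longrightarrow> 0 \<le> w z"
    and "\<And>g. g \<in> Hol G \<Longrightarrow> (\<And>\<zeta>. \<zeta> \<in> G \<Longrightarrow> cmod (g \<zeta>) \<le> w \<zeta>) \<Longrightarrow> cmod (g z) \<le> c"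
  shows "wtilde G w z \<le> c"
  unfolding wtilde_def
proof (rule cSup_least)
  have "(0 :: complex ^ 'a \<Rightarrow> complex) \<in> Hol G" by (rule cfun.subspace_0[OF Hol_subspace])
  then have "cmod (0 z) \<in> {cmod (g z) |g. g \<in> Hol G \<and> (\<forall>\<zeta>\<in>G. cmod (g \<zeta>) \<le> w \<zeta>)}"
    using assms(1) by (intro CollectI exI[of _ 0]) simp
  then show "{cmod (g z) |g. g \<in> Hol G \<and> (\<forall>\<zeta>\<in>G. cmod (g \<zeta>) \<le> w \<zeta>)} \<noteq> {}" by blast
qed (use assms(2) in auto)

lemma wtilde_mono:
  assumes "\<And>z. z \<in> G \<Longrightarrow> 0 \<le> w z" "\<And>z. z \<in> G \<Longrightarrow> w z \<le> w' z" "z \<in> G"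
  shows "wtilde G w z \<le> wtilde G w' z"
  by (rule wtilde_least[OF assms(1)], assumption, rule wtilde_upper) (use assms in \<open>auto intro: order_trans\<close>)

text \<open>Divided by a bound of its norm, g competes in the supremum; the summand 1 keeps the
  divisor positive even for g = 0.\<close>

lemma wtilde_growth:
  assumes G: "open G" "G \<noteq> {}" and a: "weight_on G a" and g: "g \<in> Ha0 G a" and z: "z \<in> G"
  shows "cmod (g z) \<le> (wnorm G a g + 1) * wtilde G (\<lambda>\<zeta>. 1 / a \<zeta>) z"
proof -
  define C where "C = wnorm G a g + 1"
  have C: "C > 0" using wnorm_nonneg[OF G a g] by (simp add: C_def)
  have pos: "a \<zeta> > 0" if "\<zeta> \<in> G" for \<zeta> using a that by (simp add: weight_on_def)
  have "cmod (complex_of_real (inverse C) * g z) \<le> wtilde G (\<lambda>\<zeta>. 1 / a \<zeta>) z"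
  proof (rule wtilde_upper[OF _ _ z])
    show "(\<lambda>z. complex_of_real (inverse C) * g z) \<in> Hol G"
      using g by (intro cfun.subspace_scale[OF Hol_subspace]) (simp add: Ha0_def)
    fix \<zeta> assume \<zeta>: "\<zeta> \<in> G"
    have "a \<zeta> * cmod (g \<zeta>) \<le> C" using wnorm_upper[OF G a g \<zeta>] by (simp add: C_def)
    then have "inverse C * cmod (g \<zeta>) \<le> 1 / a \<zeta>" using C pos[OF \<zeta>] by (simp add: field_simps)
    then show "cmod (complex_of_real (inverse C) * g \<zeta>) \<le> 1 / a \<zeta>"
      using C by (simp only: norm_mult norm_of_real) simp
  qed
  then have "inverse C * cmod (g z) \<le> wtilde G (\<lambda>\<zeta>. 1 / a \<zeta>) z"
    using C by (simp only: norm_mult norm_of_real) simp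
  then show ?thesis using C unfolding C_def[symmetric] by (simp add: field_simps)
qed

lemma wtilde_via_polynomials:
  assumes G: "open G" "balanced_set G" and z: "z \<in> G" and a: "weight_on G a" "radial_on G a"
    and B: "\<And>p. p \<in> polynomials \<Longrightarrow> (\<And>\<zeta>. \<zeta> \<in> G \<Longrightarrow> a \<zeta> * cmod (p \<zeta>) \<le> 1) \<Longrightarrow> cmod (p z) \<le> B"
  shows "wtilde G (\<lambda>\<zeta>. 1 / a \<zeta>) z \<le> B"
proof (rule wtilde_least)
  have pos: "a \<zeta> > 0" if "\<zeta> \<in> G" for \<zeta> using a that by (simp add: weight_on_def)
  show "0 \<le> 1 / a \<zeta>" if "\<zeta> \<in> G" for \<zeta> using pos[OF that] by simp
  fix g assume g: "g \<in> Hol G" "\<And>\<zeta>. \<zeta> \<in> G \<Longrightarrow> cmod (g \<zeta>) \<le> 1 / a \<zeta>"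
  show "cmod (g z) \<le> B"
  proof (rule Hol_bound_via_polynomials[OF G z g(1) _ _ g(2)])
    show "radial_on G (\<lambda>\<zeta>. 1 / a \<zeta>)" using a(2) by (simp add: radial_on_def)
    show "0 < 1 / a \<zeta>" if "\<zeta> \<in> G" for \<zeta> using pos[OF that] by simp
    fix p :: "complex ^ 'a \<Rightarrow> complex" assume p: "p \<in> polynomials" "\<And>\<zeta>. \<zeta> \<in> G \<Longrightarrow> cmod (p \<zeta>) \<le> 1 / a \<zeta>"
    show "cmod (p z) \<le> B"
    proof (rule B[OF p(1)])
      fix \<zeta> assume "\<zeta> \<in> G"
      with p(2) pos show "a \<zeta> * cmod (p \<zeta>) \<le> 1" by (simp add: field_simps)
    qed
  qed
qed

section \<open>The weighted spectrum and its barrel\<close>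

locale weighted_plb =
  fixes G :: "(complex ^ 'd) set" and a :: "nat \<Rightarrow> nat \<Rightarrow> complex ^ 'd \<Rightarrow> real"
  assumes G: "open G" "G \<noteq> {}" and a: "weight_double_sequence G a"
begin

lemma weight: "weight_on G (a N n)"
  using a by (simp add: weight_double_sequence_def)

lemma a_pos: "z \<in> G \<Longrightarrow> 0 < a N n z"
  using weight by (simp add: weight_on_def)

lemma a_Suc: "z \<in> G \<Longrightarrow> a N (Suc n) z \<le> a N n z" "z \<in> G \<Longrightarrow> a N n z \<le> a (Suc N) n z"
  using a by (auto simp: weight_double_sequence_def)

lemma a_antimono: "n \<le> n' \<Longrightarrow> z \<in> G \<Longrightarrow> a N n' z \<le> a N n z"
  by (induction n' rule: dec_induct) (auto intro: order_trans a_Suc)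

lemma Ha0_mono:
  assumes "weight_on G b" "\<And>z. z \<in> G \<Longrightarrow> b z \<le> a N n z"
  shows "Ha0 G (a N n) \<subseteq> Ha0 G b"
    and "f \<in> Ha0 G (a N n) \<Longrightarrow> wnorm G b f \<le> wnorm G (a N n) f"
proof -
  have le: "b z * cmod (f z) \<le> a N n z * cmod (f z)" if "z \<in> G" for f z
    using assms(2)[OF that] by (intro mult_right_mono) auto
  show "Ha0 G (a N n) \<subseteq> Ha0 G b"
  proof
    fix f assume f: "f \<in> Ha0 G (a N n)"
    have "vanishes_at_infinity_on G (\<lambda>z. b z * cmod (f z))"
    proof (rule vanishes_at_infinity_on_mono)
      show "vanishes_at_infinity_on G (\<lambda>z. a N n z * cmod (f z))" using f by (simp add: Ha0_def)
      fix z assume z: "z \<in> G"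
      then have "0 < b z" using assms(1) by (simp add: weight_on_def)
      with le[OF z] a_pos[OF z] show "\<bar>b z * cmod (f z)\<bar> \<le> \<bar>a N n z * cmod (f z)\<bar>"
        by (simp add: abs_mult less_imp_le)
    qed
    then show "f \<in> Ha0 G b" using f by (simp add: Ha0_def)
  qed
  show "wnorm G b f \<le> wnorm G (a N n) f" if f: "f \<in> Ha0 G (a N n)"
    by (rule wnorm_least[OF G assms(1)]) (rule order_trans[OF le wnorm_upper[OF G weight f]])
qed

sublocale plb "\<lambda>c (f :: complex ^ 'd \<Rightarrow> complex) z. c * f z" "\<lambda>N n. Ha0 G (a N n)" "\<lambda>N n. wnorm G (a N n)"
proof unfold_locales
  show "cfun.banach_on (Ha0 G (a N n)) (wnorm G (a N n))" for N n
    by (rule banach_on_Ha0[OF G weight])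
qed (rule Ha0_mono[OF weight]; simp add: a_Suc)+

lemma T_eq: "T = A0H G a"
  by (rule ext) (simp add: T_def A0H_def)

lemma E_eq: "E = (\<lambda>N. topspace (A0H G a N))"
  by (rule ext) (metis T_eq topspace_T)

lemma limit_eq: "cfun.projective_limit T = AH0 G a"
  by (simp add: AH0_def T_eq)

text \<open>The modulus of the value at z is a seminorm bounded on each step of \<open>E 0\<close>
  by a multiple of the norm, hence continuous on the limit. The complement of the barrel will be a
  union of such sets.\<close>

lemma openin_evaluation:
  assumes z: "z \<in> G"
  shows "openin (AH0 G a) {g \<in> Y. c < cmod (g z)}"
proof -
  let ?q = "\<lambda>g :: complex ^ 'd \<Rightarrow> complex. cmod (g z)"
  have "openin (cfun.projective_limit T) ({g \<in> E 0. c < cmod (g z)} \<inter> Y)"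
  proof (rule openin_limit_seminorm)
    show "cfun.seminorm_on (E 0) ?q"
      using subspace_E unfolding cfun.seminorm_on_def by (auto simp: norm_mult intro: norm_triangle_ineq)
    show "cmod (g z) \<le> (1 / a 0 n z) * wnorm G (a 0 n) g" if "g \<in> Ha0 G (a 0 n)" for g n
      using wnorm_upper[OF G weight that z] a_pos[OF z, of 0 n] by (simp add: field_simps)
    show "openin (norm_topology (E 0) ?q) {g \<in> E 0. c < cmod (g z)}"
      unfolding openin_norm_topology
    proof (intro conjI ballI)
      fix g assume g: "g \<in> {g \<in> E 0. c < cmod (g z)}"
      show "\<exists>r>0. \<forall>h\<in>E 0. cmod ((h - g) z) < r \<longrightarrow> h \<in> {g \<in> E 0. c < cmod (g z)}"
      proof (intro exI[of _ "cmod (g z) - c"] conjI ballI impI)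
        fix h assume "h \<in> E 0" "cmod ((h - g) z) < cmod (g z) - c"
        then show "h \<in> {g \<in> E 0. c < cmod (g z)}"
          using norm_triangle_sub[of "g z" "h z"] by (simp add: norm_minus_commute)
      qed (use g in simp)
    qed auto
  qed
  moreover have "{g \<in> E 0. c < cmod (g z)} \<inter> Y = {g \<in> Y. c < cmod (g z)}" using Y_E by blast
  ultimately show ?thesis by (simp add: limit_eq)
qed

lemma barrelled_imp_wQ:
  assumes bal: "balanced_setting G a" and barrelled: "cfun.barrelled (AH0 G a)"
  shows "wQ_in_tilde G a"
proof (rule ccontr)
  define u where "u N n = wtilde G (\<lambda>\<zeta>. 1 / a N n \<zeta>)" for N n
  have balG: "balanced_set G" and rad: "\<And>N n. radial_on G (a N n)"
    and poly: "\<And>N n. zero_ext G ` polynomials \<subseteq> Ha0 G (a N n)"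
    using bal by (auto simp: balanced_setting_def)
  have growth: "cmod (g z) \<le> (wnorm G (a N n) g + 1) * u N n z" if "g \<in> Ha0 G (a N n)" "z \<in> G" for g z N n
    unfolding u_def by (rule wtilde_growth[OF G weight that])
  \<comment> \<open>The constant 1 belongs to every space, so the growth estimate for it forces the
    majorant to be positive. The bounds c at the chosen points can then be divided by.\<close>
  have u_pos: "0 < u N n z" if z: "z \<in> G" for N n z
  proof -
    have one: "zero_ext G (\<lambda>_. 1) \<in> Ha0 G (a N n)" using poly polynomials_const by blast
    have "cmod (zero_ext G (\<lambda>_. 1) z) \<le> (wnorm G (a N n) (zero_ext G (\<lambda>_. 1)) + 1) * u N n z"
      by (rule growth[OF one z])
    then have "0 < (wnorm G (a N n) (zero_ext G (\<lambda>_. 1)) + 1) * u N n z"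
      using z by (simp add: zero_ext_def)
    moreover have "0 < wnorm G (a N n) (zero_ext G (\<lambda>_. 1)) + 1"
      using wnorm_nonneg[OF G weight one] by simp
    ultimately show ?thesis using zero_less_mult_pos by blast
  qed
  have u_mono: "u N n z \<le> u N n' z" if "n \<le> n'" "z \<in> G" for N n n' z
    unfolding u_def
    by (rule wtilde_mono) (use a_antimono[OF that(1)] a_pos that(2) in \<open>auto intro!: divide_left_mono mult_pos_pos simp: less_imp_le\<close>)
  assume "\<not> wQ_in_tilde G a"
  then have "\<exists>N. \<forall>M\<ge>N. \<forall>n. \<exists>K\<ge>M. \<exists>m. \<forall>k. \<forall>S>0. \<exists>z\<in>G. S * max (u N n z) (u K k z) < u M m z"
    unfolding wQ_in_tilde_def u_def[symmetric] by (simp add: not_le) (meson not_le)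
  then obtain N where N: "\<And>M n. M \<ge> N \<Longrightarrow> \<exists>K\<ge>M. \<exists>m. \<forall>k. \<forall>S>0.
      \<exists>z\<in>G. S * max (u N n z) (u K k z) < u M m z" by blast
  obtain K m where Km: "\<And>M k S. M \<ge> N \<Longrightarrow> S > 0 \<Longrightarrow>
      \<exists>z\<in>G. S * max (u N M z) (u (K M) k z) < u M (m M) z"
    using N[of M M for M] by metis
  have "\<exists>z\<in>G. real (Suc k) * max (u N M z) (u (K M) k z) < u M (m M) z" if "M \<ge> N" for M k
    by (rule Km[OF that]) simp
  then obtain Z where Z: "\<And>M k. M \<ge> N \<Longrightarrow> Z M k \<in> G"
    "\<And>M k. M \<ge> N \<Longrightarrow> real (Suc k) * max (u N M (Z M k)) (u (K M) k (Z M k)) < u M (m M) (Z M k)"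
    by metis
  define c where "c M k = max (u N M (Z M k)) (u (K M) k (Z M k))" for M k
  have c_pos: "0 < c M k" if "M \<ge> N" for M k
    using u_pos[OF Z(1)[OF that]] by (simp add: c_def less_max_iff_disj)
  define A where "A = {g \<in> Y. \<forall>M\<ge>N. \<forall>k. cmod (g (Z M k)) \<le> c M k}"
  have conv: "cfun.absolutely_convex A"
    unfolding cfun.absolutely_convex_def
  proof (intro ballI allI impI)
    fix f g and \<alpha> \<beta> :: complex assume f: "f \<in> A" and g: "g \<in> A" and ab: "cmod \<alpha> + cmod \<beta> \<le> 1"
    have "(\<lambda>z. \<alpha> * f z) + (\<lambda>z. \<beta> * g z) \<in> Y"
      using f g by (intro cfun.subspace_add[OF subspace_Y] cfun.subspace_scale[OF subspace_Y]) (auto simp: A_def)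
    moreover have "cmod (\<alpha> * f (Z M k) + \<beta> * g (Z M k)) \<le> c M k" if M: "M \<ge> N" for M k
    proof -
      have "cmod (\<alpha> * f (Z M k) + \<beta> * g (Z M k)) \<le> cmod \<alpha> * cmod (f (Z M k)) + cmod \<beta> * cmod (g (Z M k))"
        by (metis norm_mult norm_triangle_ineq)
      also have "\<dots> \<le> cmod \<alpha> * c M k + cmod \<beta> * c M k"
        using f g M by (intro add_mono mult_left_mono) (auto simp: A_def)
      also have "\<dots> \<le> 1 * c M k"
        unfolding distrib_right[symmetric] using c_pos[OF M] ab by (intro mult_right_mono) (auto simp: less_imp_le)
      finally show ?thesis by simp
    qed
    ultimately show "(\<lambda>z. \<alpha> * f z) + (\<lambda>z. \<beta> * g z) \<in> A" by (simp add: A_def)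
  qed
  have top: "topspace (AH0 G a) = Y" using topspace_limit by (simp add: limit_eq)
  have "cfun.barrel (AH0 G a) A"
    unfolding cfun.barrel_def
  proof (intro conjI conv ballI)
    have "openin (AH0 G a) (\<Union>M\<in>{N..}. \<Union>k. {g \<in> Y. c M k < cmod (g (Z M k))})"
      using openin_evaluation[OF Z(1)] by (intro openin_Union ballI) (auto intro!: openin_Union)
    moreover have "topspace (AH0 G a) - A = (\<Union>M\<in>{N..}. \<Union>k. {g \<in> Y. c M k < cmod (g (Z M k))})"
    proof (rule set_eqI)
      fix g :: "complex ^ 'd \<Rightarrow> complex"
      have "(\<forall>M\<ge>N. \<forall>k. cmod (g (Z M k)) \<le> c M k) \<longleftrightarrow> \<not> (\<exists>M\<in>{N..}. \<exists>k. c M k < cmod (g (Z M k)))"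
        by (meson atLeast_iff not_le)
      then show "g \<in> topspace (AH0 G a) - A \<longleftrightarrow> g \<in> (\<Union>M\<in>{N..}. \<Union>k. {g \<in> Y. c M k < cmod (g (Z M k))})"
        unfolding top A_def by blast
    qed
    ultimately show "closedin (AH0 G a) A" by (auto simp: closedin_def top A_def)
    fix g assume "g \<in> topspace (AH0 G a)"
    then have g: "g \<in> Y" by (simp add: top)
    \<comment> \<open>For fixed M, g lies in some step k0 of \<open>E (K M)\<close>, and the
      majorants grow with k, so c bounds g up to a constant for k >= k0; the finitely many earlier
      points enter through a sum of quotients.\<close>
    have "\<exists>D\<ge>0. \<forall>k. cmod (g (Z M k)) \<le> D * c M k" if M: "M \<ge> N" for M
    proof -
      obtain k0 where k0: "g \<in> Ha0 G (a (K M) k0)" using Y_E[OF g, of "K M"] by (auto simp: E_def)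
      define C where "C = wnorm G (a (K M) k0) g + 1"
      have C: "C \<ge> 0" using wnorm_nonneg[OF G weight k0] by (simp add: C_def)
      define D where "D = C + (\<Sum>k<k0. cmod (g (Z M k)) / c M k)"
      have terms: "0 \<le> cmod (g (Z M k)) / c M k" for k using c_pos[OF M, of k] by simp
      then have D: "C \<le> D" using sum_nonneg[of "{..<k0}" "\<lambda>k. cmod (g (Z M k)) / c M k"] by (simp add: D_def)
      have "cmod (g (Z M k)) \<le> D * c M k" for k
      proof (cases "k < k0")
        case True
        have "cmod (g (Z M k)) / c M k \<le> (\<Sum>k<k0. cmod (g (Z M k)) / c M k)"
          using True terms by (intro member_le_sum) auto
        also have "\<dots> \<le> D" using C by (simp add: D_def)
        finally show ?thesis using c_pos[OF M, of k] by (simp add: field_simps)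
      next
        case False
        have "cmod (g (Z M k)) \<le> C * u (K M) k0 (Z M k)"
          unfolding C_def by (rule growth[OF k0 Z(1)[OF M]])
        also have "\<dots> \<le> C * c M k"
          using u_mono[of k0 k "Z M k" "K M"] False Z(1)[OF M] C by (intro mult_left_mono) (auto simp: c_def)
        also have "\<dots> \<le> D * c M k" using D c_pos[OF M, of k] by (intro mult_right_mono) auto
        finally show ?thesis .
      qed
      then show ?thesis using C D by (intro exI[of _ D]) auto
    qed
    then obtain D where D: "\<And>M. M \<ge> N \<Longrightarrow> D M \<ge> 0" "\<And>M k. M \<ge> N \<Longrightarrow> cmod (g (Z M k)) \<le> D M * c M k"
      by metis
    \<comment> \<open>g lies in one step n0 of \<open>E N\<close>. For M >= n0 the term
      \<open>u N M\<close> in c bounds g with a constant independent of M and k; for the finitely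
      many smaller M the constants D M are added.\<close>
    obtain n0 where n0: "g \<in> Ha0 G (a N n0)" using Y_E[OF g, of N] by (auto simp: E_def)
    define C where "C = wnorm G (a N n0) g + 1"
    have C: "C > 0" using wnorm_nonneg[OF G weight n0] by (simp add: C_def)
    define R where "R = C + (\<Sum>M=N..<n0. D M)"
    have R: "R \<ge> C" using D(1) by (auto simp: R_def intro!: sum_nonneg)
    have bound: "cmod (g (Z M k)) \<le> R * c M k" if M: "M \<ge> N" for M k
    proof (cases "M < n0")
      case True
      then have "D M \<le> (\<Sum>M=N..<n0. D M)" using M D(1) by (intro member_le_sum) auto
      then have "D M \<le> R" using C by (simp add: R_def)
      then have "D M * c M k \<le> R * c M k" using c_pos[OF M, of k] by (intro mult_right_mono) auto
      then show ?thesis using D(2)[OF M, of k] by simp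
    next
      case False
      have "cmod (g (Z M k)) \<le> C * u N n0 (Z M k)" unfolding C_def by (rule growth[OF n0 Z(1)[OF M]])
      also have "\<dots> \<le> C * c M k"
        using u_mono[of n0 M "Z M k" N] False Z(1)[OF M] C by (intro mult_left_mono) (auto simp: c_def)
      also have "\<dots> \<le> R * c M k" using R c_pos[OF M, of k] by (intro mult_right_mono) auto
      finally show ?thesis .
    qed
    show "cfun.absorbs A {g}"
      unfolding cfun.absorbs_iff[OF conv]
    proof (intro exI[of _ "inverse R"] conjI ballI)
      show R0: "inverse R > 0" using R C by simp
      fix h assume "h \<in> {g}"
      then have h: "h = g" by simp
      have "cmod (complex_of_real (inverse R) * g (Z M k)) \<le> c M k" if "M \<ge> N" for M k
      proof -
        have "inverse R * cmod (g (Z M k)) \<le> c M k" using bound[OF that, of k] R C by (simp add: field_simps)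
        then show ?thesis using R0 by (simp only: norm_mult norm_of_real)
      qed
      moreover have "(\<lambda>z. complex_of_real (inverse R) * g z) \<in> Y" by (rule cfun.subspace_scale[OF subspace_Y g])
      ultimately show "(\<lambda>z. complex_of_real (inverse R) * h z) \<in> A" by (simp add: A_def h)
    qed
  qed
  then have "cfun.zero_nbhd (cfun.projective_limit T) A"
    using barrelled unfolding cfun.barrelled_def limit_eq by blast
  from zero_nbhd_limitD[OF this] obtain M0 where M0: "\<And>M n. M \<ge> M0 \<Longrightarrow>
      \<exists>e>0. \<forall>x\<in>Ha0 G (a M n) \<inter> Y. wnorm G (a M n) x < e \<longrightarrow> x \<in> A" by blast
  \<comment> \<open>The neighbourhood property holds from M0 on, while the points are defined from N
    on; one M satisfying both is enough for the contradiction.\<close>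
  define M where "M = max M0 N"
  have M: "M \<ge> N" "M \<ge> M0" by (auto simp: M_def)
  obtain e where e: "e > 0" "\<And>x. x \<in> Ha0 G (a M (m M)) \<Longrightarrow> x \<in> Y \<Longrightarrow> wnorm G (a M (m M)) x < e \<Longrightarrow> x \<in> A"
    using M0[OF M(2), of "m M"] by blast
  \<comment> \<open>A polynomial in the unit ball of the step \<open>m M\<close>, scaled by e/2,
    lies in the limit space and in the zero neighbourhood, hence in A, and so obeys the bound c at
    the chosen points. The majorant inherits this bound with the factor 2/e, which does not depend
    on k.\<close>
  have "u M (m M) (Z M k) \<le> 2 / e * c M k" for k
    unfolding u_def
  proof (rule wtilde_via_polynomials[OF G(1) balG Z(1)[OF M(1)] weight rad])
    fix q :: "complex ^ 'd \<Rightarrow> complex"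
    assume q: "q \<in> polynomials" "\<And>\<zeta>. \<zeta> \<in> G \<Longrightarrow> a M (m M) \<zeta> * cmod (q \<zeta>) \<le> 1"
    have qH: "zero_ext G q \<in> Ha0 G (a N' n)" for N' n using poly q(1) by blast
    define x where "x = (\<lambda>z. complex_of_real (e/2) * zero_ext G q z)"
    have x: "x \<in> Ha0 G (a N' n)" for N' n unfolding x_def by (rule cfun.subspace_scale[OF Ha0_subspace[OF G weight] qH])
    have x_val: "cmod (x \<zeta>) = e/2 * cmod (q \<zeta>)" if "\<zeta> \<in> G" for \<zeta>
      using that e(1) unfolding x_def zero_ext_def by (simp only: norm_mult norm_of_real) simp
    have "x \<in> Y" using x by (auto simp: Y_def E_def)
    moreover have "wnorm G (a M (m M)) x \<le> e/2"
    proof (rule wnorm_least[OF G weight])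
      fix \<zeta> assume \<zeta>: "\<zeta> \<in> G"
      have "a M (m M) \<zeta> * cmod (x \<zeta>) = e/2 * (a M (m M) \<zeta> * cmod (q \<zeta>))" using x_val[OF \<zeta>] by simp
      also have "\<dots> \<le> e/2 * 1" using q(2)[OF \<zeta>] e(1) by (intro mult_left_mono) auto
      finally show "a M (m M) \<zeta> * cmod (x \<zeta>) \<le> e/2" by simp
    qed
    ultimately have "x \<in> A" using e x by auto
    then have "cmod (x (Z M k)) \<le> c M k" using M by (simp add: A_def)
    then show "cmod (q (Z M k)) \<le> 2 / e * c M k"
      using x_val[OF Z(1)[OF M(1)], of k] e(1) by (simp add: field_simps)
  qed
  \<comment> \<open>The points were chosen to violate the inequality with the factor k + 1, which
    eventually exceeds 2/e.\<close>
  moreover obtain k where "2 / e < real (Suc k)" using reals_Archimedean2 by (meson less_trans lessI of_nat_less_iff)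
  then have "2 / e * c M k < real (Suc k) * c M k" using c_pos[OF M(1), of k] by (rule mult_strict_right_mono)
  ultimately show False using Z(2)[OF M(1), of k] unfolding c_def[symmetric] by (meson less_asym' less_le_trans order_less_le_trans)
qed

end

theorem theorem3p1:
  fixes G :: "(complex ^ 'd) set"
    and a :: "nat \<Rightarrow> nat \<Rightarrow> complex ^ 'd \<Rightarrow> real"
  assumes "open G" and "G \<noteq> {}"
    and "weight_double_sequence G a"
    and "balanced_setting G a"
  shows "(Proj1_is_zero (\<lambda>N. topspace (A0H G a N)) \<longrightarrow> cfun.ultrabornological (AH0 G a)) \<and>
         (cfun.ultrabornological (AH0 G a) \<longrightarrow> cfun.barrelled (AH0 G a)) \<and>
         (cfun.barrelled (AH0 G a) \<longrightarrow> wQ_in_tilde G a)"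
proof -
  interpret weighted_plb G a by unfold_locales (rule assms)+
  show ?thesis
    using Proj1_zero_imp_ultrabornological cfun.ultrabornological_imp_barrelled[of "AH0 G a"]
      barrelled_imp_wQ[OF assms(4)]
    by (simp add: limit_eq E_eq)
qed

end
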